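(* Let $\delta\in(0,1)$, $\gamma_u>1$, $0<\rho_*\le\rho^*<\infty$, $\rho_c>0$, and let $c_{\rm LSE}>0$ (depending only on $\rho_*,\rho^*$) and $C_{\rm LSE}>0$ be suitable constants; let also $c_0,K>0$ be suitable constants depending only on $\rho_*$. Consider a sequence of problems indexed by $n\to\infty$ in which $\lambda\sqrt s=o(1)$, the LSE condition holds with constants $\rho_*,\rho^*,c_{\rm LSE},C_{\rm LSE}$ and radius $r$, $\mathrm{w}\in\mathcal T$ with $\mathrm{w}(u)\ge1/2$ for $u=18\rho_*^{-1}\delta^{-1}\lambda$, the gradient $\nabla\mathcal L$ is $\rho_c$-Lipschitz (in $\ell_2$ norm) on $B_2(R/2,\boldsymbol\beta^* )$ with $R=K(\|\boldsymbol\beta^*\|_2+\lambda\sqrt s)$, and $$4\big(\|\nabla\mathcal L(\boldsymbol\beta^* )\|_\infty+\max\{\varepsilon_t,\varepsilon_c\}\big)\le\lambda\le c_0\,\frac r{\sqrt s}.$$ Let $0<\varepsilon_c\lesssim\lambda$, $0<\varepsilon_t\lesssim\sqrt{1/n}$ and $T\asymp\log(\lambda\sqrt n)$. Then there are positive constants $C',C''$ (depending only on the fixed constants above and an upper bound on $\|\boldsymbol\beta^*\|_2$, and not on $n,d,s,\varepsilon_c,\varepsilon_t$) such that, for all sufficiently large $n$, the algorithm described in the context produces approximate solutions with $\omega_{\boldsymbol\lambda^{(0)}}(\widetilde{\boldsymbol\beta}^{(1)})\le\varepsilon_c$ and $\omega_{\boldsymbol\lambda^{(k-1)}}(\widetilde{\boldsymbol\beta}^{(k)})\le\varepsilon_t$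 for $2\le k\le T$ using a total number of LAMM iterations of at most $$C'\,\frac1{\varepsilon_c^2}+C''\,(T-1)\log\Big(\frac1{\varepsilon_t}\Big).$$
   Context: Setting. $\boldsymbol\beta^*\in\mathbb R^d$ is the true parameter, $S=\mathrm{supp}(\boldsymbol\beta^* )$, $s=|S|\ge1$; $n$ is the sample size. $a\lesssim b$ means $a\le Kb$ and $a\asymp b$ means $K^{-1}b\le a\le Kb$ for a constant $K>0$ not depending on $n,d,s$. $\mathbf v_I$ keeps the coordinates of $\mathbf v$ in $I$ and sets the others to $0$; $\odot$ is the entrywise product; $B_2(r,\boldsymbol\beta^* )=\{\boldsymbol\beta:\|\boldsymbol\beta-\boldsymbol\beta^*\|_2\le r\}$. The loss $\mathcal L:\mathbb R^d\to\mathbb R$ is convex, with continuous gradient that is differentiable on $B_2(r,\boldsymbol\beta^* )$. Localized sparse eigenvalues: $\rho_+(m,r)$ and $\rho_-(m,r)$ are the supremum and infimum of $\mathbf u_J^{T}\nabla^2\mathcal L(\boldsymbol\beta)\mathbf u_J$ over $\|\mathbf u_J\|_2=1$, $|J|\le m$, $\|\boldsymbol\beta-\boldsymbol\beta^*\|_2\le r$. LSE condition with constants $\rho_*,\rho^*,c_{\rm LSE},C_{\rm LSE}$ and radius $r$: there is an integer $\widetilde s\ge c_{\rm LSE}s$ with $0<\rho_*\le\rho_-(2s+2\widetilde s,r)<\rho_+(2s+2\widetilde s,r)\le\rho^*<\infty$ and $\rho_+(\widetilde s,r)/\rho_-(2s+2\widetilde s,r)\le1+C_{\rm LSE}\,\widetilde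 s/s$. Tightening class $\mathcal T$: functions $\mathrm{w}:\mathbb R\to\mathbb R$ with $\mathrm{w}(t_1)\le\mathrm{w}(t_2)$ for $t_1\ge t_2\ge0$, $0\le\mathrm{w}(t)\le1$ for $t\ge0$, and $\mathrm{w}(t)=1$ for $t\le0$. Algorithm (I-LAMM). $\lambda>0$, $\widetilde{\boldsymbol\beta}^{(0)}=\mathbf 0$, $\boldsymbol\lambda^{(\ell-1)}=(\lambda\mathrm{w}(|\widetilde\beta^{(\ell-1)}_j|))_{j=1}^d$ (so $\boldsymbol\lambda^{(0)}=\lambda\mathbf 1$). For a weight vector $\boldsymbol\lambda$: $F(\boldsymbol\beta,\boldsymbol\lambda)=\mathcal L(\boldsymbol\beta)+\sum_j\lambda_j|\beta_j|$ and $\omega_{\boldsymbol\lambda}(\boldsymbol\beta)=\min_{\boldsymbol\xi\in\partial\|\boldsymbol\beta\|_1}\|\nabla\mathcal L(\boldsymbol\beta)+\boldsymbol\lambda\odot\boldsymbol\xi\|_\infty$. For $\phi>0$, $$\Psi_{\boldsymbol\lambda,\phi}(\boldsymbol\beta;\boldsymbol\beta')=\mathcal L(\boldsymbol\beta')+\langle\nabla\mathcal L(\boldsymbol\beta'),\boldsymbol\beta-\boldsymbol\beta'\rangle+\tfrac{\phi}{2}\|\boldsymbol\beta-\boldsymbol\beta'\|_2^2+\sum_j\lambda_j|\beta_j|,$$ whose unique minimizer in $\boldsymbol\beta$ is $T_{\boldsymbol\lambda,\phi}(\boldsymbol\beta')=\big(\mathrm{sign}(z_j)\max\{|z_j|-\lambda_j/\phi,0\}\big)_j$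 with $\mathbf z=\boldsymbol\beta'-\phi^{-1}\nabla\mathcal L(\boldsymbol\beta')$. The parameters are $\gamma_u>1$ and a sufficiently small $\phi_0>0$. For $\ell=1,\dots,T$: set $\boldsymbol\beta^{(\ell,0)}=\widetilde{\boldsymbol\beta}^{(\ell-1)}$, and let $\phi^{(\ell,0)}$ be the last value of $\phi$ used in problem $\ell-1$ ($\phi^{(1,0)}=\phi_0$). One LAMM iteration passes from $(\boldsymbol\beta^{(\ell,k-1)},\phi^{(\ell,k-1)})$ to $(\boldsymbol\beta^{(\ell,k)},\phi^{(\ell,k)})$: start with $\phi=\max\{\phi_0,\gamma_u^{-1}\phi^{(\ell,k-1)}\}$ and repeatedly replace $\phi$ by $\gamma_u\phi$ until $\boldsymbol\beta=T_{\boldsymbol\lambda^{(\ell-1)},\phi}(\boldsymbol\beta^{(\ell,k-1)})$ satisfies $F(\boldsymbol\beta,\boldsymbol\lambda^{(\ell-1)})\le\Psi_{\boldsymbol\lambda^{(\ell-1)},\phi}(\boldsymbol\beta;\boldsymbol\beta^{(\ell,k-1)})$; put $\boldsymbol\beta^{(\ell,k)}=\boldsymbol\beta$, $\phi^{(\ell,k)}=\phi$. Problem $\ell$ stops at the first $k$ with $\omega_{\boldsymbol\lambda^{(\ell-1)}}(\boldsymbol\beta^{(\ell,k)})\le\varepsilon$, where $\varepsilon=\varepsilon_c$ for $\ell=1$ and $\varepsilon=\varepsilon_t$ for $\ell\ge2$, and $\widetilde{\boldsymbol\beta}^{(\ell)}=\boldsymbol\beta^{(\ell,k)}$. *)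

theory Defs
  imports "HOL-Analysis.Analysis"
begin

section \<open>The spaces \<open>\<real>\<^sup>d\<close>, \<open>d\<close> a variable\<close>

text \<open>
  The dimension changes along the sequence of problems, so it cannot be a type. All the spaces
  \<open>\<real>\<^sup>d\<close> are realised as subspaces \<open>Euc d\<close> of the inner product space of finitely supported
  real sequences, coordinates being numbered \<open>0, \<dots>, d - 1\<close>. The norm is the Euclidean norm, and
  differentiation in \<open>\<real>\<^sup>d\<close> is differentiation \<open>at x within Euc d\<close>.
\<close>

typedef fvec = "{v :: nat \<Rightarrow> real. finite {i. v i \<noteq> 0}}"
  morphisms entry Abs_fvec
  by (rule exI[of _ "\<lambda>_. 0"]) simp

setup_lifting type_definition_fvec

notation entry (infixl "$." 90)

lemma finite_entry: "finite {i. v $. i \<noteq> 0}"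
  using entry[of v] by simp

lemma fvec_eqI: "(\<And>i. v $. i = w $. i) \<Longrightarrow> v = w"
  by (metis entry_inject ext)

instantiation fvec :: real_vector
begin

lift_definition zero_fvec :: fvec is "\<lambda>_. 0" by simp

lift_definition plus_fvec :: "fvec \<Rightarrow> fvec \<Rightarrow> fvec" is "\<lambda>v w i. v i + w i"
  subgoal for v w by (rule finite_subset[of _ "{i. v i \<noteq> 0} \<union> {i. w i \<noteq> 0}"]) auto
  done

lift_definition uminus_fvec :: "fvec \<Rightarrow> fvec" is "\<lambda>v i. - v i" by simp

lift_definition minus_fvec :: "fvec \<Rightarrow> fvec \<Rightarrow> fvec" is "\<lambda>v w i. v i - w i"
  subgoal for v w by (rule finite_subset[of _ "{i. v i \<noteq> 0} \<union> {i. w i \<noteq> 0}"]) auto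
  done

lift_definition scaleR_fvec :: "real \<Rightarrow> fvec \<Rightarrow> fvec" is "\<lambda>a v i. a * v i"
  by (erule rev_finite_subset) auto

instance
  by standard (transfer; simp add: algebra_simps)+

end

lemma entry_simps [simp]:
  "(0 :: fvec) $. i = 0" "(v + w) $. i = v $. i + w $. i" "(- v) $. i = - (v $. i)"
  "(v - w) $. i = v $. i - w $. i" "(a *\<^sub>R v) $. i = a * v $. i"
  by (transfer; simp)+

instantiation fvec :: real_inner
begin

definition inner_fvec :: "fvec \<Rightarrow> fvec \<Rightarrow> real" where
  "inner_fvec v w = (\<Sum>i | v $. i \<noteq> 0. v $. i * w $. i)"

definition norm_fvec :: "fvec \<Rightarrow> real" where
  "norm_fvec v = sqrt (inner v v)"

definition dist_fvec :: "fvec \<Rightarrow> fvec \<Rightarrow> real" where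
  "dist_fvec v w = norm (v - w)"

definition sgn_fvec :: "fvec \<Rightarrow> fvec" where
  "sgn_fvec v = v /\<^sub>R norm v"

definition uniformity_fvec :: "(fvec \<times> fvec) filter" where
  "uniformity_fvec = (INF e\<in>{0<..}. principal {(x, y). dist x y < e})"

definition open_fvec :: "fvec set \<Rightarrow> bool" where
  "open_fvec U \<longleftrightarrow> (\<forall>x\<in>U. \<forall>\<^sub>F (x', y) in uniformity. x' = x \<longrightarrow> y \<in> U)"

lemma inner_fvec_superset:
  "finite A \<Longrightarrow> {i. v $. i \<noteq> 0} \<subseteq> A \<Longrightarrow> inner v w = (\<Sum>i\<in>A. v $. i * w $. i)"
  unfolding inner_fvec_def by (rule sum.mono_neutral_left) auto

instance
proof
  fix x y z :: fvec and r :: real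
  show "dist x y = norm (x - y)" by (rule dist_fvec_def)
  show "sgn x = x /\<^sub>R norm x" by (rule sgn_fvec_def)
  show "uniformity = (INF e\<in>{0<..}. principal {(x, y :: fvec). dist x y < e})"
    by (rule uniformity_fvec_def)
  show "open U \<longleftrightarrow> (\<forall>x\<in>U. \<forall>\<^sub>F (x', y) in uniformity. x' = x \<longrightarrow> y \<in> U)" for U :: "fvec set"
    by (rule open_fvec_def)
  show "norm x = sqrt (inner x x)" by (rule norm_fvec_def)
  define A where "A = {i. x $. i \<noteq> 0} \<union> {i. y $. i \<noteq> 0}"
  have A: "finite A" "{i. x $. i \<noteq> 0} \<subseteq> A" "{i. y $. i \<noteq> 0} \<subseteq> A"
    "{i. (x + y) $. i \<noteq> 0} \<subseteq> A" "{i. (r *\<^sub>R x) $. i \<noteq> 0} \<subseteq> A"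
    by (auto simp: A_def finite_entry)
  note eqs = A(2-)[THEN inner_fvec_superset[OF A(1)]]
  show "inner x y = inner y x"
    by (simp add: eqs mult.commute)
  show "inner (x + y) z = inner x z + inner y z"
    by (simp only: eqs) (simp add: algebra_simps sum.distrib)
  show "inner (r *\<^sub>R x) y = r * inner x y"
    by (simp only: eqs) (simp add: algebra_simps sum_distrib_left)
  show "0 \<le> inner x x"
    by (simp add: inner_fvec_def sum_nonneg)
  show "inner x x = 0 \<longleftrightarrow> x = 0"
  proof
    assume "inner x x = 0"
    hence "x $. i * x $. i = 0" if "x $. i \<noteq> 0" for i
      using that unfolding inner_fvec_def
      by (subst (asm) sum_nonneg_eq_0_iff) (auto simp: finite_entry)
    thus "x = 0" by (intro fvec_eqI) force
  qed (simp add: inner_fvec_def)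
qed

end

definition Euc :: "nat \<Rightarrow> fvec set" where
  "Euc d = {v. \<forall>i\<ge>d. v $. i = 0}"

lift_definition mkvec :: "nat \<Rightarrow> (nat \<Rightarrow> real) \<Rightarrow> fvec" is
  "\<lambda>d f i. if i < d then f i else 0"
  by (rule finite_subset[of _ "{..<_}"]) auto

lemma entry_mkvec [simp]: "mkvec d f $. i = (if i < d then f i else 0)"
  by transfer simp

lemma inner_Euc: "v \<in> Euc d \<Longrightarrow> inner v w = (\<Sum>i<d. v $. i * w $. i)"
  by (rule inner_fvec_superset) (auto simp: Euc_def not_le[symmetric])

lemma norm_Euc: "v \<in> Euc d \<Longrightarrow> norm v = L2_set (entry v) {..<d}"
  by (simp add: norm_eq_sqrt_inner inner_Euc L2_set_def power2_eq_square)

definition supp :: "fvec \<Rightarrow> nat set" where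
  "supp v = {j. v $. j \<noteq> 0}"

lift_definition restr :: "fvec \<Rightarrow> nat set \<Rightarrow> fvec" is "\<lambda>v I i. if i \<in> I then v i else 0"
  by (erule rev_finite_subset) auto

definition hadamard :: "nat \<Rightarrow> fvec \<Rightarrow> fvec \<Rightarrow> fvec" where
  "hadamard d v w = mkvec d (\<lambda>j. v $. j * w $. j)"

definition l1_norm :: "nat \<Rightarrow> fvec \<Rightarrow> real" where
  "l1_norm d v = (\<Sum>j<d. \<bar>v $. j\<bar>)"

definition linf_norm :: "nat \<Rightarrow> fvec \<Rightarrow> real" where
  "linf_norm d v = (MAX j\<in>{..<d}. \<bar>v $. j\<bar>)"


section \<open>The loss and its localized sparse eigenvalues\<close>

definition grad :: "nat \<Rightarrow> (fvec \<Rightarrow> real) \<Rightarrow> fvec \<Rightarrow> fvec" where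
  "grad d f x = (THE g. g \<in> Euc d \<and> (f has_derivative (\<lambda>h. inner g h)) (at x within Euc d))"

lemma grad_eqI:
  assumes x: "x \<in> Euc d" and g: "g \<in> Euc d"
    and der: "(f has_derivative (\<lambda>h. inner g h)) (at x within Euc d)"
  shows "grad d f x = g"
  unfolding grad_def
proof (rule the_equality)
  fix g' assume g': "g' \<in> Euc d \<and> (f has_derivative (\<lambda>h. inner g' h)) (at x within Euc d)"
  define h where "h = g' - g"
  have line: "(\<lambda>t. x + t *\<^sub>R h) ` UNIV \<subseteq> Euc d"
    using x g g' by (auto simp: h_def Euc_def)
  have comp: "((\<lambda>t. f (x + t *\<^sub>R h)) has_derivative (\<lambda>t. inner k (t *\<^sub>R h))) (at 0)"
    if "(f has_derivative (\<lambda>h. inner k h)) (at x within Euc d)" for k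
  proof -
    have "((\<lambda>t. x + t *\<^sub>R h) has_derivative (\<lambda>t. t *\<^sub>R h)) (at 0)"
      by (auto intro!: derivative_eq_intros)
    moreover have "(f has_derivative (\<lambda>h. inner k h)) (at (x + 0 *\<^sub>R h) within (\<lambda>t. x + t *\<^sub>R h) ` UNIV)"
      using has_derivative_subset[OF that line] by simp
    ultimately show ?thesis
      by (rule has_derivative_in_compose)
  qed
  have "(\<lambda>t. inner g' (t *\<^sub>R h)) = (\<lambda>t. inner g (t *\<^sub>R h))"
    by (rule has_derivative_unique[OF comp comp]) (use g' der in auto)
  from fun_cong[OF this, of 1] have "inner h h = 0"
    by (simp add: h_def inner_diff_left)
  thus "g' = g" by (simp add: h_def)
qed (use g der in auto)

text \<open>
  The Frechet derivative within the subspace \<open>Euc d\<close> is determined on \<open>Euc d\<close> only; the quadratic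
  form is used only for \<open>u \<in> Euc d\<close>.
\<close>

definition hess_form :: "nat \<Rightarrow> (fvec \<Rightarrow> real) \<Rightarrow> fvec \<Rightarrow> fvec \<Rightarrow> real" where
  "hess_form d f x u = inner u (frechet_derivative (grad d f) (at x within Euc d) u)"

definition regular_loss :: "nat \<Rightarrow> (fvec \<Rightarrow> real) \<Rightarrow> fvec \<Rightarrow> real \<Rightarrow> bool" where
  "regular_loss d L bs r \<longleftrightarrow>
     convex_on (Euc d) L \<and>
     L differentiable_on Euc d \<and>
     continuous_on (Euc d) (grad d L) \<and>
     (\<forall>b \<in> cball bs r \<inter> Euc d. grad d L differentiable (at b within Euc d))"

definition hess_values :: "nat \<Rightarrow> (fvec \<Rightarrow> real) \<Rightarrow> fvec \<Rightarrow> nat \<Rightarrow> real \<Rightarrow> real set" where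
  "hess_values d L bs m r =
     {hess_form d L b (restr u J) | b u J.
        b \<in> cball bs r \<inter> Euc d \<and> u \<in> Euc d \<and> J \<subseteq> {..<d} \<and> card J \<le> m \<and> norm (restr u J) = 1}"

text \<open>Extended reals, so that an unbounded set of values has an infinite supremum.\<close>

definition rho_plus :: "nat \<Rightarrow> (fvec \<Rightarrow> real) \<Rightarrow> fvec \<Rightarrow> nat \<Rightarrow> real \<Rightarrow> ereal" where
  "rho_plus d L bs m r = Sup (ereal ` hess_values d L bs m r)"

definition rho_minus :: "nat \<Rightarrow> (fvec \<Rightarrow> real) \<Rightarrow> fvec \<Rightarrow> nat \<Rightarrow> real \<Rightarrow> ereal" where
  "rho_minus d L bs m r = Inf (ereal ` hess_values d L bs m r)"

definition LSE :: "nat \<Rightarrow> (fvec \<Rightarrow> real) \<Rightarrow> fvec \<Rightarrow> real \<Rightarrow> real \<Rightarrow> real \<Rightarrow> real \<Rightarrow> real \<Rightarrow> bool" where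
  "LSE d L bs r rho_lo rho_hi c C \<longleftrightarrow>
     (let s = card (supp bs) in
      \<exists>st :: nat.
        c * real s \<le> real st \<and>
        0 < rho_lo \<and>
        ereal rho_lo \<le> rho_minus d L bs (2 * s + 2 * st) r \<and>
        rho_minus d L bs (2 * s + 2 * st) r < rho_plus d L bs (2 * s + 2 * st) r \<and>
        rho_plus d L bs (2 * s + 2 * st) r \<le> ereal rho_hi \<and>
        rho_plus d L bs st r / rho_minus d L bs (2 * s + 2 * st) r
          \<le> ereal (1 + C * real st / real s))"

definition tightening :: "(real \<Rightarrow> real) set" where
  "tightening =
     {w. (\<forall>t1 t2. t1 \<ge> t2 \<and> t2 \<ge> 0 \<longrightarrow> w t1 \<le> w t2) \<and>
         (\<forall>t\<ge>0. 0 \<le> w t \<and> w t \<le> 1) \<and>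
         (\<forall>t\<le>0. w t = 1)}"


section \<open>The algorithm\<close>

definition weights :: "nat \<Rightarrow> (real \<Rightarrow> real) \<Rightarrow> real \<Rightarrow> fvec \<Rightarrow> fvec" where
  "weights d w lam b = mkvec d (\<lambda>j. lam * w \<bar>b $. j\<bar>)"

definition objF :: "nat \<Rightarrow> (fvec \<Rightarrow> real) \<Rightarrow> fvec \<Rightarrow> fvec \<Rightarrow> real" where
  "objF d L lw b = L b + (\<Sum>j<d. lw $. j * \<bar>b $. j\<bar>)"

definition l1_subdiff :: "nat \<Rightarrow> fvec \<Rightarrow> fvec set" where
  "l1_subdiff d b =
     {xi \<in> Euc d. \<forall>b' \<in> Euc d. l1_norm d b' \<ge> l1_norm d b + inner xi (b' - b)}"

text \<open>The infimum is a minimum, the subdifferential being nonempty and compact.\<close>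

definition omega :: "nat \<Rightarrow> (fvec \<Rightarrow> real) \<Rightarrow> fvec \<Rightarrow> fvec \<Rightarrow> real" where
  "omega d L lw b = (INF xi \<in> l1_subdiff d b. linf_norm d (grad d L b + hadamard d lw xi))"

definition Psi :: "nat \<Rightarrow> (fvec \<Rightarrow> real) \<Rightarrow> fvec \<Rightarrow> real \<Rightarrow> fvec \<Rightarrow> fvec \<Rightarrow> real" where
  "Psi d L lw phi b b' =
     L b' + inner (grad d L b') (b - b') + phi / 2 * (norm (b - b'))\<^sup>2
       + (\<Sum>j<d. lw $. j * \<bar>b $. j\<bar>)"

definition T_op :: "nat \<Rightarrow> (fvec \<Rightarrow> real) \<Rightarrow> fvec \<Rightarrow> real \<Rightarrow> fvec \<Rightarrow> fvec" where
  "T_op d L lw phi b' =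
     (let z = b' - (1 / phi) *\<^sub>R grad d L b'
      in mkvec d (\<lambda>j. sgn (z $. j) * max (\<bar>z $. j\<bar> - lw $. j / phi) 0))"

definition accepts :: "nat \<Rightarrow> (fvec \<Rightarrow> real) \<Rightarrow> fvec \<Rightarrow> fvec \<Rightarrow> real \<Rightarrow> bool" where
  "accepts d L lw b' phi \<longleftrightarrow>
     objF d L lw (T_op d L lw phi b') \<le> Psi d L lw phi (T_op d L lw phi b') b'"

text \<open>
  The algorithm is rendered by (deterministic) relations, so that the existence of a successor
  includes the termination of the line search, and the existence of a run its termination.
  A state is a pair of the current iterate and the current quadratic parameter.
\<close>

definition lamm_step ::
  "nat \<Rightarrow> (fvec \<Rightarrow> real) \<Rightarrow> fvec \<Rightarrow> real \<Rightarrow> real \<Rightarrow> fvec \<times> real \<Rightarrow> fvec \<times> real \<Rightarrow> bool" where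
  "lamm_step d L lw gu phi0 st st' \<longleftrightarrow>
     (\<exists>m. snd st' = gu ^ m * max phi0 (snd st / gu) \<and>
          accepts d L lw (fst st) (snd st') \<and>
          (\<forall>i<m. \<not> accepts d L lw (fst st) (gu ^ i * max phi0 (snd st / gu))) \<and>
          fst st' = T_op d L lw (snd st') (fst st))"

text \<open>The natural number is the number of LAMM iterations, zero if the initial point qualifies.\<close>

inductive solves ::
  "nat \<Rightarrow> (fvec \<Rightarrow> real) \<Rightarrow> fvec \<Rightarrow> real \<Rightarrow> real \<Rightarrow> real \<Rightarrow> fvec \<times> real \<Rightarrow> nat \<Rightarrow> fvec \<times> real \<Rightarrow> bool"
  for d L lw gu phi0 eps where
  stop: "omega d L lw (fst st) \<le> eps \<Longrightarrow> solves d L lw gu phi0 eps st 0 st"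
| step: "\<not> omega d L lw (fst st) \<le> eps \<Longrightarrow> lamm_step d L lw gu phi0 st st' \<Longrightarrow>
         solves d L lw gu phi0 eps st' k st'' \<Longrightarrow> solves d L lw gu phi0 eps st (Suc k) st''"

text \<open>
  \<open>bt l\<close>, \<open>ph l\<close> and \<open>N l\<close> are the output, the last quadratic parameter and the number of LAMM
  iterations of problem \<open>l\<close>. As \<open>w 0 = 1\<close>, the weights of problem 1 are all \<open>lam\<close>.
\<close>

definition ilamm_run ::
  "nat \<Rightarrow> (fvec \<Rightarrow> real) \<Rightarrow> (real \<Rightarrow> real) \<Rightarrow> real \<Rightarrow> real \<Rightarrow> real \<Rightarrow> real \<Rightarrow> real \<Rightarrow> nat \<Rightarrow>
   (nat \<Rightarrow> fvec) \<Rightarrow> (nat \<Rightarrow> real) \<Rightarrow> (nat \<Rightarrow> nat) \<Rightarrow> bool" where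
  "ilamm_run d L w lam gu phi0 eps_c eps_t T bt ph N \<longleftrightarrow>
     bt 0 = 0 \<and> ph 0 = phi0 \<and>
     (\<forall>l\<in>{1..T}.
        solves d L (weights d w lam (bt (l - 1))) gu phi0 (if l = 1 then eps_c else eps_t)
          (bt (l - 1), ph (l - 1)) (N l) (bt l, ph l))"


section \<open>Comparison of sequences up to a constant\<close>

definition lesssim :: "(nat \<Rightarrow> real) \<Rightarrow> (nat \<Rightarrow> real) \<Rightarrow> bool" where
  "lesssim a b \<longleftrightarrow> (\<exists>K>0. \<forall>\<^sub>F n in sequentially. a n \<le> K * b n)"

definition asymp_eq :: "(nat \<Rightarrow> real) \<Rightarrow> (nat \<Rightarrow> real) \<Rightarrow> bool" where
  "asymp_eq a b \<longleftrightarrow>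
     (\<exists>K>0. \<forall>\<^sub>F n in sequentially. inverse K * b n \<le> a n \<and> a n \<le> K * b n)"

end

theory Submission
  imports Defs
begin

text \<open>
  Write \<open>e = lam * sqrt s\<close> for the statistical rate and \<open>a\<close>, \<open>b\<close> for the bounds on the sparse
  eigenvalues. Everything rests on comparing points with the truth \<open>bs\<close> through the Bregman
  divergence of the loss.

  An approximate solution for admissible weights, and likewise any point whose objective is at most
  that of the truth, satisfies the basic inequality of Lasso theory: its Bregman divergence from
  the truth plus a multiple of its \<open>l1\<close> error off a set \<open>E\<close> of at most \<open>2 * s\<close> coordinates is
  bounded by a multiple of the \<open>l1\<close> error on \<open>E\<close>. The loss is strongly convex along such
  directions although they are not sparse (\<open>restricted_lower_bound\<close>), so the error is at most
  \<open>err = 10 * e / a\<close> (\<open>basic_error\<close>). By the condition on the tightening function, an error of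
  that size makes at most \<open>s\<close> false coordinates lose more than half of their weight, and the next
  problem has admissible weights again (\<open>good_weights_next\<close>).

  In the first problem the iterates start far away, and only the decrease of the objective is
  available. An accepted step satisfies the prox inequality, by which the distance to the truth does
  not grow while the objective exceeds its value there (\<open>distance_step\<close>). All iterates
  therefore stay where the gradient is Lipschitz, backtracking stops at \<open>phi \<le> gu * c\<close>, and
  cocoercivity bounds the squared stopping criterion by the decrease of the objective
  (\<open>omega_le_decrease\<close>). As the total decrease is bounded, there are \<open>O (1 / eps_c\<^sup>2)\<close> steps.

  The later problems start within distance \<open>err\<close> of the truth. There the objective grows
  quadratically away from its minimizer (\<open>quadratic_growth\<close>). At the minimizer the gradient is
  inactive by a margin \<open>lam / 8\<close> outside a set of \<open>O (s)\<close> coordinates; on the other coordinates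
  the penalty pays for whatever the missing sparsity of the iterate costs in the restricted lower
  bound. Growth and the prox inequality give linear convergence to the minimizer, with a rate that
  depends on \<open>a\<close>, \<open>c\<close> and \<open>gu\<close> alone, so that \<open>O (ln (1 / eps_t))\<close> steps suffice.
\<close>

section \<open>Vectors and restrictions to coordinate sets\<close>

lemma Euc_closed_ops [simp, intro]:
  "0 \<in> Euc d" "v \<in> Euc d \<Longrightarrow> w \<in> Euc d \<Longrightarrow> v + w \<in> Euc d"
  "v \<in> Euc d \<Longrightarrow> w \<in> Euc d \<Longrightarrow> v - w \<in> Euc d"
  "v \<in> Euc d \<Longrightarrow> - v \<in> Euc d" "v \<in> Euc d \<Longrightarrow> a *\<^sub>R v \<in> Euc d"
  "mkvec d f \<in> Euc d"
  by (auto simp: Euc_def)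

lemma entry_restr [simp]: "restr v I $. i = (if i \<in> I then v $. i else 0)"
  by transfer simp

lemma restr_Euc [simp, intro]: "v \<in> Euc d \<Longrightarrow> restr v I \<in> Euc d"
  by (auto simp: Euc_def)

lemma convex_Euc: "convex (Euc d)"
  by (auto simp: convex_def Euc_def)

lemma norm2_Euc: "v \<in> Euc d \<Longrightarrow> (norm v)\<^sup>2 = (\<Sum>i<d. (v $. i)\<^sup>2)"
  unfolding power2_norm_eq_inner by (simp add: inner_Euc power2_eq_square)

lemma norm2_restr:
  assumes "A \<subseteq> {..<d}"
  shows "(norm (restr v A))\<^sup>2 = (\<Sum>i\<in>A. (v $. i)\<^sup>2)"
proof -
  have "finite A" using assms finite_subset by blast
  then have "inner (restr v A) (restr v A) = (\<Sum>i\<in>A. restr v A $. i * restr v A $. i)"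
    by (intro inner_fvec_superset) auto
  then show ?thesis
    unfolding power2_norm_eq_inner by (simp add: power2_eq_square)
qed

lemma inner_restr:
  assumes "A \<subseteq> {..<d}"
  shows "inner w (restr v A) = (\<Sum>i\<in>A. w $. i * v $. i)"
proof -
  have "finite A" using assms finite_subset by blast
  then have "inner (restr v A) w = (\<Sum>i\<in>A. restr v A $. i * w $. i)"
    by (intro inner_fvec_superset) auto
  then show ?thesis by (simp add: inner_commute mult.commute)
qed

lemma norm_restr_le: "norm (restr v A) \<le> norm v"
proof -
  have "inner (restr v A) (restr v A) = (\<Sum>i | v $. i \<noteq> 0. restr v A $. i * restr v A $. i)"
    by (rule inner_fvec_superset) (auto simp: finite_entry)
  also have "\<dots> \<le> inner v v"
    unfolding inner_fvec_def by (rule sum_mono) auto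
  finally show ?thesis by (simp add: norm_eq_sqrt_inner)
qed

lemma abs_entry_le_norm: "\<bar>v $. i\<bar> \<le> norm v"
proof -
  have "(v $. i)\<^sup>2 = (norm (restr v {i}))\<^sup>2"
    by (subst norm2_restr[of "{i}" "Suc i"]) auto
  then show ?thesis using norm_restr_le[of v "{i}"]
    by (metis abs_ge_zero abs_norm_cancel norm_ge_zero power2_abs power2_eq_iff_nonneg)
qed

text \<open>Cauchy--Schwarz against the sign vector of \<open>A\<close>.\<close>

lemma l1_le_sqrt_card:
  assumes "A \<subseteq> {..<d}" "real (card A) \<le> k"
  shows "(\<Sum>j\<in>A. \<bar>v $. j\<bar>) \<le> sqrt k * norm (restr v A)"
proof -
  have "(\<Sum>j\<in>A. \<bar>v $. j\<bar>) \<le> L2_set (\<lambda>_. 1) A * L2_set (entry v) A"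
    using L2_set_mult_ineq[of "\<lambda>_. 1" "entry v" A] by simp
  also have "L2_set (entry v) A = norm (restr v A)"
    by (simp add: L2_set_def norm2_restr[OF assms(1), symmetric])
  also have "L2_set (\<lambda>_. 1 :: real) A = sqrt (card A)" by (simp add: L2_set_def)
  also have "sqrt (card A) * norm (restr v A) \<le> sqrt k * norm (restr v A)"
    using assms(2) by (intro mult_right_mono) auto
  finally show ?thesis .
qed

lemma card_large_le:
  assumes "A \<subseteq> {..<d}" "\<And>j. j \<in> A \<Longrightarrow> t \<le> \<bar>v $. j\<bar>" "0 \<le> t"
  shows "real (card A) * t\<^sup>2 \<le> (norm (restr v A))\<^sup>2"
proof -
  have "real (card A) * t\<^sup>2 = (\<Sum>j\<in>A. t\<^sup>2)" by simp
  also have "\<dots> \<le> (\<Sum>j\<in>A. (v $. j)\<^sup>2)"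
    using assms by (intro sum_mono) (metis power2_abs power_mono)
  finally show ?thesis by (simp add: norm2_restr[OF assms(1)])
qed

section \<open>Convex losses and their Bregman divergences\<close>

definition bregman :: "nat \<Rightarrow> (fvec \<Rightarrow> real) \<Rightarrow> fvec \<Rightarrow> fvec \<Rightarrow> real" where
  "bregman d L x y = L y - L x - inner (grad d L x) (y - x)"

locale convex_loss =
  fixes d :: nat and L :: "fvec \<Rightarrow> real"
  assumes conv: "convex_on (Euc d) L" and diff: "L differentiable_on Euc d"
begin

abbreviation g where "g \<equiv> grad d L"
abbreviation D where "D \<equiv> bregman d L"

text \<open>
  A derivative within \<open>Euc d\<close> is represented by its values on the unit vectors, and replacing it
  by that representation changes it only off \<open>Euc d\<close>.
\<close>

lemma grad_properties:
  assumes x: "x \<in> Euc d"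
  shows "g x \<in> Euc d \<and> (L has_derivative (\<lambda>h. inner (g x) h)) (at x within Euc d)"
proof -
  obtain D where D: "(L has_derivative D) (at x within Euc d)"
    using diff x unfolding differentiable_on_def differentiable_def by blast
  interpret D: bounded_linear D using D by (rule has_derivative_bounded_linear)
  define u where "u i = mkvec d (\<lambda>j. if j = i then 1 else 0)" for i
  define k where "k = mkvec d (\<lambda>i. D (u i))"
  have k: "k \<in> Euc d" by (simp add: k_def)
  have entry_sum: "(\<Sum>i\<in>A. f i) $. j = (\<Sum>i\<in>A. f i $. j)" if "finite A" for A :: "nat set" and f j
    using that by induction auto
  have eq: "D h = inner k h" if h: "h \<in> Euc d" for h
  proof -
    have "h = (\<Sum>i<d. h $. i *\<^sub>R u i)"
    proof (rule fvec_eqI)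
      fix j
      have "(\<Sum>i<d. h $. i *\<^sub>R u i) $. j = (\<Sum>i<d. if i = j then h $. i else 0)"
        unfolding entry_sum[OF finite_lessThan] by (intro sum.cong) (auto simp: u_def)
      also have "\<dots> = h $. j" using h by (auto simp: Euc_def)
      finally show "h $. j = (\<Sum>i<d. h $. i *\<^sub>R u i) $. j" by simp
    qed
    then have "D h = (\<Sum>i<d. D (h $. i *\<^sub>R u i))" by (metis D.sum)
    also have "\<dots> = (\<Sum>i<d. h $. i * D (u i))" by (simp add: D.scaleR)
    also have "\<dots> = inner k h" unfolding inner_Euc[OF k] by (simp add: k_def mult.commute)
    finally show ?thesis .
  qed
  have "(L has_derivative (\<lambda>h. inner k h)) (at x within Euc d)"
    using D unfolding has_derivative_within
  proof (elim conjE, intro conjI)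
    assume lim: "((\<lambda>y. (1 / norm (y - x)) *\<^sub>R (L y - (L x + D (y - x)))) \<longlongrightarrow> 0) (at x within Euc d)"
    show "((\<lambda>y. (1 / norm (y - x)) *\<^sub>R (L y - (L x + inner k (y - x)))) \<longlongrightarrow> 0) (at x within Euc d)"
    proof (rule Lim_transform_eventually[OF lim])
      show "\<forall>\<^sub>F y in at x within Euc d. (1 / norm (y - x)) *\<^sub>R (L y - (L x + D (y - x)))
              = (1 / norm (y - x)) *\<^sub>R (L y - (L x + inner k (y - x)))"
        unfolding eventually_at_filter by (rule always_eventually) (use x in \<open>auto simp: eq\<close>)
    qed
  qed (auto intro: bounded_linear_inner_right)
  moreover from this have "g x = k" by (rule grad_eqI[OF x k])
  ultimately show ?thesis using k by simp
qed

lemmas grad_Euc [simp, intro] = grad_properties[THEN conjunct1]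

lemma line_derivative:
  assumes "x \<in> Euc d" "h \<in> Euc d"
  shows "((\<lambda>t. L (x + t *\<^sub>R h)) has_real_derivative inner (g (x + t *\<^sub>R h)) h) (at t)"
proof -
  have line: "(\<lambda>t. x + t *\<^sub>R h) ` UNIV \<subseteq> Euc d" using assms by auto
  have "((\<lambda>t. x + t *\<^sub>R h) has_derivative (\<lambda>t. t *\<^sub>R h)) (at t)"
    by (auto intro!: derivative_eq_intros)
  moreover have "(L has_derivative (\<lambda>k. inner (g (x + t *\<^sub>R h)) k))
      (at (x + t *\<^sub>R h) within (\<lambda>t. x + t *\<^sub>R h) ` UNIV)"
    using grad_properties assms by (intro has_derivative_subset[OF _ line]) auto
  ultimately have "((\<lambda>t. L (x + t *\<^sub>R h)) has_derivative (\<lambda>s. inner (g (x + t *\<^sub>R h)) (s *\<^sub>R h))) (at t)"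
    by (rule has_derivative_in_compose)
  then show ?thesis
    by (simp add: has_field_derivative_def mult.commute[of _ "inner _ _"])
qed

lemma gradient_inequality:
  assumes "x \<in> Euc d" "y \<in> Euc d"
  shows "L x + inner (g x) (y - x) \<le> L y"
proof -
  define f where "f t = L (x + t *\<^sub>R (y - x))" for t
  have "convex_on UNIV f"
    unfolding convex_on_def
  proof (intro conjI ballI allI impI)
    fix s t u v :: real assume uv: "0 \<le> u" "0 \<le> v" "u + v = 1"
    have "x + (u *\<^sub>R s + v *\<^sub>R t) *\<^sub>R (y - x)
        = u *\<^sub>R (x + s *\<^sub>R (y - x)) + v *\<^sub>R (x + t *\<^sub>R (y - x))"
      using uv(3) by (simp add: algebra_simps flip: scaleR_add_left)
    then show "f (u *\<^sub>R s + v *\<^sub>R t) \<le> u * f s + v * f t"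
      unfolding f_def using conv uv assms unfolding convex_on_def by auto
  qed auto
  moreover have "(f has_real_derivative inner (g x) (y - x)) (at 0)"
    using line_derivative[of x "y - x" 0] assms by (simp add: f_def[abs_def])
  ultimately have "inner (g x) (y - x) * (1 - 0) \<le> f 1 - f 0"
    by (intro convex_on_imp_above_tangent[of UNIV]) auto
  then show ?thesis by (simp add: f_def)
qed

lemma bregman_nonneg: "x \<in> Euc d \<Longrightarrow> y \<in> Euc d \<Longrightarrow> 0 \<le> D x y"
  using gradient_inequality[of x y] by (simp add: bregman_def)

text \<open>The divergence in the reverse direction, which is nonnegative, is the difference of the two sides.\<close>

lemma bregman_le_inner:
  assumes "x \<in> Euc d" "y \<in> Euc d"
  shows "D x y \<le> inner (g y - g x) (y - x)"
  using gradient_inequality[OF assms(2,1)]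
  by (simp add: bregman_def inner_diff_left inner_diff_right)

text \<open>A Bregman divergence is convex in its second argument and vanishes on the diagonal.\<close>

lemma bregman_scale_le:
  assumes "x \<in> Euc d" "h \<in> Euc d" "0 \<le> t" "t \<le> 1"
  shows "D x (x + t *\<^sub>R h) \<le> t * D x (x + h)"
proof -
  have "x + t *\<^sub>R h = (1 - t) *\<^sub>R x + t *\<^sub>R (x + h)" by (simp add: algebra_simps)
  moreover have "L ((1 - t) *\<^sub>R x + t *\<^sub>R (x + h)) \<le> (1 - t) * L x + t * L (x + h)"
    using conv assms by (intro convex_onD) auto
  ultimately show ?thesis by (simp add: bregman_def algebra_simps)
qed

lemma continuous_loss: "continuous_on (Euc d) L"
  using diff by (rule differentiable_imp_continuous_on)

lemma descent:
  assumes U: "convex U" "U \<subseteq> Euc d" and lip: "c-lipschitz_on U g" and x: "x \<in> U" and y: "y \<in> U"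
  shows "D x y \<le> c / 2 * (norm (y - x))\<^sup>2"
proof -
  define h where "h = y - x"
  have xy: "x \<in> Euc d" "h \<in> Euc d" using x y U by (auto simp: h_def)
  define q where "q t = L x + t * inner (g x) h + c * t\<^sup>2 / 2 * (norm h)\<^sup>2 - L (x + t *\<^sub>R h)" for t :: real
  have "q 0 \<le> q 1"
  proof (rule DERIV_nonneg_imp_nondecreasing[of 0 1 q])
    fix t :: real assume t: "0 \<le> t" "t \<le> 1"
    define q' where "q' = inner (g x) h + c * t * (norm h)\<^sup>2 - inner (g (x + t *\<^sub>R h)) h"
    have "(q has_real_derivative q') (at t)"
      unfolding q_def[abs_def] q'_def
      by (rule derivative_eq_intros line_derivative xy refl | simp)+
    moreover have "inner (g (x + t *\<^sub>R h) - g x) h \<le> c * t * (norm h)\<^sup>2"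
    proof -
      have "x + t *\<^sub>R h = (1 - t) *\<^sub>R x + t *\<^sub>R y" by (simp add: h_def algebra_simps)
      then have "x + t *\<^sub>R h \<in> U" using convexD_alt[OF U(1) x y, of t] t by simp
      then have "norm (g (x + t *\<^sub>R h) - g x) \<le> c * norm (t *\<^sub>R h)"
        using lipschitz_onD[OF lip _ x, of "x + t *\<^sub>R h"] by (simp add: dist_norm del: norm_scaleR)
      with t have "norm (g (x + t *\<^sub>R h) - g x) * norm h \<le> (c * (t * norm h)) * norm h"
        by (intro mult_right_mono) auto
      then show ?thesis
        using Cauchy_Schwarz_ineq2[of "g (x + t *\<^sub>R h) - g x" h] by (simp add: power2_eq_square)
    qed
    then have "0 \<le> q'" by (simp add: q'_def inner_diff_left)
    ultimately show "\<exists>q'. (q has_real_derivative q') (at t) \<and> 0 \<le> q'" by blast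
  qed simp
  then show ?thesis by (simp add: q_def bregman_def h_def)
qed

text \<open>
  Localized Baillon--Haddad inequality. The point \<open>z\<close> is the gradient step from \<open>y\<close> for the loss
  tilted by its tangent at \<open>x\<close>; the tilted loss is minimal at \<open>x\<close>, so the decrease that the
  descent lemma guarantees for the step is at most \<open>D x y\<close>.
\<close>

lemma cocoercive:
  assumes U: "convex U" "U \<subseteq> Euc d" and lip: "c-lipschitz_on U g" and c: "0 < c"
    and x: "x \<in> U" and y: "y \<in> U" and z: "y - (1 / c) *\<^sub>R (g y - g x) \<in> U"
  shows "(norm (g y - g x))\<^sup>2 \<le> 2 * c * D x y"
proof -
  define z where "z = y - (1 / c) *\<^sub>R (g y - g x)"
  have zU: "z \<in> U" using z by (simp add: z_def)
  have "L x + inner (g x) (z - x) \<le> L z" using U x zU by (intro gradient_inequality) auto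
  moreover have "D y z \<le> c / 2 * (norm (z - y))\<^sup>2" by (rule descent[OF U lip y zU])
  ultimately have "inner (g y - g x) (y - z) - c / 2 * (norm (z - y))\<^sup>2 \<le> D x y"
    by (simp add: bregman_def inner_diff_left inner_diff_right)
  moreover have "inner (g y - g x) (y - z) = (1 / c) * (norm (g y - g x))\<^sup>2"
    by (simp add: z_def power2_norm_eq_inner)
  moreover have "norm (z - y) = (1 / c) * norm (g y - g x)" using c by (simp add: z_def)
  ultimately have "(1 / c) * (norm (g y - g x))\<^sup>2 - c / 2 * ((1 / c) * norm (g y - g x))\<^sup>2 \<le> D x y"
    by simp
  moreover have "c / 2 * ((1 / c) * norm (g y - g x))\<^sup>2 = (1 / (2 * c)) * (norm (g y - g x))\<^sup>2"
    using c by (simp add: power2_eq_square)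
  moreover have "(1 / c) * (norm (g y - g x))\<^sup>2 = 2 * ((1 / (2 * c)) * (norm (g y - g x))\<^sup>2)"
    by simp
  ultimately have "(1 / (2 * c)) * (norm (g y - g x))\<^sup>2 \<le> D x y" by linarith
  then show ?thesis using c by (simp add: field_simps)
qed

end

section \<open>Restricted curvature from sparse eigenvalues\<close>

lemma hess_form_scaleR:
  assumes "grad d L differentiable (at x within Euc d)"
  shows "hess_form d L x (a *\<^sub>R u) = a\<^sup>2 * hess_form d L x u"
proof -
  interpret bounded_linear "frechet_derivative (grad d L) (at x within Euc d)"
    using assms frechet_derivative_works has_derivative_bounded_linear by blast
  show ?thesis by (simp add: hess_form_def scaleR power2_eq_square)
qed

lemma hess_form_restr_bounds:
  assumes diff: "grad d L differentiable (at x within Euc d)"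
    and x: "x \<in> cball bs r \<inter> Euc d" and h: "h \<in> Euc d"
    and J: "J \<subseteq> {..<d}" "card J \<le> m" and hJ: "\<And>i. i \<notin> J \<Longrightarrow> h $. i = 0"
    and lo: "ereal a \<le> rho_minus d L bs m r" and hi: "rho_plus d L bs m r \<le> ereal b"
  shows "a * (norm h)\<^sup>2 \<le> hess_form d L x h \<and> hess_form d L x h \<le> b * (norm h)\<^sup>2"
proof (cases "h = 0")
  case True
  then show ?thesis by (simp add: hess_form_def)
next
  case False
  define u where "u = (1 / norm h) *\<^sub>R h"
  have u: "u \<in> Euc d" "h = norm h *\<^sub>R u" using h False by (auto simp: u_def)
  have "restr u J = u" by (rule fvec_eqI) (auto simp: u_def hJ)
  moreover have "norm u = 1" using False by (simp add: u_def)
  ultimately have "hess_form d L x u \<in> hess_values d L bs m r"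
    unfolding hess_values_def mem_Collect_eq using x u(1) J
    by (intro exI[of _ x] exI[of _ u] exI[of _ J]) simp
  then have "rho_minus d L bs m r \<le> hess_form d L x u" "hess_form d L x u \<le> rho_plus d L bs m r"
    unfolding rho_minus_def rho_plus_def by (auto intro: Inf_lower Sup_upper)
  then have "a \<le> hess_form d L x u" "hess_form d L x u \<le> b"
    using lo hi by (meson ereal_less_eq(3) order_trans)+
  moreover have "hess_form d L x h = (norm h)\<^sup>2 * hess_form d L x u"
    by (subst u(2)) (rule hess_form_scaleR[OF diff])
  ultimately show ?thesis by (auto simp: mult.commute intro: mult_right_mono)
qed

context convex_loss
begin

lemma line_second_derivative:
  assumes x: "x \<in> Euc d" and h: "h \<in> Euc d"
    and diff: "g differentiable (at (x + t *\<^sub>R h) within Euc d)"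
  shows "((\<lambda>t. inner (g (x + t *\<^sub>R h)) h) has_real_derivative hess_form d L (x + t *\<^sub>R h) h) (at t)"
proof -
  define G where "G = frechet_derivative g (at (x + t *\<^sub>R h) within Euc d)"
  have G: "(g has_derivative G) (at (x + t *\<^sub>R h) within Euc d)"
    unfolding G_def using diff frechet_derivative_works by blast
  interpret G: bounded_linear G using G by (rule has_derivative_bounded_linear)
  have line: "(\<lambda>t. x + t *\<^sub>R h) ` UNIV \<subseteq> Euc d" using x h by auto
  have "((\<lambda>t. x + t *\<^sub>R h) has_derivative (\<lambda>t. t *\<^sub>R h)) (at t)"
    by (auto intro!: derivative_eq_intros)
  moreover have "(g has_derivative G) (at (x + t *\<^sub>R h) within (\<lambda>t. x + t *\<^sub>R h) ` UNIV)"
    by (rule has_derivative_subset[OF G line])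
  ultimately have "((\<lambda>t. g (x + t *\<^sub>R h)) has_derivative (\<lambda>s. G (s *\<^sub>R h))) (at t)"
    by (rule has_derivative_in_compose)
  then have "((\<lambda>t. inner (g (x + t *\<^sub>R h)) h) has_derivative (\<lambda>s. inner (G (s *\<^sub>R h)) h)) (at t)"
    by (rule has_derivative_inner_left)
  moreover have "(\<lambda>s. inner (G (s *\<^sub>R h)) h) = (*) (hess_form d L (x + t *\<^sub>R h) h)"
    by (rule ext) (simp add: G.scaleR hess_form_def inner_commute flip: G_def)
  ultimately show ?thesis
    by (simp add: has_field_derivative_def)
qed

text \<open>Taylor's theorem on the segment, for a direction supported in \<open>J\<close>.\<close>

lemma bregman_sparse_bounds:
  assumes diff: "\<forall>b \<in> cball bs r \<inter> Euc d. g differentiable (at b within Euc d)"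
    and lo: "ereal a \<le> rho_minus d L bs m r" and hi: "rho_plus d L bs m r \<le> ereal b"
    and x: "x \<in> cball bs r \<inter> Euc d" and y: "y \<in> cball bs r \<inter> Euc d"
    and J: "J \<subseteq> {..<d}" "card J \<le> m" and xy: "\<And>i. i \<notin> J \<Longrightarrow> y $. i = x $. i"
  shows "a / 2 * (norm (y - x))\<^sup>2 \<le> D x y \<and> D x y \<le> b / 2 * (norm (y - x))\<^sup>2"
proof -
  define h where "h = y - x"
  have E: "x \<in> Euc d" "h \<in> Euc d" using x y by (auto simp: h_def)
  have seg: "x + t *\<^sub>R h \<in> cball bs r \<inter> Euc d" if "0 \<le> t" "t \<le> 1" for t
  proof -
    have "x + t *\<^sub>R h = (1 - t) *\<^sub>R x + t *\<^sub>R y" by (simp add: h_def algebra_simps)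
    then show ?thesis
      using convexD_alt[OF convex_Int[OF convex_cball convex_Euc] x y, of t] that by simp
  qed
  define q where "q c t = L (x + t *\<^sub>R h) - L x - t * inner (g x) h - c * t\<^sup>2 / 2 * (norm h)\<^sup>2" for c t :: real
  define q1 where "q1 c t = inner (g (x + t *\<^sub>R h)) h - inner (g x) h - c * t * (norm h)\<^sup>2" for c t :: real
  have q: "(q c has_real_derivative q1 c t) (at t)" for c t
    unfolding q_def[abs_def] q1_def
    by (rule derivative_eq_intros line_derivative E refl | simp)+
  have q1: "(q1 c has_real_derivative hess_form d L (x + t *\<^sub>R h) h - c * (norm h)\<^sup>2) (at t)"
    if "0 \<le> t" "t \<le> 1" for c t
    unfolding q1_def[abs_def]
    by (rule derivative_eq_intros line_second_derivative E refl diff[rule_format] seg that | simp)+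
  have hb: "a * (norm h)\<^sup>2 \<le> hess_form d L (x + t *\<^sub>R h) h \<and> hess_form d L (x + t *\<^sub>R h) h \<le> b * (norm h)\<^sup>2"
    if "0 \<le> t" "t \<le> 1" for t
    using hess_form_restr_bounds[OF _ seg[OF that] E(2) J _ lo hi] diff seg[OF that] xy
    by (auto simp: h_def)
  have z: "q c 0 = 0" "q1 c 0 = 0" for c by (auto simp: q_def q1_def)
  have "q1 a 0 \<le> q1 a t" if t: "0 \<le> t" "t \<le> 1" for t
  proof (rule DERIV_nonneg_imp_nondecreasing[of 0 t "q1 a"])
    fix u assume "0 \<le> u" "u \<le> t"
    then show "\<exists>y. (q1 a has_real_derivative y) (at u) \<and> 0 \<le> y"
      using q1[of u a] hb[of u] t
      by (intro exI[of _ "hess_form d L (x + u *\<^sub>R h) h - a * (norm h)\<^sup>2"]) auto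
  qed (use t in auto)
  then have "q a 0 \<le> q a 1"
    using q z(2) by (intro DERIV_nonneg_imp_nondecreasing[of 0 1 "q a"]) auto
  moreover have "q1 b t \<le> q1 b 0" if t: "0 \<le> t" "t \<le> 1" for t
  proof (rule DERIV_nonpos_imp_nonincreasing[of 0 t "q1 b"])
    fix u assume "0 \<le> u" "u \<le> t"
    then show "\<exists>y. (q1 b has_real_derivative y) (at u) \<and> y \<le> 0"
      using q1[of u b] hb[of u] t
      by (intro exI[of _ "hess_form d L (x + u *\<^sub>R h) h - b * (norm h)\<^sup>2"]) auto
  qed (use t in auto)
  then have "q b 1 \<le> q b 0"
    using q z(2) by (intro DERIV_nonpos_imp_nonincreasing[of 0 1 "q b"]) auto
  ultimately show ?thesis by (simp add: z) (simp add: q_def bregman_def h_def)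
qed

end

section \<open>Soft thresholding and the stopping criterion\<close>

definition soft :: "real \<Rightarrow> real \<Rightarrow> real" where
  "soft t z = sgn z * max (\<bar>z\<bar> - t) 0"

text \<open>
  Soft thresholding at \<open>l / phi\<close> is the proximal map of \<open>(l / phi) * \<bar>_\<bar>\<close>: the multiplier \<open>xi\<close> is
  a subgradient of the absolute value at the thresholded point.
\<close>

lemma soft_multiplier:
  assumes "0 \<le> l" "0 < phi"
  shows "\<exists>xi. \<bar>xi\<bar> \<le> 1 \<and> xi * soft (l / phi) z = \<bar>soft (l / phi) z\<bar> \<and> phi * (z - soft (l / phi) z) = l * xi"
proof (cases "l / phi < \<bar>z\<bar>")
  case True
  have t: "0 \<le> l / phi" using assms by simp
  have "soft (l / phi) z = z - sgn z * (l / phi)"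
    using True t by (auto simp: soft_def max_def sgn_if)
  moreover have "sgn z * (z - sgn z * (l / phi)) = \<bar>z - sgn z * (l / phi)\<bar>"
    using True t by (auto simp: sgn_if abs_if)
  moreover have "phi * (z - (z - sgn z * (l / phi))) = l * sgn z" using assms by simp
  ultimately show ?thesis by (intro exI[of _ "sgn z"]) (auto simp: sgn_if)
next
  case False
  then have s: "soft (l / phi) z = 0" by (simp add: soft_def)
  show ?thesis
  proof (cases "l = 0")
    case True
    then show ?thesis using False s by (intro exI[of _ 0]) auto
  next
    case l: False
    have "\<bar>phi * z\<bar> \<le> l" using False assms by (simp add: abs_mult field_simps)
    then show ?thesis using l s assms by (intro exI[of _ "phi * z / l"]) (auto simp: abs_mult)
  qed
qed

lemma soft_nonexpansive: "0 \<le> t \<Longrightarrow> \<bar>soft t y - soft t z\<bar> \<le> \<bar>y - z\<bar>"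
  by (auto simp: soft_def sgn_if max_def abs_if split: if_splits)

lemma soft_near: "0 \<le> t \<Longrightarrow> \<bar>soft t z - z\<bar> \<le> t"
  by (auto simp: soft_def sgn_if max_def abs_if split: if_splits)

lemma soft_zero: "\<bar>z\<bar> \<le> t \<Longrightarrow> soft t z = 0"
  by (auto simp: soft_def)

lemma T_op_Euc [simp, intro]: "T_op d L lw phi x \<in> Euc d"
  by (simp add: T_op_def Let_def)

lemma T_op_entry:
  "j < d \<Longrightarrow> T_op d L lw phi x $. j = soft (lw $. j / phi) (x $. j - grad d L x $. j / phi)"
  by (simp add: T_op_def Let_def soft_def)

text \<open>Coordinatewise optimality of the minimizer of the quadratic model.\<close>

lemma T_op_multiplier:
  assumes "0 \<le> lw $. j" "0 < phi" "j < d"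
  obtains xi where "\<bar>xi\<bar> \<le> 1" "xi * T_op d L lw phi x $. j = \<bar>T_op d L lw phi x $. j\<bar>"
    "phi * (x $. j - T_op d L lw phi x $. j) - grad d L x $. j = lw $. j * xi"
proof -
  obtain xi where "\<bar>xi\<bar> \<le> 1" "xi * T_op d L lw phi x $. j = \<bar>T_op d L lw phi x $. j\<bar>"
    "phi * (x $. j - grad d L x $. j / phi - T_op d L lw phi x $. j) = lw $. j * xi"
    using soft_multiplier[of "lw $. j" phi "x $. j - grad d L x $. j / phi"] assms
    unfolding T_op_entry[OF assms(3)] by blast
  moreover from this(3) have "phi * (x $. j - T_op d L lw phi x $. j) - grad d L x $. j = lw $. j * xi"
    using assms(2) by (simp add: right_diff_distrib)
  ultimately show ?thesis using that by blast
qed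

lemma l1_subdiff_iff:
  "xi \<in> l1_subdiff d b \<longleftrightarrow>
     xi \<in> Euc d \<and> (\<forall>j<d. \<bar>xi $. j\<bar> \<le> 1 \<and> xi $. j * b $. j = \<bar>b $. j\<bar>)" if b: "b \<in> Euc d"
proof (intro iffI conjI allI impI)
  assume xi: "xi \<in> l1_subdiff d b"
  then show xiE: "xi \<in> Euc d" by (simp add: l1_subdiff_def)
  fix j assume j: "j < d"
  have *: "\<bar>b $. j\<bar> + xi $. j * t \<le> \<bar>b $. j + t\<bar>" for t
  proof -
    define b' where "b' = b + mkvec d (\<lambda>i. if i = j then t else 0)"
    have "b' \<in> Euc d" using b by (auto simp: b'_def)
    then have "l1_norm d b + inner xi (b' - b) \<le> l1_norm d b'"
      using xi by (auto simp: l1_subdiff_def)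
    moreover have "inner xi (b' - b) = xi $. j * t"
      unfolding inner_Euc[OF xiE] b'_def using j by (simp add: if_distrib[of "\<lambda>x. _ * x"] cong: if_cong)
    moreover have "l1_norm d v = \<bar>v $. j\<bar> + (\<Sum>i\<in>{..<d} - {j}. \<bar>v $. i\<bar>)" for v
      unfolding l1_norm_def using j by (intro sum.remove) auto
    moreover have "(\<Sum>i\<in>{..<d} - {j}. \<bar>b' $. i\<bar>) = (\<Sum>i\<in>{..<d} - {j}. \<bar>b $. i\<bar>)"
      by (intro sum.cong) (auto simp: b'_def)
    moreover have "b' $. j = b $. j + t" using j by (simp add: b'_def)
    ultimately show ?thesis by simp
  qed
  show "xi $. j * b $. j = \<bar>b $. j\<bar>"
    using *[of "b $. j"] *[of "- b $. j"] by (auto simp: abs_if split: if_splits)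
  show "\<bar>xi $. j\<bar> \<le> 1"
    using *[of 1] *[of "-1"] by linarith
next
  assume xi: "xi \<in> Euc d \<and> (\<forall>j<d. \<bar>xi $. j\<bar> \<le> 1 \<and> xi $. j * b $. j = \<bar>b $. j\<bar>)"
  have "l1_norm d b + inner xi (b' - b) \<le> l1_norm d b'" for b'
  proof -
    have "l1_norm d b + inner xi (b' - b) = (\<Sum>j<d. xi $. j * b' $. j)"
      using xi unfolding l1_norm_def inner_diff_right inner_Euc[OF xi[THEN conjunct1]]
      by simp
    also have "\<dots> \<le> (\<Sum>j<d. \<bar>b' $. j\<bar>)"
    proof (rule sum_mono)
      fix j assume "j \<in> {..<d}"
      then have "\<bar>xi $. j * b' $. j\<bar> \<le> 1 * \<bar>b' $. j\<bar>"
        unfolding abs_mult using xi by (intro mult_right_mono) auto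
      then show "xi $. j * b' $. j \<le> \<bar>b' $. j\<bar>" by linarith
    qed
    finally show ?thesis by (simp add: l1_norm_def)
  qed
  then show "xi \<in> l1_subdiff d b" using xi by (auto simp: l1_subdiff_def)
qed

lemma linf_norm_ge: "j < d \<Longrightarrow> \<bar>v $. j\<bar> \<le> linf_norm d v"
  unfolding linf_norm_def by (rule Max_ge) auto

lemma linf_norm_le: "0 < d \<Longrightarrow> (\<And>j. j < d \<Longrightarrow> \<bar>v $. j\<bar> \<le> c) \<Longrightarrow> linf_norm d v \<le> c"
  unfolding linf_norm_def by (rule Max.boundedI) auto

text \<open>
  The subdifferential is a product of intervals, so the multipliers may be chosen coordinate by
  coordinate. The next two lemmas express the stopping criterion in these terms.
\<close>

lemma omega_le:
  assumes d: "0 < d" and b: "b \<in> Euc d"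
    and ex: "\<And>j. j < d \<Longrightarrow> \<exists>xi. \<bar>xi\<bar> \<le> 1 \<and> xi * b $. j = \<bar>b $. j\<bar> \<and> \<bar>grad d L b $. j + lw $. j * xi\<bar> \<le> c"
  shows "omega d L lw b \<le> c"
proof -
  from ex obtain f where f: "\<And>j. j < d \<Longrightarrow> \<bar>f j\<bar> \<le> 1 \<and> f j * b $. j = \<bar>b $. j\<bar> \<and> \<bar>grad d L b $. j + lw $. j * f j\<bar> \<le> c"
    by metis
  have "omega d L lw b \<le> linf_norm d (grad d L b + hadamard d lw (mkvec d f))"
    unfolding omega_def
  proof (rule cINF_lower)
    show "bdd_below ((\<lambda>xi. linf_norm d (grad d L b + hadamard d lw xi)) ` l1_subdiff d b)"
      using linf_norm_ge[OF d] by (intro bdd_belowI2[of _ 0]) (meson abs_ge_zero order_trans)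
    show "mkvec d f \<in> l1_subdiff d b" using f by (simp add: l1_subdiff_iff[OF b])
  qed
  also have "\<dots> \<le> c" using f by (intro linf_norm_le d) (auto simp: hadamard_def)
  finally show ?thesis .
qed

lemma omega_leD:
  assumes b: "b \<in> Euc d" and om: "omega d L lw b \<le> c" and j: "j < d" and lw: "0 \<le> lw $. j"
  shows "if b $. j = 0 then \<bar>grad d L b $. j\<bar> \<le> lw $. j + c
         else \<bar>grad d L b $. j + lw $. j * sgn (b $. j)\<bar> \<le> c"
proof -
  define q where "q = (if b $. j = 0 then \<bar>grad d L b $. j\<bar> - lw $. j
         else \<bar>grad d L b $. j + lw $. j * sgn (b $. j)\<bar>)"
  have "q \<le> omega d L lw b"
    unfolding omega_def
  proof (rule cINF_greatest)
    have "mkvec d (\<lambda>j. sgn (b $. j)) \<in> l1_subdiff d b"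
      by (auto simp: l1_subdiff_iff[OF b] sgn_if abs_if)
    then show "l1_subdiff d b \<noteq> {}" by blast
    fix xi assume "xi \<in> l1_subdiff d b"
    then have xi: "\<bar>xi $. j\<bar> \<le> 1" "xi $. j * b $. j = \<bar>b $. j\<bar>"
      using j by (auto simp: l1_subdiff_iff[OF b])
    have "q \<le> \<bar>grad d L b $. j + lw $. j * xi $. j\<bar>"
    proof (cases "b $. j = 0")
      case True
      have "\<bar>lw $. j * xi $. j\<bar> \<le> lw $. j"
        unfolding abs_mult using xi(1) lw by (simp add: mult_left_le)
      then show ?thesis using True by (simp add: q_def)
    next
      case False
      have "xi $. j * b $. j = sgn (b $. j) * b $. j" using xi(2) by (simp add: sgn_if abs_if)
      then have "xi $. j = sgn (b $. j)" using False by simp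
      then show ?thesis using False by (simp add: q_def)
    qed
    also have "\<dots> \<le> linf_norm d (grad d L b + hadamard d lw xi)"
      using linf_norm_ge[OF j, of "grad d L b + hadamard d lw xi"] j by (simp add: hadamard_def)
    finally show "q \<le> linf_norm d (grad d L b + hadamard d lw xi)" .
  qed
  then show ?thesis using om by (auto simp: q_def split: if_splits)
qed

section \<open>Restricted lower bounds for nonsparse directions\<close>

lemma norm2_split_Euc:
  assumes "v \<in> Euc d" "I \<subseteq> {..<d}"
  shows "(norm v)\<^sup>2 = (norm (restr v I))\<^sup>2 + (norm (restr v ({..<d} - I)))\<^sup>2"
  using sum.subset_diff[OF assms(2), of "\<lambda>i. (v $. i)\<^sup>2"]
  by (simp add: norm2_Euc[OF assms(1)] norm2_restr[OF assms(2)] norm2_restr[of "{..<d} - I" d])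

text \<open>
  Of the sparse eigenvalues only their consequence for Bregman divergences between points that
  differ on few coordinates is kept. The tolerance \<open>ep\<close> bounds \<open>eps_c\<close> and \<open>eps_t\<close>, and \<open>st\<close> is the
  integer of the LSE condition.
\<close>

locale sparse_problem = convex_loss d L for d L +
  fixes bs :: fvec and r a b lam ep :: real and st :: nat
  assumes bs: "bs \<in> Euc d"
    and s_pos: "0 < card (supp bs)"
    and a_pos: "0 < a" and a_le_b: "a \<le> b" and lam_pos: "0 < lam" and ep_nonneg: "0 \<le> ep"
    and noise: "\<And>j. j < d \<Longrightarrow> \<bar>g bs $. j\<bar> + ep \<le> lam / 4"
    and radius: "100 * (lam * sqrt (card (supp bs))) / a \<le> r"
    and st_large: "10^6 * (b / a)\<^sup>2 * card (supp bs) \<le> st"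
    and sparse_bounds: "\<And>x y J. x \<in> cball bs r \<inter> Euc d \<Longrightarrow> y \<in> cball bs r \<inter> Euc d \<Longrightarrow> J \<subseteq> {..<d} \<Longrightarrow>
        card J \<le> 2 * card (supp bs) + 2 * st \<Longrightarrow> (\<And>i. i \<notin> J \<Longrightarrow> y $. i = x $. i) \<Longrightarrow>
        a / 2 * (norm (y - x))\<^sup>2 \<le> D x y \<and> D x y \<le> b / 2 * (norm (y - x))\<^sup>2"
begin

abbreviation s where "s \<equiv> card (supp bs)"
abbreviation e where "e \<equiv> lam * sqrt s"

definition err :: real where "err = 10 * e / a"

lemma b_pos: "0 < b" using a_pos a_le_b by simp

lemma e_pos: "0 < e" using lam_pos s_pos by simp

lemma err_pos: "0 < err" using e_pos a_pos by (simp add: err_def)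

lemma err_le_radius: "10 * err \<le> r" using radius by (simp add: err_def)

lemma supp_bs: "supp bs \<subseteq> {..<d}"
  using bs by (auto simp: supp_def Euc_def) (meson linorder_not_le)

lemma d_pos: "0 < d"
  using s_pos supp_bs by (cases d) auto

lemma st_pos: "0 < real st"
  using st_large s_pos a_pos b_pos by (smt (verit) divide_pos_pos mult_pos_pos of_nat_0_less_iff zero_less_power)

lemma sqrt_s_le: "sqrt s \<le> a / (1000 * b) * sqrt st"
proof (rule power2_le_imp_le)
  have "s = (a / (1000 * b))\<^sup>2 * (10^6 * (b / a)\<^sup>2 * s)"
    using a_pos b_pos by (simp add: field_simps power2_eq_square)
  also have "\<dots> \<le> (a / (1000 * b))\<^sup>2 * st" using st_large by (intro mult_left_mono) auto
  also have "\<dots> = (a / (1000 * b) * sqrt st)\<^sup>2" unfolding power_mult_distrib by simp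
  finally show "(sqrt s)\<^sup>2 \<le> (a / (1000 * b) * sqrt st)\<^sup>2"
    by (simp only: real_sqrt_pow2 of_nat_0_le_iff)
qed (use a_pos b_pos in auto)

text \<open>
  A small Bregman divergence bounds the change of the gradient on small sets of coordinates, even
  between points that differ everywhere. With \<open>v\<close> the negative change on \<open>B\<close>, compare the tangent
  at \<open>x\<close> with the parabola at \<open>y\<close>, both evaluated at a step of length \<open>q\<close> from \<open>y\<close> along \<open>v\<close>; only
  the curvature along the sparse vector \<open>v\<close> enters.
\<close>

lemma sparse_gradient_difference:
  assumes x: "x \<in> Euc d" and y: "y \<in> Euc d" and q: "0 < q" and D: "D x y \<le> b / 2 * q\<^sup>2"
    and ball: "norm (y - bs) + q \<le> r"
    and B: "B \<subseteq> {..<d}" "card B \<le> 2 * s + 2 * st"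
  shows "norm (restr (g y - g x) B) \<le> b * q"
proof -
  define k where "k = g y - g x"
  define v where "v = - restr k B"
  have v: "v \<in> Euc d" using x y by (auto simp: v_def k_def)
  show ?thesis
  proof (cases "v = 0")
    case True
    then show ?thesis using q b_pos by (simp add: v_def k_def)
  next
    case False
    define t where "t = q / norm v"
    have t: "0 < t" "t * norm v = q" using q False by (auto simp: t_def)
    have "norm (y + t *\<^sub>R v - bs) \<le> norm (y - bs) + norm (t *\<^sub>R v)"
      using norm_triangle_ineq[of "y - bs" "t *\<^sub>R v"] by (simp add: algebra_simps)
    also have "\<dots> \<le> r" using ball t by simp
    finally have z: "y + t *\<^sub>R v \<in> cball bs r" by (simp add: dist_norm norm_minus_commute)
    have y': "y \<in> cball bs r" using ball q by (simp add: dist_norm norm_minus_commute)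
    have yv: "y \<in> cball bs r \<inter> Euc d" "y + t *\<^sub>R v \<in> cball bs r \<inter> Euc d"
      using y y' z v by blast+
    have "(y + t *\<^sub>R v) $. i = y $. i" if "i \<notin> B" for i
      using that by (simp add: v_def)
    then have "D y (y + t *\<^sub>R v) \<le> b / 2 * (norm (y + t *\<^sub>R v - y))\<^sup>2"
      using sparse_bounds[OF yv B] by blast
    then have "D y (y + t *\<^sub>R v) \<le> b / 2 * q\<^sup>2" using t by simp
    moreover have "L x + inner (g x) (y + t *\<^sub>R v - x) \<le> L (y + t *\<^sub>R v)"
      using x y v by (intro gradient_inequality) auto
    ultimately have "t * inner k (- v) \<le> b * q\<^sup>2"
      using D by (simp add: bregman_def k_def algebra_simps inner_diff_left inner_diff_right inner_add_right)
    moreover have "inner k (- v) = (norm v)\<^sup>2"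
      using norm2_restr[OF B(1), of k] inner_restr[OF B(1), of k k] by (simp add: v_def power2_eq_square)
    ultimately have "t * (norm v * norm v) \<le> b * q\<^sup>2" by (simp only: power2_eq_square)
    then have "q * norm v \<le> q * (b * q)"
      unfolding t(2)[symmetric] by (simp add: power2_eq_square ac_simps)
    then have "norm v \<le> b * q" using q by simp
    then show ?thesis by (simp add: v_def k_def)
  qed
qed

text \<open>
  Strong convexity along an arbitrary direction \<open>h\<close>, up to an error governed by the \<open>l1\<close> norm of
  \<open>h\<close> off \<open>A\<close>. The coordinates outside \<open>A\<close> where \<open>h\<close> exceeds the threshold \<open>tau\<close>, at most \<open>st / 2\<close>
  of them, join \<open>A\<close>; on the enlarged set \<open>I\<close> the loss is strongly convex. The rest of \<open>h\<close> is
  paired with a change \<open>k\<close> of the gradient that is bounded on all sets of \<open>st\<close> coordinates: at most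
  \<open>st\<close> entries of \<open>k\<close> exceed \<open>theta\<close>; on these \<open>h\<close> is below \<open>tau\<close>, and on the others \<open>k\<close> is
  below \<open>theta\<close>. The two thresholds replace the usual sorting of \<open>h\<close> into blocks.
\<close>

lemma restricted_lower_bound:
  assumes x: "x \<in> Euc d" and h: "h \<in> Euc d" and ball: "norm (x - bs) + 2 * norm h \<le> r"
    and A: "A \<subseteq> {..<d}" "2 * card A \<le> 4 * s + st"
  defines "M \<equiv> \<Sum>j\<in>{..<d} - A. \<bar>h $. j\<bar>"
  obtains I where "A \<subseteq> I" "I \<subseteq> {..<d}"
    "a / 2 * (norm (restr h I))\<^sup>2 - 3 * b * norm (restr h I) * M / sqrt st \<le> D x (x + h)"
    "(norm (restr h ({..<d} - I)))\<^sup>2 \<le> 2 * M\<^sup>2 / st"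
proof -
  have M: "0 \<le> M" by (simp add: M_def sum_nonneg)
  define tau where "tau = 2 * M / st"
  have tau: "0 \<le> tau" using M st_pos by (simp add: tau_def)
  define J where "J = {j \<in> {..<d} - A. tau < \<bar>h $. j\<bar>}"
  have J: "2 * card J \<le> st"
  proof (cases "J = {}")
    case False
    have "real (card J) * tau = (\<Sum>j\<in>J. tau)" by simp
    also have "\<dots> < (\<Sum>j\<in>J. \<bar>h $. j\<bar>)" using False by (intro sum_strict_mono) (auto simp: J_def)
    also have "\<dots> \<le> M" unfolding M_def by (rule sum_mono2) (auto simp: J_def)
    finally have lt: "real (card J) * tau < M" .
    then have "0 < M" using tau by (smt (verit) mult_nonneg_nonneg of_nat_0_le_iff)
    then have "2 * real (card J) < st" using lt st_pos by (simp add: tau_def field_simps)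
    then show ?thesis by linarith
  qed simp
  define I where "I = A \<union> J"
  have I: "A \<subseteq> I" "I \<subseteq> {..<d}" using A by (auto simp: I_def J_def)
  have cI: "2 * card I \<le> 4 * s + 2 * st"
    using card_Un_le[of A J] J A(2) by (simp add: I_def)
  have small: "\<bar>h $. j\<bar> \<le> tau" if "j \<in> {..<d} - I" for j
    using that by (auto simp: I_def J_def not_less)
  have M': "(\<Sum>j\<in>{..<d} - I. \<bar>h $. j\<bar>) \<le> M"
    unfolding M_def using I by (intro sum_mono2) auto
  define u w where "u = restr h I" and "w = restr h ({..<d} - I)"
  have uw: "u \<in> Euc d" "w \<in> Euc d" using h by (auto simp: u_def w_def)
  have hsum: "h = u + w" using h by (intro fvec_eqI) (auto simp: u_def w_def Euc_def)
  have u_le: "norm u \<le> norm h" by (simp add: u_def norm_restr_le)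
  have "(norm w)\<^sup>2 = (\<Sum>j\<in>{..<d} - I. \<bar>h $. j\<bar> * \<bar>h $. j\<bar>)"
  proof -
    have "(norm w)\<^sup>2 = (\<Sum>j\<in>{..<d} - I. (h $. j)\<^sup>2)"
      unfolding w_def by (rule norm2_restr) auto
    then show ?thesis by (simp add: power2_eq_square)
  qed
  also have "\<dots> \<le> (\<Sum>j\<in>{..<d} - I. tau * \<bar>h $. j\<bar>)"
    using small by (intro sum_mono mult_right_mono) auto
  also have "\<dots> = tau * (\<Sum>j\<in>{..<d} - I. \<bar>h $. j\<bar>)" by (simp add: sum_distrib_left)
  also have "\<dots> \<le> tau * M" using M' tau by (rule mult_left_mono)
  finally have wM: "(norm w)\<^sup>2 \<le> 2 * M\<^sup>2 / st" by (simp add: tau_def power2_eq_square)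
  have "a / 2 * (norm u)\<^sup>2 - 3 * b * norm u * M / sqrt st \<le> D x (x + h)"
  proof (cases "u = 0")
    case True
    then show ?thesis using bregman_nonneg[of x "x + h"] x h by auto
  next
    case False
    define y where "y = x + u"
    have y: "y \<in> Euc d" using x uw by (simp add: y_def)
    have yb: "norm (y - bs) + norm u \<le> r"
      using norm_triangle_ineq[of "x - bs" u] u_le ball by (simp add: y_def algebra_simps)
    have xb: "norm (x - bs) \<le> r" using ball norm_ge_zero[of h] by linarith
    have yb': "norm (y - bs) \<le> r" using yb norm_ge_zero[of u] by linarith
    have bounds: "a / 2 * (norm u)\<^sup>2 \<le> D x y" "D x y \<le> b / 2 * (norm u)\<^sup>2"
      using sparse_bounds[of x y I] x y xb yb' I cI
      by (auto simp: dist_norm norm_minus_commute y_def u_def)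
    define k where "k = g y - g x"
    have G: "norm (restr k B) \<le> b * norm u" if "B \<subseteq> {..<d}" "card B \<le> st" for B
      unfolding k_def using that False bounds yb
      by (intro sparse_gradient_difference x y) auto
    define theta where "theta = b * norm u / sqrt st"
    have theta: "0 \<le> theta" "st * theta\<^sup>2 = (b * norm u)\<^sup>2" "sqrt st * theta = b * norm u"
      using b_pos st_pos by (auto simp: theta_def power_divide)
    define B where "B = {j \<in> {..<d} - I. theta < \<bar>k $. j\<bar>}"
    have B: "B \<subseteq> {..<d}" by (auto simp: B_def)
    have cB: "card B \<le> st"
    proof (rule ccontr)
      assume "\<not> card B \<le> st"
      then obtain B' where B': "B' \<subseteq> B" "card B' = st" "finite B'"
        by (metis linear obtain_subset_with_card_n)
      then have "B' \<noteq> {}" using st_pos by auto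
      have "st * theta\<^sup>2 = (\<Sum>j\<in>B'. theta\<^sup>2)" using B' by simp
      also have "\<dots> < (\<Sum>j\<in>B'. (k $. j)\<^sup>2)"
      proof (rule sum_strict_mono)
        fix j assume "j \<in> B'"
        then have "theta < \<bar>k $. j\<bar>" using B' by (auto simp: B_def)
        then show "theta\<^sup>2 < (k $. j)\<^sup>2" using theta(1) by (metis power2_abs power_strict_mono zero_less_numeral)
      qed (use B' \<open>B' \<noteq> {}\<close> in auto)
      also have "\<dots> = (norm (restr k B'))\<^sup>2" using B B' by (intro norm2_restr[symmetric]) auto
      also have "\<dots> \<le> (b * norm u)\<^sup>2" using G[of B'] B B' by (intro power_mono) auto
      finally show False using theta by simp
    qed
    have "- inner k w = (\<Sum>j\<in>{..<d} - I. - (k $. j * h $. j))"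
      by (simp add: w_def inner_restr[of _ d] sum_negf)
    also have "\<dots> \<le> (\<Sum>j\<in>{..<d} - I. (if j \<in> B then tau * \<bar>k $. j\<bar> else 0) + theta * \<bar>h $. j\<bar>)"
    proof (rule sum_mono)
      fix j assume j: "j \<in> {..<d} - I"
      have "- (k $. j * h $. j) \<le> \<bar>k $. j\<bar> * \<bar>h $. j\<bar>" by (metis abs_ge_minus_self abs_mult)
      also have "\<dots> \<le> (if j \<in> B then tau * \<bar>k $. j\<bar> else 0) + theta * \<bar>h $. j\<bar>"
      proof (cases "j \<in> B")
        case True
        have "\<bar>k $. j\<bar> * \<bar>h $. j\<bar> \<le> \<bar>k $. j\<bar> * tau" using small[OF j] by (intro mult_left_mono) auto
        then show ?thesis using True theta(1) by (simp add: mult.commute add_increasing2)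
      next
        case False
        then have "\<bar>k $. j\<bar> \<le> theta" using j by (auto simp: B_def)
        then show ?thesis using False by (simp add: mult_right_mono)
      qed
      finally show "- (k $. j * h $. j) \<le> (if j \<in> B then tau * \<bar>k $. j\<bar> else 0) + theta * \<bar>h $. j\<bar>" .
    qed
    also have "\<dots> = tau * (\<Sum>j\<in>B. \<bar>k $. j\<bar>) + theta * (\<Sum>j\<in>{..<d} - I. \<bar>h $. j\<bar>)"
    proof -
      have "({..<d} - I) \<inter> B = B" by (auto simp: B_def)
      then show ?thesis
        by (simp add: sum.distrib sum_distrib_left sum.inter_restrict[symmetric] flip: sum.inter_restrict)
    qed
    also have "\<dots> \<le> tau * (sqrt st * (b * norm u)) + theta * M"
    proof -
      have "(\<Sum>j\<in>B. \<bar>k $. j\<bar>) \<le> sqrt st * norm (restr k B)"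
        using cB by (intro l1_le_sqrt_card[OF B]) auto
      also have "\<dots> \<le> sqrt st * (b * norm u)" using G[OF B cB] by (intro mult_left_mono) auto
      finally show ?thesis using M' tau theta(1) by (intro add_mono mult_left_mono) auto
    qed
    also have "\<dots> = 3 * b * norm u * M / sqrt st"
    proof -
      have "tau * sqrt st = 2 * M / sqrt st"
        using st_pos by (simp add: tau_def real_div_sqrt field_simps)
      then have "tau * (sqrt st * (b * norm u)) = 2 * M / sqrt st * (b * norm u)"
        by (metis mult.assoc)
      then show ?thesis by (simp add: theta_def field_simps)
    qed
    finally have "- inner k w \<le> 3 * b * norm u * M / sqrt st" .
    moreover have "L y + inner (g y) w \<le> L (x + h)"
      using gradient_inequality[OF y, of "x + h"] x h by (simp add: y_def hsum)
    then have "D x y + inner k w \<le> D x (x + h)"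
      by (simp add: bregman_def k_def y_def hsum inner_diff_left inner_add_right)
    ultimately show ?thesis using bounds by linarith
  qed
  then show ?thesis using that I wM unfolding u_def w_def by blast
qed

section \<open>The statistical error of approximate solutions\<close>

definition active :: "nat set \<Rightarrow> bool" where
  "active E \<longleftrightarrow> supp bs \<subseteq> E \<and> E \<subseteq> {..<d} \<and> card E \<le> 2 * s"

text \<open>
  The basic inequality of Lasso theory. As the divergence is nonnegative, it contains the cone
  condition with ratio 5 for the error.
\<close>

definition basic :: "nat set \<Rightarrow> fvec \<Rightarrow> bool" where
  "basic E x \<longleftrightarrow> D bs x + lam / 4 * (\<Sum>j\<in>{..<d} - E. \<bar>x $. j - bs $. j\<bar>)
     \<le> 5 / 4 * lam * (\<Sum>j\<in>E. \<bar>x $. j - bs $. j\<bar>)"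

lemma active_l1:
  assumes "active E"
  shows "(\<Sum>j\<in>E. \<bar>v $. j\<bar>) \<le> sqrt 2 * sqrt s * norm (restr v E)"
proof -
  have "real (card E) \<le> 2 * s" using assms by (simp add: active_def)
  then show ?thesis using assms l1_le_sqrt_card[of E d "2 * s" v]
    by (simp add: active_def real_sqrt_mult)
qed

text \<open>
  By the cone condition the \<open>l1\<close> error off \<open>E\<close> is at most \<open>5 * sqrt (2 * s)\<close> times the Euclidean
  error on \<open>E\<close>. Since \<open>sqrt (s / st) \<le> a / (1000 * b)\<close>, the loss term of the restricted lower bound
  absorbs only a part of the curvature, and what remains beats the linear right-hand side.
\<close>

lemma basic_error_local:
  assumes E: "active E" and x: "x \<in> Euc d" and basic: "basic E x" and loc: "norm (x - bs) \<le> r / 2"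
  shows "norm (x - bs) \<le> err"
proof -
  define h where "h = x - bs"
  have h: "h \<in> Euc d" "x = bs + h" using x bs by (auto simp: h_def)
  define M where "M = (\<Sum>j\<in>{..<d} - E. \<bar>h $. j\<bar>)"
  define l where "l = (\<Sum>j\<in>E. \<bar>h $. j\<bar>)"
  have M0: "0 \<le> M" by (simp add: M_def sum_nonneg)
  have bas: "D bs x + lam / 4 * M \<le> 5 / 4 * lam * l"
    using basic by (simp add: basic_def M_def l_def h_def)
  have Dn: "0 \<le> D bs x" using bs x by (rule bregman_nonneg)
  have "lam * M \<le> lam * (5 * l)" using bas Dn by simp
  then have M5: "M \<le> 5 * l" using lam_pos by simp
  have "E \<subseteq> {..<d}" "2 * card E \<le> 4 * s + st" using E by (auto simp: active_def)
  then obtain I where I: "E \<subseteq> I" "I \<subseteq> {..<d}"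
    and lo: "a / 2 * (norm (restr h I))\<^sup>2 - 3 * b * norm (restr h I) * M / sqrt st \<le> D bs (bs + h)"
    and rest: "(norm (restr h ({..<d} - I)))\<^sup>2 \<le> 2 * M\<^sup>2 / st"
    using restricted_lower_bound[OF bs h(1)] loc unfolding M_def h_def[symmetric] by auto
  define z where "z = norm (restr h I)"
  have z: "0 \<le> z" by (simp add: z_def)
  have "restr h E = restr (restr h I) E" using I by (intro fvec_eqI) auto
  then have "norm (restr h E) \<le> z" unfolding z_def using norm_restr_le by metis
  then have "sqrt 2 * sqrt s * norm (restr h E) \<le> sqrt 2 * sqrt s * z"
    by (intro mult_left_mono) auto
  with active_l1[OF E, of h] have l: "l \<le> sqrt 2 * sqrt s * z"
    unfolding l_def by (rule order_trans)
  have "M \<le> 5 * (sqrt 2 * sqrt s * z)" using M5 l by linarith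
  also have "\<dots> \<le> 5 * (sqrt 2 * (a / (1000 * b) * sqrt st) * z)"
    using sqrt_s_le z by (intro mult_left_mono mult_right_mono) auto
  also have "\<dots> \<le> 5 * (2 * (a / (1000 * b) * sqrt st) * z)"
    using z a_pos b_pos by (intro mult_left_mono mult_right_mono) (auto simp: real_le_lsqrt)
  finally have M: "M \<le> a / (100 * b) * sqrt st * z" by (simp add: field_simps)
  have "3 * b * z * M / sqrt st \<le> 3 * b * z * (a / (100 * b) * sqrt st * z) / sqrt st"
    using M z b_pos st_pos by (intro divide_right_mono mult_left_mono) auto
  also have "\<dots> = 3 / 100 * a * z\<^sup>2" using b_pos st_pos by (simp add: field_simps power2_eq_square)
  also have "\<dots> \<le> a / 4 * z\<^sup>2" using a_pos by (simp add: mult_right_mono)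
  finally have "a / 2 * z\<^sup>2 - a / 4 * z\<^sup>2 \<le> D bs x"
    using lo by (simp only: z_def h(2))
  then have "a / 4 * z\<^sup>2 \<le> D bs x" by linarith
  also have "\<dots> \<le> 5 / 4 * lam * l"
  proof -
    have "0 \<le> lam / 4 * M" using M0 lam_pos by simp
    then show ?thesis using bas by linarith
  qed
  also have "\<dots> \<le> 5 / 4 * lam * (sqrt 2 * sqrt s * z)" using l lam_pos by (intro mult_left_mono) auto
  finally have az: "a / 4 * z\<^sup>2 \<le> 5 / 4 * lam * (sqrt 2 * sqrt s * z)" .
  have "a * z \<le> 5 * sqrt 2 * e"
  proof (cases "z = 0")
    case False
    have "(a / 4 * z) * z \<le> (5 / 4 * lam * (sqrt 2 * sqrt s)) * z"
      using az by (simp only: power2_eq_square mult.assoc)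
    moreover have "0 < z" using False z by linarith
    ultimately have "a / 4 * z \<le> 5 / 4 * lam * (sqrt 2 * sqrt s)"
      by (rule mult_right_le_imp_le)
    then have "4 * (a / 4 * z) \<le> 4 * (5 / 4 * lam * (sqrt 2 * sqrt s))" by linarith
    moreover have "4 * (a / 4 * z) = a * z" "4 * (5 / 4 * lam * (sqrt 2 * sqrt s)) = 5 * sqrt 2 * e"
      by simp_all
    ultimately show ?thesis by (simp only:)
  qed (use e_pos in simp)
  then have z_le: "z \<le> 5 * sqrt 2 * e / a"
    using a_pos by (simp only: pos_le_divide_eq mult.commute[of z])
  have "2 * M\<^sup>2 / st \<le> 2 * (a / (100 * b) * sqrt st * z)\<^sup>2 / st"
    using M M0 by (intro divide_right_mono mult_left_mono power_mono) auto
  also have "\<dots> = 2 * (a / (100 * b))\<^sup>2 * z\<^sup>2"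
    using st_pos unfolding power_mult_distrib by simp
  also have "\<dots> \<le> 1 * z\<^sup>2"
  proof (rule mult_right_mono)
    have "a / (100 * b) \<le> 1 / 2" using a_pos a_le_b by (simp add: field_simps)
    then have "(a / (100 * b))\<^sup>2 \<le> (1 / 2)\<^sup>2" using a_pos b_pos by (intro power_mono) auto
    then show "2 * (a / (100 * b))\<^sup>2 \<le> 1" by (simp add: power2_eq_square)
  qed simp
  finally have "(norm (restr h ({..<d} - I)))\<^sup>2 \<le> z\<^sup>2" using rest by linarith
  then have "(norm h)\<^sup>2 \<le> 2 * z\<^sup>2"
    using norm2_split_Euc[OF h(1) I(2)] unfolding z_def by linarith
  also have "\<dots> \<le> 2 * (5 * sqrt 2 * e / a)\<^sup>2" using z_le z by (intro mult_left_mono power_mono) auto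
  also have "\<dots> = (10 * e / a)\<^sup>2" by (simp add: power_mult_distrib power_divide)
  finally have "(norm h)\<^sup>2 \<le> (10 * e / a)\<^sup>2" .
  moreover have "0 \<le> 10 * e / a" using e_pos a_pos by simp
  ultimately show ?thesis unfolding h_def[symmetric] err_def by (rule power2_le_imp_le)
qed

text \<open>
  The basic inequality survives a contraction towards the truth, so that an error above the bound
  could be shrunk to one still above the bound but inside the region of restricted curvature.
\<close>

lemma basic_error:
  assumes E: "active E" and x: "x \<in> Euc d" and basic: "basic E x"
  shows "norm (x - bs) \<le> err"
proof (rule ccontr)
  assume neg: "\<not> ?thesis"
  define h where "h = x - bs"
  have big: "err < norm h" using neg by (simp add: h_def)
  have r2: "err < r / 2" using err_le_radius err_pos by linarith
  have h0: "0 < norm h" using big err_pos by linarith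
  \<comment> \<open>The scaled error has norm at most \<open>r / 2\<close>, still more than \<open>err\<close>.\<close>
  define t where "t = min 1 (r / 2 / norm h)"
  have r0: "0 < r" using r2 err_pos by linarith
  have t: "0 < t" "t \<le> 1" using h0 r0 by (auto simp: t_def)
  have "t * norm h = min (1 * norm h) (r / 2 / norm h * norm h)"
    unfolding t_def using h0 by (intro min_mult_distrib_right[THEN trans]) auto
  then have th: "t * norm h = min (norm h) (r / 2)" using h0 by simp
  define y where "y = bs + t *\<^sub>R h"
  have hE: "h \<in> Euc d" "y \<in> Euc d" using x bs by (auto simp: h_def y_def)
  have ny: "norm (y - bs) = min (norm h) (r / 2)" using t th by (simp add: y_def)
  have ent: "\<bar>y $. j - bs $. j\<bar> = t * \<bar>x $. j - bs $. j\<bar>" for j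
    using t by (simp add: y_def h_def abs_mult)
  have "D bs y \<le> t * D bs x"
    using bregman_scale_le[OF bs hE(1), of t] t unfolding y_def by (simp add: h_def)
  moreover have "t * (D bs x + lam / 4 * (\<Sum>j\<in>{..<d} - E. \<bar>x $. j - bs $. j\<bar>))
     \<le> t * (5 / 4 * lam * (\<Sum>j\<in>E. \<bar>x $. j - bs $. j\<bar>))"
    using basic t unfolding basic_def by (intro mult_left_mono) auto
  ultimately have "D bs y + lam / 4 * (t * (\<Sum>j\<in>{..<d} - E. \<bar>x $. j - bs $. j\<bar>))
      \<le> 5 / 4 * lam * (t * (\<Sum>j\<in>E. \<bar>x $. j - bs $. j\<bar>))"
    by (simp add: algebra_simps)
  then have "basic E y"
    unfolding basic_def ent by (simp only: sum_distrib_left)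
  then have "norm (y - bs) \<le> err"
    using basic_error_local[OF E hE(2)] ny by simp
  then show False using ny big r2 by linarith
qed

text \<open>
  Coordinates of \<open>E\<close> off the support of the truth, at most \<open>s\<close> in number, may have lost their
  penalty; all others off the support keep at least half of it, which is at least twice the noise.
\<close>

definition good_weights :: "nat set \<Rightarrow> fvec \<Rightarrow> bool" where
  "good_weights E lw \<longleftrightarrow> active E \<and>
     (\<forall>j<d. 0 \<le> lw $. j \<and> lw $. j \<le> lam) \<and> (\<forall>j\<in>{..<d} - E. lam / 2 \<le> lw $. j)"

lemma bregman_bs_sum:
  assumes x: "x \<in> Euc d"
  shows "D bs x = L x - L bs - (\<Sum>j<d. g bs $. j * (x $. j - bs $. j))"
  unfolding bregman_def inner_Euc[OF grad_Euc[OF bs]] by simp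

text \<open>The common last step of the derivations of the basic inequality: a coordinatewise estimate.\<close>

lemma basic_bound:
  assumes gw: "active E"
    and sum: "D bs x \<le> (\<Sum>j<d. f j) + K"
    and off: "\<And>j. j < d \<Longrightarrow> j \<notin> E \<Longrightarrow> f j \<le> - (lam / 4) * \<bar>x $. j - bs $. j\<bar>"
    and on: "\<And>j. j < d \<Longrightarrow> j \<in> E \<Longrightarrow> f j \<le> 5 / 4 * lam * \<bar>x $. j - bs $. j\<bar>"
  shows "D bs x + lam / 4 * (\<Sum>j\<in>{..<d} - E. \<bar>x $. j - bs $. j\<bar>)
     \<le> 5 / 4 * lam * (\<Sum>j\<in>E. \<bar>x $. j - bs $. j\<bar>) + K"
proof -
  have E: "E \<subseteq> {..<d}" using gw by (simp add: active_def)
  have "D bs x - K \<le> (\<Sum>j\<in>{..<d} - E. f j) + (\<Sum>j\<in>E. f j)"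
    using sum sum.subset_diff[OF E, of f] by simp
  also have "\<dots> \<le> (\<Sum>j\<in>{..<d} - E. - (lam / 4) * \<bar>x $. j - bs $. j\<bar>) + (\<Sum>j\<in>E. 5 / 4 * lam * \<bar>x $. j - bs $. j\<bar>)"
    using off on E by (intro add_mono sum_mono) auto
  also have "\<dots> = - (lam / 4) * (\<Sum>j\<in>{..<d} - E. \<bar>x $. j - bs $. j\<bar>) + 5 / 4 * lam * (\<Sum>j\<in>E. \<bar>x $. j - bs $. j\<bar>)"
    by (simp only: sum_distrib_left)
  finally show ?thesis by simp
qed

lemma bs_zero: "active E \<Longrightarrow> j \<notin> E \<Longrightarrow> bs $. j = 0"
  by (auto simp: active_def supp_def)

lemma grad_bs_le: "j < d \<Longrightarrow> \<bar>g bs $. j\<bar> \<le> lam / 4"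
  using noise[of j] ep_nonneg by linarith

lemma basic_with_excess:
  assumes gw: "good_weights E lw" and x: "x \<in> Euc d"
  shows "D bs x + lam / 4 * (\<Sum>j\<in>{..<d} - E. \<bar>x $. j - bs $. j\<bar>)
     \<le> 5 / 4 * lam * (\<Sum>j\<in>E. \<bar>x $. j - bs $. j\<bar>) + (objF d L lw x - objF d L lw bs)"
proof (rule basic_bound)
  let ?f = "\<lambda>j. lw $. j * (\<bar>bs $. j\<bar> - \<bar>x $. j\<bar>) - g bs $. j * (x $. j - bs $. j)"
  show E: "active E" using gw by (simp add: good_weights_def)
  show "D bs x \<le> (\<Sum>j<d. ?f j) + (objF d L lw x - objF d L lw bs)"
    unfolding bregman_bs_sum[OF x]
    by (simp add: objF_def sum_subtractf right_diff_distrib)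
  fix j assume j: "j < d"
  have gj: "- (g bs $. j * (x $. j - bs $. j)) \<le> lam / 4 * \<bar>x $. j - bs $. j\<bar>"
  proof -
    have "\<bar>g bs $. j * (x $. j - bs $. j)\<bar> \<le> lam / 4 * \<bar>x $. j - bs $. j\<bar>"
      unfolding abs_mult using grad_bs_le[OF j] by (intro mult_right_mono) auto
    then show ?thesis by linarith
  qed
  {
    assume jE: "j \<notin> E"
    have "lam / 2 * \<bar>x $. j\<bar> \<le> lw $. j * \<bar>x $. j\<bar>"
      using gw j jE by (intro mult_right_mono) (auto simp: good_weights_def)
    then show "?f j \<le> - (lam / 4) * \<bar>x $. j - bs $. j\<bar>"
      using gj bs_zero[OF E jE] by simp
  next
    have "lw $. j * (\<bar>bs $. j\<bar> - \<bar>x $. j\<bar>) \<le> lw $. j * \<bar>x $. j - bs $. j\<bar>"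
      using gw j by (intro mult_left_mono) (auto simp: good_weights_def)
    also have "\<dots> \<le> lam * \<bar>x $. j - bs $. j\<bar>"
      using gw j by (intro mult_right_mono) (auto simp: good_weights_def)
    finally show "?f j \<le> 5 / 4 * lam * \<bar>x $. j - bs $. j\<bar>" using gj by simp
  }
qed

lemma basic_if_objF_le:
  assumes "good_weights E lw" "x \<in> Euc d" "objF d L lw x \<le> objF d L lw bs"
  shows "basic E x"
  using basic_with_excess[OF assms(1,2)] assms(3) by (simp add: basic_def)

lemma grad_le_if_omega_le:
  assumes gw: "good_weights E lw" and x: "x \<in> Euc d" and om: "omega d L lw x \<le> ep" and j: "j < d"
  shows "\<bar>g x $. j\<bar> \<le> lw $. j + ep"
  using omega_leD[OF x om j] gw j
  by (auto simp: good_weights_def sgn_if split: if_splits)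

lemma basic_if_omega_le:
  assumes gw: "good_weights E lw" and x: "x \<in> Euc d" and om: "omega d L lw x \<le> ep"
  shows "basic E x"
  unfolding basic_def
proof (subst add_0_right[symmetric], rule basic_bound)
  let ?f = "\<lambda>j. (g x $. j - g bs $. j) * (x $. j - bs $. j)"
  show E: "active E" using gw by (simp add: good_weights_def)
  have "g x - g bs \<in> Euc d" using x bs by blast
  then show "D bs x \<le> (\<Sum>j<d. ?f j) + 0"
    using bregman_le_inner[OF bs x] by (simp add: inner_Euc)
  fix j assume j: "j < d"
  have gj: "- (g bs $. j * (x $. j - bs $. j)) \<le> (lam / 4 - ep) * \<bar>x $. j - bs $. j\<bar>"
  proof -
    have "\<bar>g bs $. j * (x $. j - bs $. j)\<bar> \<le> (lam / 4 - ep) * \<bar>x $. j - bs $. j\<bar>"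
      unfolding abs_mult using noise[OF j] by (intro mult_right_mono) auto
    then show ?thesis by linarith
  qed
  have lw: "0 \<le> lw $. j" "lw $. j \<le> lam" using gw j by (auto simp: good_weights_def)
  {
    assume jE: "j \<notin> E"
    have lw2: "lam / 2 \<le> lw $. j" using gw j jE by (auto simp: good_weights_def)
    have "g x $. j * x $. j \<le> (ep - lam / 2) * \<bar>x $. j\<bar>"
    proof (cases "x $. j = 0")
      case False
      have "\<bar>g x $. j + lw $. j * sgn (x $. j)\<bar> \<le> ep"
        using omega_leD[OF x om j lw(1)] False by simp
      then have "\<bar>g x $. j + lw $. j * sgn (x $. j)\<bar> * \<bar>x $. j\<bar> \<le> ep * \<bar>x $. j\<bar>"
        by (intro mult_right_mono) auto
      then have "(g x $. j + lw $. j * sgn (x $. j)) * x $. j \<le> ep * \<bar>x $. j\<bar>"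
        by (metis abs_ge_self abs_mult order_trans)
      moreover have "sgn (x $. j) * x $. j = \<bar>x $. j\<bar>" by (simp add: sgn_if abs_if)
      moreover have "lam / 2 * \<bar>x $. j\<bar> \<le> lw $. j * \<bar>x $. j\<bar>" using lw2 by (intro mult_right_mono) auto
      ultimately show ?thesis by (simp add: algebra_simps)
    qed simp
    then show "?f j \<le> - (lam / 4) * \<bar>x $. j - bs $. j\<bar>"
      using gj bs_zero[OF E jE] by (simp add: algebra_simps)
  next
    have "g x $. j * (x $. j - bs $. j) \<le> \<bar>g x $. j\<bar> * \<bar>x $. j - bs $. j\<bar>"
      by (metis abs_ge_self abs_mult)
    also have "\<dots> \<le> (lam + ep) * \<bar>x $. j - bs $. j\<bar>"
      using grad_le_if_omega_le[OF gw x om j] lw by (intro mult_right_mono) auto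
    finally show "?f j \<le> 5 / 4 * lam * \<bar>x $. j - bs $. j\<bar>"
      using gj by (simp add: algebra_simps)
  }
qed

lemma weights_bounds:
  assumes "w \<in> tightening" "j < d"
  shows "0 \<le> weights d w lam x $. j \<and> weights d w lam x $. j \<le> lam"
  using assms lam_pos by (auto simp: weights_def tightening_def mult_left_le)

lemma good_weights_initial:
  assumes "w \<in> tightening"
  shows "good_weights (supp bs) (weights d w lam 0)"
proof -
  have "w 0 = 1" using assms by (simp add: tightening_def)
  then show ?thesis
    using supp_bs lam_pos by (auto simp: good_weights_def active_def weights_def)
qed

text \<open>
  A coordinate off the support that loses more than half of its weight exceeds the threshold
  \<open>18 / a / delta * lam\<close>, larger than \<open>err / sqrt s\<close>. More than \<open>s\<close> of them would contradict the error bound.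
\<close>

lemma good_weights_next:
  assumes w: "w \<in> tightening" and half: "1 / 2 \<le> w (18 / a / delta * lam)"
    and delta: "0 < delta" "delta < 1" and x: "norm (x - bs) \<le> err"
  obtains E where "good_weights E (weights d w lam x)"
proof -
  define N where "N = {j \<in> {..<d} - supp bs. w \<bar>x $. j\<bar> < 1 / 2}"
  define u where "u = 18 / a / delta * lam"
  have u0: "0 < u" using a_pos delta lam_pos by (simp add: u_def)
  have N: "N \<subseteq> {..<d}" by (auto simp: N_def)
  have big: "u \<le> \<bar>(x - bs) $. j\<bar>" if "j \<in> N" for j
  proof (rule ccontr)
    assume "\<not> ?thesis"
    then have "\<bar>x $. j\<bar> \<le> u" using that by (auto simp: N_def supp_def)
    then have "w u \<le> w \<bar>x $. j\<bar>" using w by (auto simp: tightening_def)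
    then show False using that half by (simp add: N_def u_def)
  qed
  have "real (card N) * u\<^sup>2 \<le> (norm (restr (x - bs) N))\<^sup>2"
    using card_large_le[OF N big] u0 by simp
  also have "\<dots> \<le> (norm (x - bs))\<^sup>2" by (intro power_mono norm_restr_le) auto
  also have "\<dots> \<le> err\<^sup>2" using x by (intro power_mono) auto
  also have "\<dots> = s * (10 * lam / a)\<^sup>2" by (simp add: err_def power_mult_distrib power_divide)
  also have "\<dots> \<le> s * u\<^sup>2"
  proof (intro mult_left_mono power_mono)
    show "10 * lam / a \<le> u" using a_pos delta lam_pos by (simp add: u_def field_simps)
  qed (use a_pos lam_pos in auto)
  finally have "real (card N) \<le> s" using u0 by simp
  then have "card (supp bs \<union> N) \<le> 2 * s" using card_Un_le[of "supp bs" N] by simp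
  moreover have "lam / 2 \<le> weights d w lam x $. j" if "j \<in> {..<d} - (supp bs \<union> N)" for j
    using that lam_pos by (auto simp: N_def weights_def field_simps)
  ultimately have "good_weights (supp bs \<union> N) (weights d w lam x)"
    using supp_bs N weights_bounds[OF w] by (auto simp: good_weights_def active_def)
  then show ?thesis by (rule that)
qed

end

section \<open>Iteration counts and the prox inequality\<close>

lemma norm_le_componentwise:
  assumes "v \<in> Euc d" "w \<in> Euc d" "\<And>j. j < d \<Longrightarrow> \<bar>v $. j\<bar> \<le> \<bar>w $. j\<bar>"
  shows "norm v \<le> norm w"
proof -
  have "(norm v)\<^sup>2 \<le> (norm w)\<^sup>2"
    unfolding norm2_Euc[OF assms(1)] norm2_Euc[OF assms(2)]
    by (rule sum_mono) (use assms(3) in \<open>auto simp: abs_le_square_iff\<close>)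
  then show ?thesis by (rule power2_le_imp_le) simp
qed

lemma norm2_three_points:
  fixes u p x :: "'a :: real_inner"
  shows "inner (x - p) (u - p) - (norm (p - x))\<^sup>2 / 2 = ((norm (u - p))\<^sup>2 - (norm (u - x))\<^sup>2) / 2"
  unfolding power2_norm_eq_inner
  by (simp add: inner_diff_left inner_diff_right inner_commute field_simps)

text \<open>
  The abstract form of both complexity bounds: if every iteration that does not reach the tolerance
  lowers a nonnegative potential by one, their number is at most the potential of the
  starting point plus one.
\<close>

lemma solves_by_potential:
  assumes step: "\<And>st. I st \<Longrightarrow> \<not> omega d L lw (fst st) \<le> eps \<Longrightarrow>
      \<exists>st'. lamm_step d L lw gu phi0 st st' \<and> I st' \<and> (omega d L lw (fst st') \<le> eps \<or> V st' + 1 \<le> V st)"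
    and V: "\<And>st. I st \<Longrightarrow> 0 \<le> (V st :: real)"
    and st: "I st"
  shows "\<exists>k st'. solves d L lw gu phi0 eps st k st' \<and> I st' \<and> omega d L lw (fst st') \<le> eps \<and> real k \<le> V st + 1"
proof -
  have "\<exists>k st'. solves d L lw gu phi0 eps st k st' \<and> I st' \<and> omega d L lw (fst st') \<le> eps \<and> real k \<le> V st + 1"
    if "I st" "V st \<le> real n" for n st
    using that
  proof (induction n arbitrary: st)
    case 0
    then have V0: "V st = 0" using V[of st] by simp
    show ?case
    proof (cases "omega d L lw (fst st) \<le> eps")
      case True
      then show ?thesis
        using 0 V0 by (intro exI[of _ 0] exI[of _ st]) (simp add: solves.stop)
    next
      case False
      then obtain st' where st': "lamm_step d L lw gu phi0 st st'" "I st'"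
        "omega d L lw (fst st') \<le> eps \<or> V st' + 1 \<le> V st"
        using step 0 by blast
      with V0 V[of st'] have om: "omega d L lw (fst st') \<le> eps" by linarith
      then have "solves d L lw gu phi0 eps st (Suc 0) st'"
        using False st' by (intro solves.step[OF False st'(1)] solves.stop)
      then show ?thesis using st' om V0 by (intro exI[of _ "Suc 0"] exI[of _ st']) simp
    qed
  next
    case (Suc n)
    show ?case
    proof (cases "omega d L lw (fst st) \<le> eps")
      case True
      then show ?thesis
        using Suc.prems V[of st] by (intro exI[of _ 0] exI[of _ st]) (simp add: solves.stop)
    next
      case False
      then obtain st' where st': "lamm_step d L lw gu phi0 st st'" "I st'"
        "omega d L lw (fst st') \<le> eps \<or> V st' + 1 \<le> V st"
        using step Suc.prems by blast
      show ?thesis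
      proof (cases "omega d L lw (fst st') \<le> eps")
        case True
        then have "solves d L lw gu phi0 eps st (Suc 0) st'"
          using False st' by (intro solves.step[OF False st'(1)] solves.stop)
        then show ?thesis
          using st' True V[OF Suc.prems(1)] by (intro exI[of _ "Suc 0"] exI[of _ st']) simp
      next
        case F2: False
        then have le: "V st' + 1 \<le> V st" using st' by blast
        with Suc.prems have "V st' \<le> real n" by simp
        with Suc.IH st'(2) obtain k st'' where k: "solves d L lw gu phi0 eps st' k st''" "I st''"
          "omega d L lw (fst st'') \<le> eps" "real k \<le> V st' + 1" by blast
        have "solves d L lw gu phi0 eps st (Suc k) st''"
          by (rule solves.step[OF False st'(1) k(1)])
        then show ?thesis
          using k le by (intro exI[of _ "Suc k"] exI[of _ st'']) simp
      qed
    qed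
  qed
  moreover obtain n where "V st \<le> real n" using real_arch_simple by blast
  ultimately show ?thesis using st by blast
qed

context convex_loss
begin

lemma accepts_iff:
  "accepts d L lw x phi \<longleftrightarrow> D x (T_op d L lw phi x) \<le> phi / 2 * (norm (T_op d L lw phi x - x))\<^sup>2"
  by (auto simp: accepts_def objF_def Psi_def bregman_def)

text \<open>
  The model is \<open>phi\<close>-strongly convex with minimizer \<open>p\<close>; an accepted model lies above the
  objective at \<open>p\<close>, and by convexity its value at \<open>u\<close> exceeds the objective by at most the
  quadratic term.
\<close>

lemma prox_inequality:
  assumes lw: "\<And>j. j < d \<Longrightarrow> 0 \<le> lw $. j" and phi: "0 < phi" and x: "x \<in> Euc d" and u: "u \<in> Euc d"
    and acc: "accepts d L lw x phi"
  defines "p \<equiv> T_op d L lw phi x"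
  shows "objF d L lw p + phi / 2 * ((norm (u - p))\<^sup>2 - (norm (u - x))\<^sup>2) \<le> objF d L lw u"
proof -
  have p: "p \<in> Euc d" by (simp add: p_def)
  define zeta where "zeta = phi *\<^sub>R (x - p) - g x"
  have zE: "zeta \<in> Euc d" using x p by (auto simp: zeta_def)
  have "(\<Sum>j<d. lw $. j * \<bar>p $. j\<bar> + zeta $. j * (u - p) $. j) \<le> (\<Sum>j<d. lw $. j * \<bar>u $. j\<bar>)"
  proof (rule sum_mono)
    fix j assume "j \<in> {..<d}"
    then have j: "j < d" by simp
    obtain xi where xi: "\<bar>xi\<bar> \<le> 1" "xi * p $. j = \<bar>p $. j\<bar>" "zeta $. j = lw $. j * xi"
      using T_op_multiplier[of lw j phi d L x] lw[OF j] phi j unfolding p_def[symmetric] zeta_def by auto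
    have "xi * u $. j \<le> \<bar>xi\<bar> * \<bar>u $. j\<bar>" by (metis abs_ge_self abs_mult)
    also have "\<dots> \<le> 1 * \<bar>u $. j\<bar>" using xi(1) by (intro mult_right_mono) auto
    finally have "xi * u $. j \<le> 1 * \<bar>u $. j\<bar>" .
    then have "xi * (u - p) $. j \<le> \<bar>u $. j\<bar> - \<bar>p $. j\<bar>"
      using xi(2) by (simp add: right_diff_distrib)
    then have "lw $. j * (xi * (u - p) $. j) \<le> lw $. j * (\<bar>u $. j\<bar> - \<bar>p $. j\<bar>)"
      using lw[OF j] by (rule mult_left_mono)
    then show "lw $. j * \<bar>p $. j\<bar> + zeta $. j * (u - p) $. j \<le> lw $. j * \<bar>u $. j\<bar>"
      unfolding xi(3) by (simp add: right_diff_distrib mult.assoc)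
  qed
  then have pen: "(\<Sum>j<d. lw $. j * \<bar>p $. j\<bar>) + inner zeta (u - p) \<le> (\<Sum>j<d. lw $. j * \<bar>u $. j\<bar>)"
    unfolding inner_Euc[OF zE] sum.distrib .
  have up: "objF d L lw p \<le> L x + inner (g x) (p - x) + phi / 2 * (norm (p - x))\<^sup>2 + (\<Sum>j<d. lw $. j * \<bar>p $. j\<bar>)"
    using acc by (simp add: accepts_def Psi_def p_def)
  have lo: "L x + inner (g x) (u - x) + (\<Sum>j<d. lw $. j * \<bar>u $. j\<bar>) \<le> objF d L lw u"
    using gradient_inequality[OF x u] by (simp add: objF_def)
  have z: "inner zeta (u - p) = phi * inner (x - p) (u - p) - inner (g x) (u - x) + inner (g x) (p - x)"
  proof -
    have "inner zeta (u - p) = phi * inner (x - p) (u - p) - inner (g x) (u - p)"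
      by (simp add: zeta_def inner_diff_left)
    moreover have "inner (g x) (u - p) = inner (g x) (u - x) - inner (g x) (p - x)"
      by (simp add: inner_diff_right)
    ultimately show ?thesis by linarith
  qed
  have "phi / 2 * ((norm (u - p))\<^sup>2 - (norm (u - x))\<^sup>2)
      = phi * (((norm (u - p))\<^sup>2 - (norm (u - x))\<^sup>2) / 2)" by simp
  also have "\<dots> = phi * inner (x - p) (u - p) - phi / 2 * (norm (p - x))\<^sup>2"
    unfolding norm2_three_points[symmetric] by (simp add: right_diff_distrib)
  finally show ?thesis using pen up lo z by linarith
qed

lemma omega_T_op_le:
  assumes d: "0 < d" and lw: "\<And>j. j < d \<Longrightarrow> 0 \<le> lw $. j" and phi: "0 < phi" and x: "x \<in> Euc d"
  defines "p \<equiv> T_op d L lw phi x"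
  shows "omega d L lw p \<le> norm (g p - g x) + phi * norm (p - x)"
proof (rule omega_le[OF d])
  show "p \<in> Euc d" by (simp add: p_def)
  fix j assume j: "j < d"
  obtain xi where xi: "\<bar>xi\<bar> \<le> 1" "xi * p $. j = \<bar>p $. j\<bar>"
    "phi * (x $. j - p $. j) - g x $. j = lw $. j * xi"
    using T_op_multiplier[of lw j phi d L x] lw[OF j] phi j unfolding p_def[symmetric] by blast
  have "\<bar>g p $. j + lw $. j * xi\<bar> = \<bar>((g p - g x) + phi *\<^sub>R (x - p)) $. j\<bar>"
    unfolding xi(3)[symmetric] by simp
  also have "\<dots> \<le> norm ((g p - g x) + phi *\<^sub>R (x - p))" by (rule abs_entry_le_norm)
  also have "\<dots> \<le> norm (g p - g x) + norm (phi *\<^sub>R (x - p))" by (rule norm_triangle_ineq)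
  also have "norm (phi *\<^sub>R (x - p)) = phi * norm (p - x)"
    using phi by (simp add: norm_minus_commute)
  finally show "\<exists>xi. \<bar>xi\<bar> \<le> 1 \<and> xi * p $. j = \<bar>p $. j\<bar> \<and>
      \<bar>g p $. j + lw $. j * xi\<bar> \<le> norm (g p - g x) + phi * norm (p - x)"
    using xi by blast
qed

end

section \<open>Line search and the contraction stage\<close>

text \<open>
  The Lipschitz ball has three times the radius \<open>norm bs + err\<close> within which all iterates stay. This
  leaves room for the trial points of the line search and for the auxiliary point of cocoercivity.
  The bound \<open>a \<le> c\<close> can be arranged by enlarging \<open>c\<close>; it keeps the radius independent of \<open>c\<close>.
\<close>

locale lamm_problem = sparse_problem +
  fixes c gu phi0 :: real
  assumes lip: "c-lipschitz_on (cball bs (3 * (norm bs + 10 * e / a)) \<inter> Euc d) g"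
    and a_le_c: "a \<le> c" and gu: "1 < gu" and phi0_pos: "0 < phi0" and phi0_le: "phi0 \<le> c"
begin

definition M :: real where "M = norm bs + err"

lemma lipM: "c-lipschitz_on (cball bs (3 * M) \<inter> Euc d) g"
  using lip by (simp add: M_def err_def)

lemma c_pos: "0 < c" using a_pos a_le_c by linarith

lemma err_le_M: "err \<le> M" by (simp add: M_def)

lemma M_pos: "0 < M" using err_pos err_le_M by linarith

lemma good_nonneg: "good_weights E lw \<Longrightarrow> j < d \<Longrightarrow> 0 \<le> lw $. j"
  by (simp add: good_weights_def)

text \<open>
  Compare with the step \<open>q\<close> from the truth itself. The proximal map is nonexpansive, so for \<open>c \<le> phi\<close>
  the two steps end at most \<open>2 * M\<close> apart; and \<open>q\<close> moves only the coordinates in \<open>E\<close>, the noise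
  being below the threshold elsewhere.
\<close>

lemma T_op_in_ball:
  assumes gw: "good_weights E lw" and phi: "c \<le> phi" and x: "x \<in> Euc d" and xM: "norm (x - bs) \<le> M"
  shows "norm (T_op d L lw phi x - bs) \<le> 3 * M"
proof -
  have phi_pos: "0 < phi" using phi c_pos by linarith
  define p q where "p = T_op d L lw phi x" and "q = T_op d L lw phi bs"
  have E: "E \<subseteq> {..<d}" "card E \<le> 2 * s" using gw by (auto simp: good_weights_def active_def)
  define z where "z = (x - bs) - (1 / phi) *\<^sub>R (g x - g bs)"
  have zE: "z \<in> Euc d" using x bs by (auto simp: z_def)
  have t: "0 \<le> lw $. j / phi" if "j < d" for j using good_nonneg[OF gw that] phi_pos by simp
  have "norm (p - q) \<le> norm z"
  proof (rule norm_le_componentwise)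
    fix j assume j: "j < d"
    show "\<bar>(p - q) $. j\<bar> \<le> \<bar>z $. j\<bar>"
      using soft_nonexpansive[OF t[OF j], of "x $. j - g x $. j / phi" "bs $. j - g bs $. j / phi"]
      by (simp add: p_def q_def z_def T_op_entry[OF j] diff_divide_distrib algebra_simps)
  qed (auto simp: p_def q_def zE)
  also have "\<dots> \<le> norm (x - bs) + norm ((1 / phi) *\<^sub>R (g x - g bs))"
    unfolding z_def by (rule norm_triangle_ineq4)
  also have "norm ((1 / phi) *\<^sub>R (g x - g bs)) \<le> norm (x - bs)"
  proof -
    have "norm (g x - g bs) \<le> c * norm (x - bs)"
      using lipschitz_onD[OF lipM, of x bs] x bs xM M_pos
      by (simp add: dist_norm norm_minus_commute)
    also have "\<dots> \<le> phi * norm (x - bs)" using phi by (intro mult_right_mono) auto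
    finally show ?thesis using phi_pos by (simp add: pos_divide_le_eq mult.commute)
  qed
  finally have pq: "norm (p - q) \<le> 2 * M" using xM by simp
  define v where "v = mkvec d (\<lambda>j. if j \<in> E then 5 / 4 * lam / a else 0)"
  have "norm (q - bs) \<le> norm v"
  proof (rule norm_le_componentwise)
    fix j assume j: "j < d"
    have gj: "\<bar>g bs $. j\<bar> \<le> lam / 4" by (rule grad_bs_le[OF j])
    show "\<bar>(q - bs) $. j\<bar> \<le> \<bar>v $. j\<bar>"
    proof (cases "j \<in> E")
      case False
      then have b0: "bs $. j = 0" using gw bs_zero by (auto simp: good_weights_def)
      have "lam / 2 \<le> lw $. j" using gw j False by (auto simp: good_weights_def)
      then have "\<bar>g bs $. j\<bar> \<le> lw $. j" using gj lam_pos by linarith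
      then have "\<bar>bs $. j - g bs $. j / phi\<bar> \<le> lw $. j / phi"
        using phi_pos b0 by (simp add: divide_right_mono)
      then have "q $. j = 0" unfolding q_def T_op_entry[OF j] by (rule soft_zero)
      then show ?thesis using b0 by simp
    next
      case True
      have lwj: "lw $. j \<le> lam" using gw j by (auto simp: good_weights_def)
      have "\<bar>q $. j - (bs $. j - g bs $. j / phi)\<bar> \<le> lw $. j / phi"
        unfolding q_def T_op_entry[OF j] by (rule soft_near[OF t[OF j]])
      then have "\<bar>q $. j - bs $. j\<bar> \<le> lw $. j / phi + \<bar>g bs $. j / phi\<bar>" by linarith
      also have "\<dots> = (lw $. j + \<bar>g bs $. j\<bar>) / phi" using phi_pos by (simp add: add_divide_distrib)
      also have "\<dots> \<le> (5 / 4 * lam) / phi" using gj lwj phi_pos by (intro divide_right_mono) auto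
      also have "\<dots> \<le> 5 / 4 * lam / a"
        using phi a_le_c a_pos lam_pos by (intro divide_left_mono) auto
      finally show ?thesis using True j lam_pos a_pos by (simp add: v_def)
    qed
  qed (auto simp: q_def v_def bs)
  also have "\<dots> \<le> err"
  proof (rule power2_le_imp_le)
    have "(norm v)\<^sup>2 = (\<Sum>j<d. if j \<in> E then (5 / 4 * lam / a)\<^sup>2 else 0)"
      unfolding norm2_Euc[of v d, unfolded v_def, OF Euc_closed_ops(6)] v_def
      by (intro sum.cong) auto
    also have "\<dots> = real (card E) * (5 / 4 * lam / a)\<^sup>2"
      using E(1) by (simp add: sum.If_cases Int_absorb1)
    also have "\<dots> \<le> real (2 * s) * (5 / 4 * lam / a)\<^sup>2"
      using E(2) by (intro mult_right_mono) auto
    also have "\<dots> = 50 / 16 * (real s * (lam / a)\<^sup>2)" by (simp add: power2_eq_square)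
    also have "\<dots> \<le> 100 * (real s * (lam / a)\<^sup>2)" by (intro mult_right_mono) auto
    also have "\<dots> = err\<^sup>2" by (simp add: err_def power_mult_distrib power_divide)
    finally show "(norm v)\<^sup>2 \<le> err\<^sup>2" .
  qed (use err_pos in simp)
  finally have "norm (q - bs) \<le> M" using err_le_M by linarith
  moreover have "norm (p - bs) \<le> norm (p - q) + norm (q - bs)"
    using norm_triangle_ineq[of "p - q" "q - bs"] by simp
  ultimately show ?thesis using pq unfolding p_def by linarith
qed

text \<open>
  Backtracking stops below \<open>gu * c\<close> because every parameter from \<open>c\<close> on is accepted; \<open>T_op_in_ball\<close>
  places the trial points where the gradient is Lipschitz.
\<close>

lemma line_search:
  assumes gw: "good_weights E lw" and x: "x \<in> Euc d" and xM: "norm (x - bs) \<le> M"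
    and phi: "phi \<le> gu * c"
  obtains phi' where "lamm_step d L lw gu phi0 (x, phi) (T_op d L lw phi' x, phi')"
    "accepts d L lw x phi'" "0 < phi'" "phi' \<le> gu * c"
proof -
  define f where "f = max phi0 (phi / gu)"
  have f: "0 < f" "f \<le> c"
    using phi0_pos phi0_le phi gu by (auto simp: f_def pos_divide_le_eq mult.commute)
  have acc: "accepts d L lw x psi" if psi: "c \<le> psi" for psi
    unfolding accepts_iff
  proof -
    have "D x (T_op d L lw psi x) \<le> c / 2 * (norm (T_op d L lw psi x - x))\<^sup>2"
    proof (rule descent[OF _ _ lipM])
      show "convex (cball bs (3 * M) \<inter> Euc d)" by (intro convex_Int convex_cball convex_Euc)
      show "x \<in> cball bs (3 * M) \<inter> Euc d" using x xM M_pos by (simp add: dist_norm norm_minus_commute)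
      show "T_op d L lw psi x \<in> cball bs (3 * M) \<inter> Euc d"
        using T_op_in_ball[OF gw psi x xM] by (simp add: dist_norm norm_minus_commute)
    qed auto
    also have "\<dots> \<le> psi / 2 * (norm (T_op d L lw psi x - x))\<^sup>2"
      using psi by (intro mult_right_mono) auto
    finally show "D x (T_op d L lw psi x) \<le> psi / 2 * (norm (T_op d L lw psi x - x))\<^sup>2" .
  qed
  \<comment> \<open>The predecessor of the first accepted parameter is below \<open>c\<close>.\<close>
  obtain m0 where "c / f < gu ^ m0" using real_arch_pow[OF gu] by blast
  then have "c \<le> gu ^ m0 * f" using f by (simp add: pos_divide_less_eq)
  then have m0: "accepts d L lw x (gu ^ m0 * f)" by (rule acc)
  define m where "m = (LEAST m. accepts d L lw x (gu ^ m * f))"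
  have m: "accepts d L lw x (gu ^ m * f)" unfolding m_def using m0 by (rule LeastI)
  have below: "\<not> accepts d L lw x (gu ^ i * f)" if "i < m" for i
    using that not_less_Least unfolding m_def by blast
  have le: "gu ^ m * f \<le> gu * c"
  proof (cases m)
    case 0
    have "1 * c \<le> gu * c" using gu c_pos by (intro mult_right_mono) auto
    moreover have "gu ^ m * f = f" using 0 by simp
    ultimately show ?thesis using f by linarith
  next
    case (Suc i)
    then have "\<not> c \<le> gu ^ i * f" using below[of i] acc by blast
    then have "gu * (gu ^ i * f) \<le> gu * c" using gu by (intro mult_left_mono) auto
    then show ?thesis using Suc by (simp add: mult.assoc)
  qed
  have "lamm_step d L lw gu phi0 (x, phi) (T_op d L lw (gu ^ m * f) x, gu ^ m * f)"
    unfolding lamm_step_def using m below by (auto simp: f_def)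
  moreover have "0 < gu ^ m * f" using gu f by simp
  ultimately show ?thesis using that m le by blast
qed

lemma objF_decreases:
  assumes "good_weights E lw" "0 < phi" "x \<in> Euc d" "accepts d L lw x phi"
  shows "objF d L lw (T_op d L lw phi x) + phi / 2 * (norm (T_op d L lw phi x - x))\<^sup>2 \<le> objF d L lw x"
  using prox_inequality[OF good_nonneg[OF assms(1)] assms(2,3,3,4)]
  by (simp add: norm_minus_commute)

text \<open>
  As long as the objective stays above its value at the truth, the distance to the truth does not
  increase; below that value the error bound applies.
\<close>

lemma distance_step:
  assumes gw: "good_weights E lw" and phi: "0 < phi" and x: "x \<in> Euc d" and acc: "accepts d L lw x phi"
    and rho: "norm (x - bs) \<le> rho" "err \<le> rho"
  shows "norm (T_op d L lw phi x - bs) \<le> rho"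
proof (cases "objF d L lw (T_op d L lw phi x) \<le> objF d L lw bs")
  case True
  then have "basic E (T_op d L lw phi x)" by (intro basic_if_objF_le[OF gw]) auto
  then have "norm (T_op d L lw phi x - bs) \<le> err"
    using gw by (intro basic_error) (auto simp: good_weights_def)
  then show ?thesis using rho by linarith
next
  case False
  define p where "p = T_op d L lw phi x"
  have "phi / 2 * ((norm (bs - p))\<^sup>2 - (norm (bs - x))\<^sup>2) < 0"
    using prox_inequality[OF good_nonneg[OF gw] phi x bs acc] False unfolding p_def by linarith
  then have "(norm (bs - p))\<^sup>2 - (norm (bs - x))\<^sup>2 < 0"
    using phi by (simp only: mult_less_0_iff) auto
  then have "(norm (bs - p))\<^sup>2 \<le> (norm (bs - x))\<^sup>2" by linarith
  then have "norm (bs - p) \<le> norm (bs - x)" by (rule power2_le_imp_le) simp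
  then show ?thesis using rho by (simp add: p_def norm_minus_commute)
qed

text \<open>
  Cocoercivity converts the acceptance test, an upper bound on the Bregman divergence that scales
  with \<open>phi\<close>, into a bound on the change of the gradient. This keeps the constant free of a lower
  bound on \<open>phi\<close>, hence of \<open>phi0\<close>.
\<close>

lemma omega_le_decrease:
  assumes gw: "good_weights E lw" and phi: "0 < phi" "phi \<le> gu * c"
    and x: "x \<in> Euc d" and acc: "accepts d L lw x phi"
    and xM: "norm (x - bs) \<le> M"
    and nn: "0 \<le> omega d L lw (T_op d L lw phi x)"
  shows "(omega d L lw (T_op d L lw phi x))\<^sup>2
    \<le> 4 * c * (1 + gu) * (objF d L lw x - objF d L lw (T_op d L lw phi x))"
proof -
  define p where "p = T_op d L lw phi x"
  define U where "U = cball bs (3 * M) \<inter> Euc d"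
  define k where "k = norm (g p - g x)"
  define h where "h = norm (p - x)"
  have pE: "p \<in> Euc d" by (simp add: p_def)
  have pM: "norm (p - bs) \<le> M"
    unfolding p_def by (rule distance_step[OF gw phi(1) x acc xM err_le_M])
  have U: "convex U" "U \<subseteq> Euc d" "c-lipschitz_on U g"
    using lipM unfolding U_def by (auto intro: convex_Int convex_cball convex_Euc)
  have xp: "x \<in> U" "p \<in> U"
    using x xM pE pM M_pos by (auto simp: U_def dist_norm norm_minus_commute)
  have hM: "h \<le> 2 * M"
    using norm_triangle_ineq4[of "p - bs" "x - bs"] pM xM by (simp add: h_def)
  have kh: "k \<le> c * h"
    using lipschitz_onD[OF U(3) xp(2,1)] by (simp add: dist_norm k_def h_def)
  have "p - (1 / c) *\<^sub>R (g p - g x) \<in> U"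
  proof -
    have "norm ((1 / c) *\<^sub>R (g p - g x)) \<le> h"
      using kh c_pos by (simp add: k_def pos_divide_le_eq mult.commute)
    then have "norm (p - bs - (1 / c) *\<^sub>R (g p - g x)) \<le> M + 2 * M"
      using norm_triangle_ineq4[of "p - bs" "(1 / c) *\<^sub>R (g p - g x)"] pM hM by linarith
    moreover have "p - bs - (1 / c) *\<^sub>R (g p - g x) = p - (1 / c) *\<^sub>R (g p - g x) - bs"
      by (simp only: diff_diff_add add.commute)
    ultimately have "norm (p - (1 / c) *\<^sub>R (g p - g x) - bs) \<le> M + 2 * M" by simp
    then show ?thesis using pE x by (simp add: U_def dist_norm norm_minus_commute)
  qed
  then have "k\<^sup>2 \<le> 2 * c * D x p"
    unfolding k_def by (rule cocoercive[OF U c_pos xp])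
  also have "\<dots> \<le> 2 * c * (phi / 2 * h\<^sup>2)"
    using acc c_pos unfolding accepts_iff p_def h_def by (intro mult_left_mono) auto
  finally have k2: "k\<^sup>2 \<le> c * phi * h\<^sup>2" by simp
  have dec: "phi / 2 * h\<^sup>2 \<le> objF d L lw x - objF d L lw p"
    using objF_decreases[OF gw phi(1) x acc] unfolding p_def h_def by linarith
  have "omega d L lw p \<le> k + phi * h"
    unfolding k_def h_def p_def by (rule omega_T_op_le[OF d_pos good_nonneg[OF gw] phi(1) x])
  then have "(omega d L lw p)\<^sup>2 \<le> (k + phi * h)\<^sup>2"
    using nn unfolding p_def by (intro power_mono)
  also have "\<dots> \<le> 2 * k\<^sup>2 + 2 * (phi * h)\<^sup>2"
    using zero_le_power2[of "k - phi * h"] by (simp add: power2_eq_square algebra_simps)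
  also have "\<dots> \<le> 2 * (c * phi * h\<^sup>2) + 2 * (phi * h)\<^sup>2" using k2 by simp
  also have "\<dots> = 4 * (c + phi) * (phi / 2 * h\<^sup>2)" by (simp add: power2_eq_square algebra_simps)
  also have "\<dots> \<le> 4 * (c + gu * c) * (phi / 2 * h\<^sup>2)"
    using phi by (intro mult_right_mono) auto
  also have "\<dots> \<le> 4 * (c + gu * c) * (objF d L lw x - objF d L lw p)"
    using dec c_pos gu by (intro mult_left_mono) auto
  also have "4 * (c + gu * c) = 4 * c * (1 + gu)" by (simp add: algebra_simps)
  finally show ?thesis by (simp add: p_def)
qed

text \<open>
  The potential is the excess of the objective over the lower bound \<open>low\<close>, in units of the decrease
  \<open>eps\<^sup>2 / kap\<close> of a step that misses the tolerance.
\<close>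

lemma contraction_stage:
  assumes gw: "good_weights E lw" and lw: "\<And>j. j < d \<Longrightarrow> lw $. j = lam" and eps: "0 < eps"
  shows "\<exists>k x phi. solves d L lw gu phi0 eps (0, phi0) k (x, phi) \<and> x \<in> Euc d \<and> phi \<le> gu * c \<and>
    omega d L lw x \<le> eps \<and>
    real k \<le> 4 * c * (1 + gu) * (e * norm bs + c * (norm bs)\<^sup>2) / eps\<^sup>2 + 1"
proof -
  define kap where "kap = 4 * c * (1 + gu)"
  have kap: "0 < kap" using c_pos gu by (simp add: kap_def)
  have "(\<Sum>j\<in>supp bs. \<bar>bs $. j\<bar>) \<le> sqrt s * norm (restr bs (supp bs))"
    by (rule l1_le_sqrt_card[OF supp_bs]) simp
  also have "\<dots> \<le> sqrt s * norm bs" by (intro mult_left_mono norm_restr_le) auto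
  also have "(\<Sum>j\<in>supp bs. \<bar>bs $. j\<bar>) = (\<Sum>j<d. \<bar>bs $. j\<bar>)"
    using supp_bs by (intro sum.mono_neutral_left) (auto simp: supp_def)
  finally have l1: "(\<Sum>j<d. \<bar>bs $. j\<bar>) \<le> sqrt s * norm bs" .
  have gl: "(\<Sum>j<d. \<bar>g bs $. j * bs $. j\<bar>) \<le> e * norm bs / 4"
  proof -
    have "(\<Sum>j<d. \<bar>g bs $. j * bs $. j\<bar>) \<le> (\<Sum>j<d. lam / 4 * \<bar>bs $. j\<bar>)"
      unfolding abs_mult using grad_bs_le by (intro sum_mono mult_right_mono) auto
    also have "\<dots> = lam / 4 * (\<Sum>j<d. \<bar>bs $. j\<bar>)" by (simp add: sum_distrib_left)
    also have "\<dots> \<le> lam / 4 * (sqrt s * norm bs)" using l1 lam_pos by (intro mult_left_mono) auto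
    finally show ?thesis by simp
  qed
  have gE: "g bs \<in> Euc d" using bs by blast
  have ib: "\<bar>inner (g bs) bs\<bar> \<le> e * norm bs / 4"
    unfolding inner_Euc[OF gE] using sum_abs[of "\<lambda>j. g bs $. j * bs $. j" "{..<d}"] gl by linarith
  define low where "low = L bs - e * norm bs / 4"
  have low: "low \<le> objF d L lw x" if x: "x \<in> Euc d" for x
  proof -
    have "L bs + inner (g bs) (x - bs) \<le> L x" by (rule gradient_inequality[OF bs x])
    moreover have "0 \<le> inner (g bs) x + (\<Sum>j<d. lw $. j * \<bar>x $. j\<bar>)"
      unfolding inner_Euc[OF gE] sum.distrib[symmetric]
    proof (rule sum_nonneg)
      fix j assume "j \<in> {..<d}"
      then have j: "j < d" by simp
      have "\<bar>g bs $. j * x $. j\<bar> \<le> lam * \<bar>x $. j\<bar>"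
        unfolding abs_mult using grad_bs_le[OF j] lam_pos by (intro mult_right_mono) auto
      then show "0 \<le> g bs $. j * x $. j + lw $. j * \<bar>x $. j\<bar>" unfolding lw[OF j] by linarith
    qed
    ultimately show ?thesis using ib unfolding objF_def low_def inner_diff_right by linarith
  qed
  have U: "convex (cball bs (3 * M) \<inter> Euc d)" by (intro convex_Int convex_cball convex_Euc)
  have nb: "norm bs \<le> 3 * M" using err_pos norm_ge_zero[of bs] by (simp add: M_def)
  have "D bs 0 \<le> c / 2 * (norm (0 - bs))\<^sup>2"
    by (rule descent[OF U _ lipM]) (use bs M_pos nb in auto)
  then have "D bs 0 \<le> c / 2 * (norm bs)\<^sup>2" by simp
  moreover have "D bs 0 = L 0 - L bs + inner (g bs) bs" by (simp add: bregman_def)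
  ultimately have "L 0 \<le> L bs + e * norm bs / 4 + c / 2 * (norm bs)\<^sup>2"
    using ib by linarith
  then have "objF d L lw 0 - low \<le> e * norm bs / 2 + c / 2 * (norm bs)\<^sup>2"
    by (simp add: objF_def low_def)
  moreover have "0 \<le> e * norm bs" "0 \<le> c * (norm bs)\<^sup>2" using e_pos c_pos by simp_all
  ultimately have gap: "objF d L lw 0 - low \<le> e * norm bs + c * (norm bs)\<^sup>2" by linarith
  define V where "V st = kap * (objF d L lw (fst st) - low) / eps\<^sup>2" for st :: "fvec \<times> real"
  define I where "I st \<longleftrightarrow> fst st \<in> Euc d \<and> norm (fst st - bs) \<le> M \<and> snd st \<le> gu * c" for st :: "fvec \<times> real"
  have "\<exists>k st'. solves d L lw gu phi0 eps (0, phi0) k st' \<and> I st' \<and> omega d L lw (fst st') \<le> eps \<and> real k \<le> V (0, phi0) + 1"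
  proof (rule solves_by_potential)
    fix st assume I: "I st"
    then show "0 \<le> V st" using low kap by (auto simp: V_def I_def)
    obtain x phi where st: "st = (x, phi)" by (metis surj_pair)
    have x: "x \<in> Euc d" "norm (x - bs) \<le> M" "phi \<le> gu * c" using I by (auto simp: I_def st)
    obtain phi' where ls: "lamm_step d L lw gu phi0 (x, phi) (T_op d L lw phi' x, phi')"
      "accepts d L lw x phi'" "0 < phi'" "phi' \<le> gu * c"
      using line_search[OF gw x] by blast
    have "I (T_op d L lw phi' x, phi')"
      using distance_step[OF gw ls(3) x(1) ls(2) x(2) err_le_M] ls by (simp add: I_def)
    moreover have "V (T_op d L lw phi' x, phi') + 1 \<le> V st" if om: "\<not> omega d L lw (T_op d L lw phi' x) \<le> eps"
    proof -
      have "eps\<^sup>2 \<le> (omega d L lw (T_op d L lw phi' x))\<^sup>2" using om eps by (intro power_mono) auto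
      also have "\<dots> \<le> kap * (objF d L lw x - objF d L lw (T_op d L lw phi' x))"
        unfolding kap_def using om eps by (intro omega_le_decrease[OF gw ls(3,4) x(1) ls(2) x(2)]) auto
      finally have "1 \<le> kap * (objF d L lw x - objF d L lw (T_op d L lw phi' x)) / eps\<^sup>2"
        using eps by (simp add: pos_le_divide_eq)
      also have "\<dots> = V st - V (T_op d L lw phi' x, phi')"
        by (simp add: V_def st diff_divide_distrib right_diff_distrib)
      finally show ?thesis by linarith
    qed
    ultimately show "\<exists>st'. lamm_step d L lw gu phi0 st st' \<and> I st' \<and> (omega d L lw (fst st') \<le> eps \<or> V st' + 1 \<le> V st)"
      using ls(1) unfolding st by (intro exI[of _ "(T_op d L lw phi' x, phi')"]) auto
  next
    have "phi0 \<le> gu * c" using phi0_le gu c_pos mult_right_mono[of 1 gu c] by linarith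
    then show "I (0, phi0)" using err_pos by (simp add: I_def M_def)
  qed
  then obtain k x phi where "solves d L lw gu phi0 eps (0, phi0) k (x, phi)" "I (x, phi)"
    "omega d L lw x \<le> eps" and k: "real k \<le> V (0, phi0) + 1"
    by (metis fst_conv surj_pair)
  moreover have "V (0, phi0) \<le> kap * (e * norm bs + c * (norm bs)\<^sup>2) / eps\<^sup>2"
    unfolding V_def fst_conv using gap kap by (intro divide_right_mono mult_left_mono) auto
  ultimately show ?thesis unfolding I_def kap_def by fastforce
qed

end

section \<open>Minimizers and quadratic growth\<close>

lemma bounded_linear_entry: "bounded_linear (\<lambda>v. v $. j)"
  by (rule bounded_linear_intro[of _ 1]) (auto simp: abs_entry_le_norm)

lemmas continuous_on_entry [continuous_intros] = bounded_linear.continuous_on[OF bounded_linear_entry]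

text \<open>
  Bounded closed sets need not be compact in the ambient space of finitely supported sequences; within
  \<open>Euc d\<close> they are, by adding one coordinate at a time.
\<close>

lemma compact_box: "compact {v \<in> Euc d. \<forall>i. \<bar>v $. i\<bar> \<le> K}"
proof (induction d)
  case 0
  have "{v \<in> Euc 0. \<forall>i. \<bar>v $. i\<bar> \<le> K} \<subseteq> {0}" by (auto simp: Euc_def intro: fvec_eqI)
  then show ?case using finite_imp_compact finite_subset by blast
next
  case (Suc d)
  define u where "u = mkvec (Suc d) (\<lambda>i. if i = d then 1 else 0)"
  have u: "u $. i = (if i = d then 1 else 0)" for i by (simp add: u_def)
  define f where "f = (\<lambda>(v, t). v + t *\<^sub>R u)"
  let ?B = "\<lambda>d. {v \<in> Euc d. \<forall>i. \<bar>v $. i\<bar> \<le> K}"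
  have "?B (Suc d) = f ` (?B d \<times> {-K..K})"
  proof (intro set_eqI iffI)
    fix v assume v: "v \<in> ?B (Suc d)"
    have "v = f (restr v {..<d}, v $. d)"
      using v by (intro fvec_eqI) (auto simp: f_def u Euc_def)
    moreover have "(restr v {..<d}, v $. d) \<in> ?B d \<times> {-K..K}"
    proof -
      have "\<bar>v $. i\<bar> \<le> K" for i using v by simp
      moreover from this[of d] have "0 \<le> K" "- K \<le> v $. d" "v $. d \<le> K" by linarith+
      ultimately show ?thesis by (auto simp: Euc_def)
    qed
    ultimately show "v \<in> f ` (?B d \<times> {-K..K})" by (rule image_eqI)
  next
    fix v assume "v \<in> f ` (?B d \<times> {-K..K})"
    then obtain w t where w: "w \<in> ?B d" "-K \<le> t" "t \<le> K" "v = w + t *\<^sub>R u"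
      by (auto simp: f_def)
    have "\<bar>v $. i\<bar> \<le> K" for i
      using w by (cases "i = d") (auto simp: u Euc_def)
    moreover have "v \<in> Euc (Suc d)" using w by (auto simp: Euc_def u)
    ultimately show "v \<in> ?B (Suc d)" by simp
  qed
  moreover have "compact (f ` (?B d \<times> {-K..K}))"
    unfolding f_def case_prod_unfold
    by (intro compact_continuous_image compact_Times Suc.IH compact_Icc continuous_intros)
  ultimately show ?case by simp
qed

context convex_loss
begin

lemma continuous_objF: "continuous_on (Euc d) (objF d L lw)"
  unfolding objF_def[abs_def] by (intro continuous_intros continuous_loss)

text \<open>The variational inequality for a minimizer, tested with a change \<open>t\<close> of one coordinate.\<close>

lemma minimizer_coordinate:
  assumes x: "x \<in> Euc d" and min: "\<And>u. u \<in> Euc d \<Longrightarrow> objF d L lw x \<le> objF d L lw u"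
    and lw: "0 \<le> lw $. j" and j: "j < d"
  shows "0 \<le> g x $. j * t + lw $. j * (\<bar>x $. j + t\<bar> - \<bar>x $. j\<bar>)"
proof (rule ccontr)
  assume neg: "\<not> ?thesis"
  define h where "h = mkvec d (\<lambda>i. if i = j then t else 0)"
  have h: "h \<in> Euc d" by (simp add: h_def)
  define P where "P = lw $. j * (\<bar>x $. j + t\<bar> - \<bar>x $. j\<bar>)"
  define q where "q u = L (x + u *\<^sub>R h) + u * P" for u :: real
  have gE: "g x \<in> Euc d" using x by blast
  have ih: "inner (g x) h = g x $. j * t"
    unfolding inner_Euc[OF gE] h_def using j by (simp add: if_distrib[of "\<lambda>x. _ * x"] cong: if_cong)
  have "(q has_real_derivative inner (g (x + 0 *\<^sub>R h)) h + P) (at 0)"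
    unfolding q_def[abs_def] by (rule derivative_eq_intros line_derivative x h refl | simp)+
  moreover have "inner (g (x + 0 *\<^sub>R h)) h + P < 0" using neg ih by (simp add: P_def)
  ultimately obtain e where e: "0 < e" "\<And>u. 0 < u \<Longrightarrow> u < e \<Longrightarrow> q (0 + u) < q 0"
    using DERIV_neg_dec_right by blast
  define u where "u = min 1 (e / 2)"
  have u: "0 < u" "u \<le> 1" "u < e" using e(1) by (auto simp: u_def)
  have pen: "(\<Sum>i<d. lw $. i * \<bar>(x + u *\<^sub>R h) $. i\<bar>) \<le> (\<Sum>i<d. lw $. i * \<bar>x $. i\<bar>) + u * P"
  proof -
    have split: "(\<Sum>i<d. f i) = f j + (\<Sum>i\<in>{..<d} - {j}. f i)" for f :: "nat \<Rightarrow> real"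
      using j by (intro sum.remove) auto
    have "(\<Sum>i\<in>{..<d} - {j}. lw $. i * \<bar>(x + u *\<^sub>R h) $. i\<bar>) = (\<Sum>i\<in>{..<d} - {j}. lw $. i * \<bar>x $. i\<bar>)"
      by (intro sum.cong) (auto simp: h_def)
    moreover have "lw $. j * \<bar>(x + u *\<^sub>R h) $. j\<bar> \<le> lw $. j * \<bar>x $. j\<bar> + u * P"
    proof -
      have "x $. j + u * t = (1 - u) * x $. j + u * (x $. j + t)" by (simp add: algebra_simps)
      then have "\<bar>x $. j + u * t\<bar> \<le> \<bar>(1 - u) * x $. j\<bar> + \<bar>u * (x $. j + t)\<bar>"
        by (simp only: abs_triangle_ineq)
      also have "\<dots> = \<bar>x $. j\<bar> + u * (\<bar>x $. j + t\<bar> - \<bar>x $. j\<bar>)"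
      proof -
        have "\<bar>(1 - u) * x $. j\<bar> = (1 - u) * \<bar>x $. j\<bar>" "\<bar>u * (x $. j + t)\<bar> = u * \<bar>x $. j + t\<bar>"
          using u by (simp_all add: abs_mult)
        then show ?thesis by (simp add: algebra_simps)
      qed
      finally have "lw $. j * \<bar>x $. j + u * t\<bar> \<le> lw $. j * (\<bar>x $. j\<bar> + u * (\<bar>x $. j + t\<bar> - \<bar>x $. j\<bar>))"
        using lw by (rule mult_left_mono)
      then show ?thesis using j by (simp add: h_def P_def algebra_simps)
    qed
    ultimately show ?thesis unfolding split[of "\<lambda>i. lw $. i * \<bar>(x + u *\<^sub>R h) $. i\<bar>"]
      split[of "\<lambda>i. lw $. i * \<bar>x $. i\<bar>"] by linarith
  qed
  have "q u < q 0" using e(2)[OF u(1,3)] by simp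
  then have "L (x + u *\<^sub>R h) + u * P < L x" by (simp add: q_def)
  then have "objF d L lw (x + u *\<^sub>R h) < objF d L lw x" using pen by (simp add: objF_def)
  moreover have "objF d L lw x \<le> objF d L lw (x + u *\<^sub>R h)" using x h by (intro min) auto
  ultimately show False by linarith
qed

end

context sparse_problem
begin

text \<open>
  Some weights may vanish, so the penalty alone does not make the objective coercive. Its
  sublevel set at the truth is bounded nevertheless, by the error bound.
\<close>

lemma minimizer_exists:
  assumes gw: "good_weights E lw"
  obtains xh where "xh \<in> Euc d" "\<And>u. u \<in> Euc d \<Longrightarrow> objF d L lw xh \<le> objF d L lw u"
    "norm (xh - bs) \<le> err" "basic E xh"
proof -
  define K where "K = norm bs + err"
  let ?B = "{v \<in> Euc d. \<forall>i. \<bar>v $. i\<bar> \<le> K}"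
  have in_B: "u \<in> ?B" if u: "u \<in> Euc d" and F: "objF d L lw u \<le> objF d L lw bs" for u
  proof -
    have "norm (u - bs) \<le> err"
      using basic_if_objF_le[OF gw u F] u gw by (intro basic_error) (auto simp: good_weights_def)
    then have "norm u \<le> K"
      using norm_triangle_ineq[of "u - bs" bs] by (simp add: K_def)
    then have "\<bar>u $. i\<bar> \<le> K" for i using abs_entry_le_norm[of u i] by linarith
    then show ?thesis using u by simp
  qed
  have bsB: "bs \<in> ?B" by (rule in_B[OF bs]) simp
  have "\<exists>x\<in>?B. \<forall>u\<in>?B. objF d L lw x \<le> objF d L lw u"
    using bsB by (intro continuous_attains_inf compact_box continuous_on_subset[OF continuous_objF]) auto
  then obtain xh where xh: "xh \<in> ?B" "\<And>u. u \<in> ?B \<Longrightarrow> objF d L lw xh \<le> objF d L lw u" by blast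
  have le_bs: "objF d L lw xh \<le> objF d L lw bs" by (rule xh(2)[OF bsB])
  have "objF d L lw xh \<le> objF d L lw u" if "u \<in> Euc d" for u
    using xh(2)[OF in_B[OF that]] le_bs by linarith
  moreover have "basic E xh" using xh(1) le_bs by (intro basic_if_objF_le[OF gw]) auto
  moreover from this have "norm (xh - bs) \<le> err"
    using xh(1) gw by (intro basic_error) (auto simp: good_weights_def)
  ultimately show ?thesis using xh(1) that by blast
qed

text \<open>The factor \<open>3 / 2\<close> is a rational bound for \<open>sqrt 2\<close>.\<close>

lemma active_l1_norm:
  assumes "active E"
  shows "(\<Sum>j\<in>E. \<bar>v $. j\<bar>) \<le> 3 / 2 * (sqrt s * norm v)"
proof -
  have "(\<Sum>j\<in>E. \<bar>v $. j\<bar>) \<le> sqrt 2 * (sqrt s * norm (restr v E))"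
    using active_l1[OF assms, of v] by (simp only: mult.assoc)
  also have "\<dots> \<le> 3 / 2 * (sqrt s * norm v)"
  proof (intro mult_mono mult_left_mono norm_restr_le)
    show "sqrt 2 \<le> 3 / 2" by (rule real_le_lsqrt) (simp_all add: power2_eq_square)
  qed auto
  finally show ?thesis .
qed

lemma basic_l1:
  assumes E: "active E" and x: "x \<in> Euc d" and b: "basic E x"
  shows "(\<Sum>j\<in>E. \<bar>x $. j - bs $. j\<bar>) \<le> 3 / 2 * (sqrt s * err)"
    "(\<Sum>j\<in>{..<d} - E. \<bar>x $. j - bs $. j\<bar>) \<le> 15 / 2 * (sqrt s * err)"
    "D bs x \<le> a / 5 * err\<^sup>2"
proof -
  let ?l = "\<Sum>j\<in>E. \<bar>x $. j - bs $. j\<bar>" and ?m = "\<Sum>j\<in>{..<d} - E. \<bar>x $. j - bs $. j\<bar>"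
  have "?l \<le> 3 / 2 * (sqrt s * norm (x - bs))" using active_l1_norm[OF E, of "x - bs"] by simp
  also have "\<dots> \<le> 3 / 2 * (sqrt s * err)" using basic_error[OF E x b] by (intro mult_left_mono) auto
  finally show l: "?l \<le> 3 / 2 * (sqrt s * err)" .
  have bb: "D bs x + lam / 4 * ?m \<le> 5 / 4 * lam * ?l" using b by (simp only: basic_def)
  have "0 \<le> D bs x" using bs x by (rule bregman_nonneg)
  then have "lam / 4 * ?m \<le> lam / 4 * (5 * ?l)" using bb by simp
  then have "?m \<le> 5 * ?l" by (rule mult_left_le_imp_le) (use lam_pos in simp)
  then show "?m \<le> 15 / 2 * (sqrt s * err)" using l by linarith
  have "0 \<le> lam / 4 * ?m" using lam_pos by (simp add: sum_nonneg)
  then have "D bs x \<le> 5 / 4 * lam * ?l" using bb by linarith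
  also have "\<dots> \<le> 5 / 4 * lam * (3 / 2 * (sqrt s * err))" using l lam_pos by (intro mult_left_mono) auto
  also have "\<dots> = 15 / 8 * (e * err)" by simp
  also have "e = a / 10 * err" using a_pos by (simp add: err_def)
  also have "15 / 8 * (a / 10 * err * err) = 3 / 16 * a * err\<^sup>2" by (simp add: power2_eq_square)
  also have "\<dots> \<le> a / 5 * err\<^sup>2" using a_pos by (intro mult_right_mono) auto
  finally show "D bs x \<le> a / 5 * err\<^sup>2" .
qed

text \<open>
  The divergence of \<open>x\<close> from the truth is small enough to bound the change of the gradient on any
  \<open>st\<close> coordinates. If more than \<open>st / 2\<close> coordinates changed by \<open>lam / 8\<close>, up to \<open>st\<close> of them
  would already violate this bound.
\<close>

lemma near_active_set:
  assumes E: "active E" and x: "x \<in> Euc d" and b: "basic E x"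
  shows "2 * card {j \<in> {..<d}. lam / 8 \<le> \<bar>(g x - g bs) $. j\<bar>} \<le> st"
proof (rule ccontr)
  define N where "N = {j \<in> {..<d}. lam / 8 \<le> \<bar>(g x - g bs) $. j\<bar>}"
  assume "\<not> ?thesis"
  then have big: "st < 2 * card N" by (simp add: N_def)
  \<comment> \<open>Gradient changes are controlled on at most \<open>st\<close> coordinates only.\<close>
  obtain B where B: "B \<subseteq> N" "card B = min (card N) st"
    by (rule obtain_subset_with_card_n[of "min (card N) st" N]) auto
  have Bd: "B \<subseteq> {..<d}" using B by (auto simp: N_def)
  have cB: "real st < 2 * real (card B)" using big B(2) st_pos by linarith
  have "norm (x - bs) + err \<le> r" using basic_error[OF E x b] err_le_radius err_pos by linarith
  moreover have "D bs x \<le> b / 2 * err\<^sup>2"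
  proof -
    have "a / 5 * err\<^sup>2 \<le> b / 2 * err\<^sup>2" using a_pos a_le_b by (intro mult_right_mono) auto
    then show ?thesis using basic_l1(3)[OF E x b] by linarith
  qed
  ultimately have G: "norm (restr (g x - g bs) B) \<le> b * err"
    using B(2) by (intro sparse_gradient_difference[OF bs x err_pos _ _ Bd]) auto
  have "real (card B) * (lam / 8)\<^sup>2 \<le> (norm (restr (g x - g bs) B))\<^sup>2"
    using B(1) lam_pos by (intro card_large_le[OF Bd]) (auto simp: N_def)
  also have "\<dots> \<le> (b * err)\<^sup>2" using G by (intro power_mono) auto
  also have "\<dots> = (6400 * ((b / a)\<^sup>2 * s)) * (lam / 8)\<^sup>2"
    by (simp add: err_def power_mult_distrib power_divide)
  finally have "real (card B) \<le> 6400 * ((b / a)\<^sup>2 * s)"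
    using lam_pos by (simp only: mult_le_cancel_right_pos zero_less_power divide_pos_pos zero_less_numeral)
  moreover have "10^6 * ((b / a)\<^sup>2 * s) \<le> real st" using st_large by (simp only: mult.assoc)
  ultimately show False using cB st_pos by simp
qed

text \<open>
  The difference of objectives is the Bregman divergence from the minimizer plus nonnegative terms
  \<open>f j\<close>, one for each coordinate. Off \<open>A\<close> the gradient at the minimizer is at most \<open>3 / 8 * lam\<close>,
  while the weight is at least \<open>lam / 2\<close>; so the minimizer vanishes there and
  \<open>f j \<ge> lam / 8 * \<bar>h $. j\<bar>\<close>. Half of this \<open>l1\<close> term pays for the defect of the restricted
  lower bound, the other half for the part of \<open>h\<close> off \<open>I\<close>, whose square is dominated by the
  \<open>l1\<close> norm because that norm is itself at most \<open>100 * sqrt s * err\<close>.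
\<close>

lemma quadratic_growth:
  assumes gw: "good_weights E lw" and xh: "xh \<in> Euc d" "basic E xh"
    and min: "\<And>u. u \<in> Euc d \<Longrightarrow> objF d L lw xh \<le> objF d L lw u"
    and y: "y \<in> Euc d" "norm (y - bs) \<le> err" and F: "objF d L lw y \<le> objF d L lw bs + 21 * (e * err)"
  shows "a / 2 * (norm (y - xh))\<^sup>2 \<le> objF d L lw y - objF d L lw xh"
proof -
  have E: "active E" "E \<subseteq> {..<d}" "card E \<le> 2 * s" using gw by (auto simp: good_weights_def active_def)
  define N where "N = {j \<in> {..<d}. lam / 8 \<le> \<bar>(g xh - g bs) $. j\<bar>}"
  define A where "A = E \<union> N"
  have A: "A \<subseteq> {..<d}" "2 * card A \<le> 4 * s + st"
    using near_active_set[OF E(1) xh] card_Un_le[of E N] E by (auto simp: A_def N_def)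
  define h where "h = y - xh"
  have h: "h \<in> Euc d" "xh + h = y" using y xh by (auto simp: h_def)
  have xhe: "norm (xh - bs) \<le> err" by (rule basic_error[OF E(1) xh])
  have nh: "norm h \<le> 2 * err"
    using norm_triangle_ineq4[of "y - bs" "xh - bs"] y(2) xhe by (simp add: h_def)
  define m where "m = (\<Sum>j\<in>{..<d} - A. \<bar>h $. j\<bar>)"
  have m0: "0 \<le> m" by (simp add: m_def sum_nonneg)
  have m_le: "m \<le> 100 * (sqrt s * err)"
  proof -
    let ?m = "\<lambda>x. \<Sum>j\<in>{..<d} - E. \<bar>x $. j - bs $. j\<bar>"
    have "m \<le> (\<Sum>j\<in>{..<d} - E. \<bar>h $. j\<bar>)"
      unfolding m_def by (intro sum_mono2) (auto simp: A_def)
    also have "\<dots> \<le> (\<Sum>j\<in>{..<d} - E. \<bar>y $. j - bs $. j\<bar> + \<bar>xh $. j - bs $. j\<bar>)"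
      by (intro sum_mono) (simp add: h_def)
    also have "\<dots> = ?m y + ?m xh" by (rule sum.distrib)
    finally have 1: "m \<le> ?m y + ?m xh" .
    have "(\<Sum>j\<in>E. \<bar>y $. j - bs $. j\<bar>) \<le> 3 / 2 * (sqrt s * norm (y - bs))"
      using active_l1_norm[OF E(1), of "y - bs"] by simp
    also have "\<dots> \<le> 3 / 2 * (sqrt s * err)" using y(2) by (intro mult_left_mono) auto
    finally have "5 / 4 * lam * (\<Sum>j\<in>E. \<bar>y $. j - bs $. j\<bar>) \<le> 5 / 4 * lam * (3 / 2 * (sqrt s * err))"
      using lam_pos by (intro mult_left_mono) auto
    moreover have "D bs y + lam / 4 * ?m y \<le> 5 / 4 * lam * (\<Sum>j\<in>E. \<bar>y $. j - bs $. j\<bar>) + 21 * (e * err)"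
      using basic_with_excess[OF gw y(1)] F by linarith
    moreover have "0 \<le> D bs y" using bs y(1) by (rule bregman_nonneg)
    ultimately have "lam / 4 * ?m y \<le> 5 / 4 * lam * (3 / 2 * (sqrt s * err)) + 21 * (e * err)" by linarith
    also have "\<dots> = lam / 4 * (183 / 2 * (sqrt s * err))" by (simp add: algebra_simps)
    finally have "?m y \<le> 183 / 2 * (sqrt s * err)"
      by (rule mult_left_le_imp_le) (use lam_pos in simp)
    moreover have "?m xh \<le> 15 / 2 * (sqrt s * err)" by (rule basic_l1(2)[OF E(1) xh])
    moreover have "0 \<le> sqrt s * err" using err_pos by simp
    ultimately show ?thesis using 1 by linarith
  qed
  define f where "f j = g xh $. j * h $. j + lw $. j * (\<bar>y $. j\<bar> - \<bar>xh $. j\<bar>)" for j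
  have f0: "0 \<le> f j" if j: "j < d" for j
    using minimizer_coordinate[OF xh(1) min, where j = j and t = "h $. j"] gw j
    by (auto simp: f_def h_def good_weights_def)
  have f_off: "lam / 8 * \<bar>h $. j\<bar> \<le> f j" if j: "j \<in> {..<d} - A" for j
  proof -
    have jd: "j < d" "j \<notin> E" and small: "\<bar>g xh $. j - g bs $. j\<bar> < lam / 8"
      using j by (auto simp: A_def N_def)
    have lwj: "lam / 2 \<le> lw $. j" using gw jd by (auto simp: good_weights_def)
    have gj: "\<bar>g xh $. j\<bar> \<le> 3 / 8 * lam" using small grad_bs_le[OF jd(1)] by linarith
    have x0: "xh $. j = 0"
    proof (rule ccontr)
      assume nz: "xh $. j \<noteq> 0"
      have "0 \<le> g xh $. j * (- xh $. j) + lw $. j * (\<bar>xh $. j + - xh $. j\<bar> - \<bar>xh $. j\<bar>)"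
        using gw jd(1) by (intro minimizer_coordinate[OF xh(1) min]) (auto simp: good_weights_def)
      then have "lw $. j * \<bar>xh $. j\<bar> \<le> - (g xh $. j * xh $. j)" by simp
      also have "\<dots> \<le> \<bar>g xh $. j\<bar> * \<bar>xh $. j\<bar>" by (metis abs_ge_minus_self abs_mult)
      finally have "lw $. j \<le> \<bar>g xh $. j\<bar>" using nz by simp
      then show False using gj lwj lam_pos by linarith
    qed
    have hy: "h $. j = y $. j" using x0 by (simp add: h_def)
    have "- (g xh $. j * y $. j) \<le> \<bar>g xh $. j\<bar> * \<bar>y $. j\<bar>" by (metis abs_ge_minus_self abs_mult)
    also have "\<dots> \<le> 3 / 8 * lam * \<bar>y $. j\<bar>" using gj by (intro mult_right_mono) auto
    finally have "- (g xh $. j * y $. j) \<le> 3 / 8 * lam * \<bar>y $. j\<bar>" .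
    moreover have "lam / 2 * \<bar>y $. j\<bar> \<le> lw $. j * \<bar>y $. j\<bar>" using lwj by (intro mult_right_mono) auto
    ultimately show ?thesis unfolding f_def hy x0 by simp
  qed
  have gE: "g xh \<in> Euc d" using xh by blast
  have "objF d L lw y - objF d L lw xh = D xh y + (\<Sum>j<d. f j)"
    unfolding f_def objF_def bregman_def h_def[symmetric] inner_Euc[OF gE] sum.distrib
    by (simp add: right_diff_distrib sum_subtractf)
  moreover have "(\<Sum>j\<in>{..<d} - A. f j) \<le> (\<Sum>j<d. f j)" using f0 by (intro sum_mono2) auto
  ultimately have "D xh y + (\<Sum>j\<in>{..<d} - A. f j) \<le> objF d L lw y - objF d L lw xh" by linarith
  moreover have "lam / 8 * m \<le> (\<Sum>j\<in>{..<d} - A. f j)"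
    unfolding m_def sum_distrib_left using f_off by (rule sum_mono)
  ultimately have lo1: "D xh y + lam / 8 * m \<le> objF d L lw y - objF d L lw xh" by linarith
  have "norm (xh - bs) + 2 * norm h \<le> r" using xhe nh err_le_radius err_pos by linarith
  then obtain I where I: "A \<subseteq> I" "I \<subseteq> {..<d}"
    and lo2: "a / 2 * (norm (restr h I))\<^sup>2 - 3 * b * norm (restr h I) * m / sqrt st \<le> D xh y"
    and rest: "(norm (restr h ({..<d} - I)))\<^sup>2 \<le> 2 * m\<^sup>2 / st"
    using restricted_lower_bound[OF xh(1) h(1) _ A] unfolding m_def[symmetric] h(2) by blast
  have "3 * b * norm (restr h I) * m / sqrt st \<le> lam / 16 * m"
  proof -
    have "norm (restr h I) \<le> 2 * err" using norm_restr_le[of h I] nh by linarith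
    then have "3 * b * norm (restr h I) \<le> 3 * b * (2 * err)" using b_pos by (intro mult_left_mono) auto
    also have "\<dots> = 60 * b * lam / a * sqrt s" by (simp add: err_def)
    also have "\<dots> \<le> 60 * b * lam / a * (a / (1000 * b) * sqrt st)"
      using sqrt_s_le a_pos b_pos lam_pos by (intro mult_left_mono) auto
    also have "\<dots> = 6 / 100 * lam * sqrt st" using a_pos b_pos by simp
    also have "\<dots> \<le> lam / 16 * sqrt st" using lam_pos by (intro mult_right_mono) auto
    finally have "3 * b * norm (restr h I) / sqrt st \<le> lam / 16"
      using st_pos by (simp only: pos_divide_le_eq real_sqrt_gt_0_iff)
    then have "3 * b * norm (restr h I) / sqrt st * m \<le> lam / 16 * m" using m0 by (rule mult_right_mono)
    then show ?thesis by simp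
  qed
  moreover have "a / 2 * (norm (restr h ({..<d} - I)))\<^sup>2 \<le> lam / 16 * m"
  proof -
    have "a / 2 * (norm (restr h ({..<d} - I)))\<^sup>2 \<le> a / 2 * (2 * m\<^sup>2 / st)"
      using rest a_pos by (intro mult_left_mono) auto
    also have "\<dots> = a * m / st * m" by (simp add: power2_eq_square)
    also have "\<dots> \<le> lam / 16 * m"
    proof (rule mult_right_mono)
      have "10^6 * (1 * real s) \<le> 10^6 * ((b / a)\<^sup>2 * s)"
        using a_pos a_le_b by (intro mult_left_mono mult_right_mono one_le_power) auto
      then have ss: "10^6 * real s \<le> st" using st_large by (simp add: mult.assoc)
      have "a * m \<le> a * (100 * (sqrt s * err))" using m_le a_pos by (intro mult_left_mono) auto
      also have "\<dots> = 1000 * lam * (sqrt s * sqrt s)" using a_pos by (simp add: err_def)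
      also have "\<dots> = 1000 * lam * real s" by simp
      also have "\<dots> \<le> lam / 16 * (10^6 * real s)" using lam_pos by simp
      also have "\<dots> \<le> lam / 16 * real st" using ss lam_pos by (intro mult_left_mono) auto
      finally show "a * m / real st \<le> lam / 16" using st_pos by (simp only: pos_divide_le_eq)
    qed (rule m0)
    finally show ?thesis .
  qed
  moreover have "(norm h)\<^sup>2 = (norm (restr h I))\<^sup>2 + (norm (restr h ({..<d} - I)))\<^sup>2"
    by (rule norm2_split_Euc[OF h(1) I(2)])
  then have "a / 2 * (norm h)\<^sup>2 = a / 2 * (norm (restr h I))\<^sup>2 + a / 2 * (norm (restr h ({..<d} - I)))\<^sup>2"
    by (simp add: distrib_left)
  ultimately show ?thesis using lo1 lo2 unfolding h_def[symmetric] by linarith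
qed

text \<open>
  The weights of the new problem differ from those for which \<open>x\<close> was computed, but both are at most
  \<open>lam\<close>. Hence the objective can be compared through the \<open>l1\<close> error, which the basic inequality controls.
\<close>

lemma warm_start_excess:
  assumes E0: "active E0" and x: "x \<in> Euc d" and b: "basic E0 x"
    and gx: "\<And>j. j < d \<Longrightarrow> \<bar>g x $. j\<bar> \<le> 5 / 4 * lam"
    and lw: "\<And>j. j < d \<Longrightarrow> 0 \<le> lw $. j \<and> lw $. j \<le> lam"
  shows "objF d L lw x \<le> objF d L lw bs + 21 * (e * err)"
proof -
  have E0d: "E0 \<subseteq> {..<d}" using E0 by (simp add: active_def)
  have gE: "g x \<in> Euc d" using x by blast
  have "L x + inner (g x) (bs - x) \<le> L bs" by (rule gradient_inequality[OF x bs])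
  then have "objF d L lw x - objF d L lw bs
      \<le> (\<Sum>j<d. g x $. j * (x $. j - bs $. j) + lw $. j * (\<bar>x $. j\<bar> - \<bar>bs $. j\<bar>))"
    unfolding objF_def inner_Euc[OF gE]
    by (simp add: sum.distrib sum_subtractf right_diff_distrib)
  also have "\<dots> \<le> (\<Sum>j<d. 9 / 4 * lam * \<bar>x $. j - bs $. j\<bar>)"
  proof (rule sum_mono)
    fix j assume "j \<in> {..<d}"
    then have j: "j < d" by simp
    have "g x $. j * (x $. j - bs $. j) \<le> \<bar>g x $. j\<bar> * \<bar>x $. j - bs $. j\<bar>" by (metis abs_ge_self abs_mult)
    also have "\<dots> \<le> 5 / 4 * lam * \<bar>x $. j - bs $. j\<bar>" using gx[OF j] by (intro mult_right_mono) auto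
    finally have 1: "g x $. j * (x $. j - bs $. j) \<le> 5 / 4 * lam * \<bar>x $. j - bs $. j\<bar>" .
    have "lw $. j * (\<bar>x $. j\<bar> - \<bar>bs $. j\<bar>) \<le> lw $. j * \<bar>x $. j - bs $. j\<bar>"
      using lw[OF j] by (intro mult_left_mono) auto
    also have "\<dots> \<le> lam * \<bar>x $. j - bs $. j\<bar>" using lw[OF j] by (intro mult_right_mono) auto
    finally show "g x $. j * (x $. j - bs $. j) + lw $. j * (\<bar>x $. j\<bar> - \<bar>bs $. j\<bar>)
        \<le> 9 / 4 * lam * \<bar>x $. j - bs $. j\<bar>" using 1 by simp
  qed
  also have "\<dots> = 9 / 4 * lam * ((\<Sum>j\<in>{..<d} - E0. \<bar>x $. j - bs $. j\<bar>) + (\<Sum>j\<in>E0. \<bar>x $. j - bs $. j\<bar>))"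
    unfolding sum_distrib_left[symmetric] using sum.subset_diff[OF E0d, of "\<lambda>j. \<bar>x $. j - bs $. j\<bar>"] by simp
  also have "\<dots> \<le> 9 / 4 * lam * (15 / 2 * (sqrt s * err) + 3 / 2 * (sqrt s * err))"
    using basic_l1[OF E0 x b] lam_pos by (intro mult_left_mono add_mono) auto
  also have "\<dots> = 81 / 4 * (e * err)" by (simp add: algebra_simps)
  also have "\<dots> \<le> 21 * (e * err)" using e_pos err_pos by (intro mult_right_mono) auto
  finally show ?thesis by linarith
qed

end

section \<open>The tightening stage\<close>

context lamm_problem
begin

definition rate :: real where "rate = ln (1 + a / (gu * c))"

lemma rate_pos: "0 < rate"
  using a_pos gu c_pos unfolding rate_def by (intro ln_gt_zero) auto

text \<open>The prox inequality with the minimizer as comparison point, combined with quadratic growth.\<close>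

lemma contraction:
  assumes gw: "good_weights E lw" and xh: "xh \<in> Euc d" "basic E xh"
    and min: "\<And>u. u \<in> Euc d \<Longrightarrow> objF d L lw xh \<le> objF d L lw u"
    and x: "x \<in> Euc d" "norm (x - bs) \<le> err" "objF d L lw x \<le> objF d L lw bs + 21 * (e * err)"
    and phi: "0 < phi" "phi \<le> gu * c" and acc: "accepts d L lw x phi"
  defines "p \<equiv> T_op d L lw phi x"
  shows "exp rate * (norm (p - xh))\<^sup>2 \<le> (norm (x - xh))\<^sup>2"
    and "norm (p - bs) \<le> err" and "objF d L lw p \<le> objF d L lw bs + 21 * (e * err)"
proof -
  show pe: "norm (p - bs) \<le> err"
    unfolding p_def by (rule distance_step[OF gw phi(1) x(1) acc x(2) order_refl])
  have pE: "p \<in> Euc d" by (simp add: p_def)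
  have "0 \<le> phi / 2 * (norm (p - x))\<^sup>2" using phi by simp
  then show Fp: "objF d L lw p \<le> objF d L lw bs + 21 * (e * err)"
    using objF_decreases[OF gw phi(1) x(1) acc] x(3) unfolding p_def by linarith
  have "a / 2 * (norm (p - xh))\<^sup>2 \<le> objF d L lw p - objF d L lw xh"
    by (rule quadratic_growth[OF gw xh min pE pe Fp])
  moreover have "objF d L lw p + phi / 2 * ((norm (xh - p))\<^sup>2 - (norm (xh - x))\<^sup>2) \<le> objF d L lw xh"
    unfolding p_def by (rule prox_inequality[OF good_nonneg[OF gw] phi(1) x(1) xh(1) acc])
  ultimately have "a / 2 * (norm (p - xh))\<^sup>2 + phi / 2 * ((norm (p - xh))\<^sup>2 - (norm (x - xh))\<^sup>2) \<le> 0"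
    unfolding norm_minus_commute[of xh] by linarith
  then have main: "(phi + a) * (norm (p - xh))\<^sup>2 \<le> phi * (norm (x - xh))\<^sup>2"
    by (simp add: algebra_simps)
  have "exp rate = 1 + a / (gu * c)"
    using a_pos gu c_pos by (simp add: rate_def add_pos_pos)
  also have "\<dots> \<le> 1 + a / phi"
    using phi a_pos by (intro add_left_mono divide_left_mono) auto
  also have "\<dots> = (phi + a) / phi" using phi by (simp add: add_divide_distrib)
  finally have "exp rate * (norm (p - xh))\<^sup>2 \<le> (phi + a) / phi * (norm (p - xh))\<^sup>2"
    by (rule mult_right_mono) simp
  also have "\<dots> = ((phi + a) * (norm (p - xh))\<^sup>2) / phi" by simp
  also have "\<dots> \<le> (phi * (norm (x - xh))\<^sup>2) / phi" using main phi by (intro divide_right_mono) auto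
  also have "\<dots> = (norm (x - xh))\<^sup>2" using phi by simp
  finally show "exp rate * (norm (p - xh))\<^sup>2 \<le> (norm (x - xh))\<^sup>2" .
qed

lemma omega_le_distance:
  assumes gw: "good_weights E lw" and xh: "norm (p - xh) \<le> norm (x - xh)"
    and x: "x \<in> Euc d" "norm (x - bs) \<le> err"
    and phi: "0 < phi" "phi \<le> gu * c" and p: "p = T_op d L lw phi x" "norm (p - bs) \<le> err"
  shows "omega d L lw p \<le> 2 * c * (1 + gu) * norm (x - xh)"
proof -
  have pE: "p \<in> Euc d" by (simp add: p)
  have "norm (x - bs) \<le> 3 * M" "norm (p - bs) \<le> 3 * M"
    using x p err_le_M M_pos by linarith+
  then have "norm (g p - g x) \<le> c * norm (p - x)"
    using lipschitz_onD[OF lipM, of p x] x(1) pE by (simp add: dist_norm norm_minus_commute)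
  moreover have "phi * norm (p - x) \<le> gu * c * norm (p - x)" using phi by (intro mult_right_mono) auto
  moreover have "omega d L lw p \<le> norm (g p - g x) + phi * norm (p - x)"
    unfolding p by (rule omega_T_op_le[OF d_pos good_nonneg[OF gw] phi(1) x(1)])
  ultimately have "omega d L lw p \<le> c * norm (p - x) + gu * c * norm (p - x)" by linarith
  also have "\<dots> = c * (1 + gu) * norm (p - x)" by (simp add: algebra_simps)
  also have "\<dots> \<le> c * (1 + gu) * (2 * norm (x - xh))"
    using norm_triangle_ineq4[of "p - xh" "x - xh"] xh c_pos gu by (intro mult_left_mono) auto
  finally show ?thesis by simp
qed

text \<open>
  The squared relative distance \<open>q\<close> to the minimizer shrinks by the factor \<open>exp (- rate)\<close> in every
  step, and the step after a point with \<open>q \<le> 1\<close> meets the tolerance. So the potential is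
  \<open>1 + ln q / rate\<close>, truncated at zero.
\<close>

lemma tightening_stage:
  assumes gw: "good_weights E lw" and E0: "active E0" "basic E0 x0" and x0: "x0 \<in> Euc d"
    and gx0: "\<And>j. j < d \<Longrightarrow> \<bar>g x0 $. j\<bar> \<le> 5 / 4 * lam"
    and phi: "ph \<le> gu * c" and eps: "0 < eps" "eps \<le> 1" and H: "1 \<le> H" "4 * c * (1 + gu) * err \<le> H"
  shows "\<exists>k x phi. solves d L lw gu phi0 eps (x0, ph) k (x, phi) \<and> x \<in> Euc d \<and> phi \<le> gu * c \<and>
    omega d L lw x \<le> eps \<and> real k \<le> 2 + 2 * (ln H + ln (1 / eps)) / rate"
proof -
  obtain xh where xh: "xh \<in> Euc d" "\<And>u. u \<in> Euc d \<Longrightarrow> objF d L lw xh \<le> objF d L lw u"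
    "norm (xh - bs) \<le> err" "basic E xh"
    using minimizer_exists[OF gw] by blast
  define C where "C = 2 * c * (1 + gu)"
  have C: "0 < C" using c_pos gu by (simp add: C_def)
  define q where "q x = (C * norm (x - xh) / eps)\<^sup>2" for x
  define V where "V st = 1 + ln (max (exp (- rate)) (q (fst st))) / rate" for st :: "fvec \<times> real"
  define I where "I st \<longleftrightarrow> fst st \<in> Euc d \<and> norm (fst st - bs) \<le> err \<and> snd st \<le> gu * c \<and>
    objF d L lw (fst st) \<le> objF d L lw bs + 21 * (e * err)" for st :: "fvec \<times> real"
  have "\<exists>k st'. solves d L lw gu phi0 eps (x0, ph) k st' \<and> I st' \<and> omega d L lw (fst st') \<le> eps \<and> real k \<le> V (x0, ph) + 1"
  proof (rule solves_by_potential)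
    show "I (x0, ph)"
      using basic_error[OF E0(1) x0 E0(2)] x0 phi warm_start_excess[OF E0(1) x0 E0(2) gx0] gw
      by (simp add: I_def good_weights_def)
  next
    fix st assume I: "I st"
    have "- rate = ln (exp (- rate))" by simp
    also have "\<dots> \<le> ln (max (exp (- rate)) (q (fst st)))"
      by (subst ln_le_cancel_iff) (auto simp: less_max_iff_disj)
    finally have "- rate / rate \<le> ln (max (exp (- rate)) (q (fst st))) / rate"
      using rate_pos by (intro divide_right_mono) auto
    then show "0 \<le> V st" using rate_pos by (simp add: V_def)
    obtain x phi where st: "st = (x, phi)" by (metis surj_pair)
    have x: "x \<in> Euc d" "norm (x - bs) \<le> err" "phi \<le> gu * c"
      "objF d L lw x \<le> objF d L lw bs + 21 * (e * err)" using I by (auto simp: I_def st)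
    have xM: "norm (x - bs) \<le> M" using x(2) err_le_M by linarith
    obtain phi' where ls: "lamm_step d L lw gu phi0 (x, phi) (T_op d L lw phi' x, phi')"
      "accepts d L lw x phi'" "0 < phi'" "phi' \<le> gu * c"
      using line_search[OF gw x(1) xM x(3)] by blast
    define p where "p = T_op d L lw phi' x"
    have con: "exp rate * (norm (p - xh))\<^sup>2 \<le> (norm (x - xh))\<^sup>2" "norm (p - bs) \<le> err"
      "objF d L lw p \<le> objF d L lw bs + 21 * (e * err)"
      unfolding p_def by (rule contraction[OF gw xh(1,4,2) x(1,2,4) ls(3,4,2)]; assumption)+
    have "I (p, phi')" using con ls by (simp add: I_def) (simp add: p_def)
    moreover have "V (p, phi') + 1 \<le> V st" if om: "\<not> omega d L lw p \<le> eps"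
    proof -
      have "1 * (norm (p - xh))\<^sup>2 \<le> exp rate * (norm (p - xh))\<^sup>2"
        using rate_pos by (intro mult_right_mono) auto
      then have "(norm (p - xh))\<^sup>2 \<le> (norm (x - xh))\<^sup>2" using con(1) by linarith
      then have "norm (p - xh) \<le> norm (x - xh)" by (rule power2_le_imp_le) simp
      then have "omega d L lw p \<le> C * norm (x - xh)"
        unfolding C_def using x(1,2) ls(3,4) con(2) by (intro omega_le_distance[OF gw]) (auto simp: p_def)
      then have "eps \<le> C * norm (x - xh)" using om by linarith
      then have "1 \<le> C * norm (x - xh) / eps" using eps by (simp add: pos_le_divide_eq)
      then have q1: "1 \<le> q x" unfolding q_def by (rule one_le_power)
      have "q p = (C / eps)\<^sup>2 * (norm (p - xh))\<^sup>2" by (simp add: q_def power_mult_distrib power_divide)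
      also have "\<dots> \<le> (C / eps)\<^sup>2 * (exp (- rate) * (norm (x - xh))\<^sup>2)"
      proof (rule mult_left_mono)
        have "exp (- rate) * (exp rate * (norm (p - xh))\<^sup>2) \<le> exp (- rate) * (norm (x - xh))\<^sup>2"
          using con(1) by (rule mult_left_mono) simp
        then show "(norm (p - xh))\<^sup>2 \<le> exp (- rate) * (norm (x - xh))\<^sup>2"
          by (simp add: mult.assoc[symmetric] exp_add[symmetric])
      qed simp
      also have "\<dots> = exp (- rate) * q x" by (simp add: q_def power_mult_distrib power_divide)
      finally have qp: "q p \<le> exp (- rate) * q x" .
      have "exp (- rate) * 1 \<le> exp (- rate) * q x" using q1 by (rule mult_left_mono) simp
      then have "max (exp (- rate)) (q p) \<le> exp (- rate) * q x" using qp by simp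
      then have "ln (max (exp (- rate)) (q p)) \<le> ln (exp (- rate) * q x)"
        using q1 by (subst ln_le_cancel_iff) (auto simp: less_max_iff_disj)
      also have "\<dots> = ln (q x) - rate" using q1 by (simp add: ln_mult)
      finally have l: "ln (max (exp (- rate)) (q p)) / rate \<le> (ln (q x) - rate) / rate"
        using rate_pos by (intro divide_right_mono) auto
      have "exp (- rate) \<le> q x" using q1 rate_pos exp_le_one_iff[of "- rate"] by linarith
      then have "V st = 1 + ln (q x) / rate" by (simp add: V_def st max_def)
      then show ?thesis using l rate_pos by (simp add: V_def diff_divide_distrib)
    qed
    ultimately show "\<exists>st'. lamm_step d L lw gu phi0 st st' \<and> I st' \<and> (omega d L lw (fst st') \<le> eps \<or> V st' + 1 \<le> V st)"
      using ls(1) unfolding st p_def[symmetric] by (intro exI[of _ "(p, phi')"]) auto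
  qed
  then obtain k st' where sol: "solves d L lw gu phi0 eps (x0, ph) k st'" "I st'"
    "omega d L lw (fst st') \<le> eps" and k: "real k \<le> V (x0, ph) + 1"
    by blast
  have "norm (x0 - xh) \<le> 2 * err"
    using norm_triangle_ineq4[of "x0 - bs" "xh - bs"] basic_error[OF E0(1) x0 E0(2)] xh(3) by simp
  then have "C * norm (x0 - xh) \<le> C * (2 * err)" using C by (intro mult_left_mono) auto
  also have "\<dots> \<le> H" using H by (simp add: C_def)
  finally have "C * norm (x0 - xh) / eps \<le> H / eps" using eps by (intro divide_right_mono) auto
  then have q0: "q x0 \<le> (H / eps)\<^sup>2" unfolding q_def using C eps by (intro power_mono) auto
  have He: "1 \<le> H / eps" using H eps by simp
  have "exp (- rate) \<le> 1" using rate_pos by simp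
  also have "\<dots> \<le> (H / eps)\<^sup>2" using He by (rule one_le_power)
  finally have "max (exp (- rate)) (q x0) \<le> (H / eps)\<^sup>2" using q0 by simp
  then have "ln (max (exp (- rate)) (q x0)) \<le> ln ((H / eps)\<^sup>2)"
    using He by (subst ln_le_cancel_iff) (auto simp: less_max_iff_disj)
  also have "\<dots> = 2 * ln (H / eps)" using He by (subst ln_realpow) auto
  also have "ln (H / eps) = ln H + ln (1 / eps)" using H eps by (simp add: ln_div)
  finally have "ln (max (exp (- rate)) (q x0)) / rate \<le> 2 * (ln H + ln (1 / eps)) / rate"
    using rate_pos by (intro divide_right_mono) auto
  then have "real k \<le> 2 + 2 * (ln H + ln (1 / eps)) / rate" using k by (simp add: V_def)
  then show ?thesis
    using sol unfolding I_def by (intro exI[of _ k] exI[of _ "fst st'"] exI[of _ "snd st'"]) auto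
qed

lemma ep_le: "ep \<le> lam / 4"
  using noise[OF d_pos] abs_ge_zero[of "g bs $. 0"] by linarith

text \<open>What the next problem needs to know about the state in which the previous one stopped.\<close>

definition solved :: "fvec \<times> real \<Rightarrow> bool" where
  "solved z \<longleftrightarrow> fst z \<in> Euc d \<and> snd z \<le> gu * c \<and> (\<forall>j<d. \<bar>g (fst z) $. j\<bar> \<le> 5 / 4 * lam) \<and>
     (\<exists>E. active E \<and> basic E (fst z))"

lemma solvedI:
  assumes gw: "good_weights E lw" and x: "x \<in> Euc d" and om: "omega d L lw x \<le> ep" and phi: "phi \<le> gu * c"
  shows "solved (x, phi)"
proof -
  have "\<bar>g x $. j\<bar> \<le> 5 / 4 * lam" if "j < d" for j
    using grad_le_if_omega_le[OF gw x om that] gw that ep_le by (fastforce simp: good_weights_def)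
  moreover have "active E" using gw by (simp add: good_weights_def)
  ultimately show ?thesis
    using x phi basic_if_omega_le[OF gw x om] by (auto simp: solved_def)
qed

section \<open>Complexity of the whole algorithm\<close>

text \<open>
  The run is built by dependent choice; the elements of the sequence consist of the final state of
  a problem and its number of iterations. One sequence serves all numbers of problems.
\<close>

lemma ilamm_run_bound:
  assumes w: "w \<in> tightening" and half: "1 / 2 \<le> w (18 / a / delta * lam)"
    and delta: "0 < delta" "delta < 1"
    and eps_c: "0 < eps_c" "eps_c \<le> ep" and eps_t: "0 < eps_t" "eps_t \<le> ep" "eps_t \<le> 1"
    and H: "1 \<le> H" "4 * c * (1 + gu) * err \<le> H"
  obtains bt ph N where
    "\<And>T. ilamm_run d L w lam gu phi0 eps_c eps_t T bt ph N"
    "\<And>l. omega d L (weights d w lam (bt l)) (bt (Suc l)) \<le> (if l = 0 then eps_c else eps_t)"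
    "real (N 1) \<le> 4 * c * (1 + gu) * (e * norm bs + c * (norm bs)\<^sup>2) / eps_c\<^sup>2 + 1"
    "\<And>l. 2 \<le> l \<Longrightarrow> real (N l) \<le> 2 + 2 * (ln H + ln (1 / eps_t)) / rate"
proof -
  define K where "K l = (if l = 0 then 4 * c * (1 + gu) * (e * norm bs + c * (norm bs)\<^sup>2) / eps_c\<^sup>2 + 1
    else 2 + 2 * (ln H + ln (1 / eps_t)) / rate)" for l :: nat
  define eps where "eps l = (if l = 0 then eps_c else eps_t)" for l :: nat
  define P where "P l z \<longleftrightarrow> (if l = 0 then fst z = (0, phi0) else solved (fst z))"
    for l :: nat and z :: "(fvec \<times> real) \<times> nat"
  define Q where "Q l z z' \<longleftrightarrow>
      solves d L (weights d w lam (fst (fst z))) gu phi0 (eps l) (fst z) (snd z') (fst z') \<and>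
      omega d L (weights d w lam (fst (fst z))) (fst (fst z')) \<le> eps l \<and> real (snd z') \<le> K l"
    for l :: nat and z z' :: "(fvec \<times> real) \<times> nat"
  have "\<exists>f. \<forall>l. P l (f l) \<and> Q l (f l) (f (Suc l))"
  proof (rule dependent_nat_choice)
    show "\<exists>z. P 0 z" by (intro exI[of _ "((0, phi0), 0)"]) (simp add: P_def)
  next
    fix z l assume P: "P l z"
    show "\<exists>z'. P (Suc l) z' \<and> Q l z z'"
    proof (cases "l = 0")
      case True
      then have z: "fst z = (0, phi0)" using P by (simp add: P_def)
      have gw: "good_weights (supp bs) (weights d w lam 0)" by (rule good_weights_initial[OF w])
      have "weights d w lam 0 $. j = lam" if "j < d" for j
        using that w by (simp add: weights_def tightening_def)
      then obtain k x phi where r: "solves d L (weights d w lam 0) gu phi0 eps_c (0, phi0) k (x, phi)"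
        "x \<in> Euc d" "phi \<le> gu * c" "omega d L (weights d w lam 0) x \<le> eps_c"
        "real k \<le> 4 * c * (1 + gu) * (e * norm bs + c * (norm bs)\<^sup>2) / eps_c\<^sup>2 + 1"
        using contraction_stage[OF gw _ eps_c(1)] by blast
      have "solved (x, phi)" using r eps_c by (intro solvedI[OF gw]) auto
      then show ?thesis
        using r z True by (intro exI[of _ "((x, phi), k)"]) (simp add: P_def Q_def eps_def K_def)
    next
      case False
      then have s: "solved (fst z)" using P by (simp add: P_def)
      obtain x0 ph where z: "fst z = (x0, ph)" by (metis surj_pair)
      obtain E0 where E0: "active E0" "basic E0 x0" and x0: "x0 \<in> Euc d" "ph \<le> gu * c"
        "\<And>j. j < d \<Longrightarrow> \<bar>g x0 $. j\<bar> \<le> 5 / 4 * lam"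
        using s by (auto simp: solved_def z)
      obtain E where gw: "good_weights E (weights d w lam x0)"
        using good_weights_next[OF w half delta basic_error[OF E0(1) x0(1) E0(2)]] by blast
      obtain k x phi where r: "solves d L (weights d w lam x0) gu phi0 eps_t (x0, ph) k (x, phi)"
        "x \<in> Euc d" "phi \<le> gu * c" "omega d L (weights d w lam x0) x \<le> eps_t"
        "real k \<le> 2 + 2 * (ln H + ln (1 / eps_t)) / rate"
        using tightening_stage[OF gw E0 x0(1) x0(3) x0(2) eps_t(1,3) H] by blast
      have "solved (x, phi)" using r eps_t by (intro solvedI[OF gw]) auto
      then show ?thesis
        using r z False by (intro exI[of _ "((x, phi), k)"]) (simp add: P_def Q_def eps_def K_def)
    qed
  qed
  then obtain f where f: "\<And>l. P l (f l)" "\<And>l. Q l (f l) (f (Suc l))" by blast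
  define bt ph N where "bt l = fst (fst (f l))" and "ph l = snd (fst (f l))" and "N l = snd (f l)" for l
  have run: "ilamm_run d L w lam gu phi0 eps_c eps_t T bt ph N" for T
    unfolding ilamm_run_def
  proof (intro conjI ballI)
    show "bt 0 = 0" "ph 0 = phi0" using f(1)[of 0] by (simp_all add: P_def bt_def ph_def)
    fix l assume "l \<in> {1..T}"
    then obtain k where l: "l = Suc k" by (cases l) auto
    show "solves d L (weights d w lam (bt (l - 1))) gu phi0 (if l = 1 then eps_c else eps_t)
        (bt (l - 1), ph (l - 1)) (N l) (bt l, ph l)"
      using f(2)[of k] by (simp add: Q_def l bt_def ph_def N_def eps_def)
  qed
  show ?thesis
  proof (rule that[OF run])
    show "omega d L (weights d w lam (bt l)) (bt (Suc l)) \<le> (if l = 0 then eps_c else eps_t)" for l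
      using f(2)[of l] by (simp add: Q_def bt_def eps_def)
    show "real (N 1) \<le> 4 * c * (1 + gu) * (e * norm bs + c * (norm bs)\<^sup>2) / eps_c\<^sup>2 + 1"
      using f(2)[of 0] by (simp add: Q_def N_def K_def)
    fix l :: nat assume "2 \<le> l"
    then obtain k where "l = Suc k" "k \<noteq> 0" by (cases l) auto
    then show "real (N l) \<le> 2 + 2 * (ln H + ln (1 / eps_t)) / rate"
      using f(2)[of k] by (simp add: Q_def N_def K_def)
  qed
qed

end

text \<open>
  The constants of the theorem enter here. The factor \<open>10^6 * (b / a)\<^sup>2\<close> makes \<open>sqrt (s / st)\<close> at
  most \<open>a / (1000 * b)\<close>; the bound on \<open>lam\<close> places ten times the error bound inside the radius \<open>r\<close>;
  and half of \<open>R\<close> is at least \<open>3 * (norm bs + err)\<close>.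
\<close>

lemma lamm_problemI:
  assumes bs: "bs \<in> Euc d" "1 \<le> card (supp bs)"
    and reg: "regular_loss d L bs r"
    and lse: "LSE d L bs r a b (10^6 * (b / a)\<^sup>2) C"
    and a: "0 < a" "a \<le> b" and c: "0 < c0" and gu: "1 < gu" and phi0: "0 < phi0" "phi0 \<le> a"
    and lip: "c0-lipschitz_on (cball bs (6 * (1 + 10 / a) * (norm bs + lam * sqrt (card (supp bs))) / 2) \<inter> Euc d) (grad d L)"
    and lam: "0 < lam" "0 \<le> ep" "4 * (linf_norm d (grad d L bs) + ep) \<le> lam"
    and r: "lam \<le> a / 100 * (r / sqrt (card (supp bs)))"
  obtains st where "lamm_problem d L bs r a b lam ep st (max c0 a) gu phi0"
proof -
  interpret convex_loss d L
    using reg by unfold_locales (auto simp: regular_loss_def)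
  obtain st :: nat where st: "10^6 * (b / a)\<^sup>2 * card (supp bs) \<le> st"
    "ereal a \<le> rho_minus d L bs (2 * card (supp bs) + 2 * st) r"
    "rho_plus d L bs (2 * card (supp bs) + 2 * st) r \<le> ereal b"
    using lse by (auto simp: LSE_def Let_def)
  have "lamm_problem d L bs r a b lam ep st (max c0 a) gu phi0"
  proof unfold_locales
    show "bs \<in> Euc d" "0 < card (supp bs)" "0 < a" "a \<le> b" "0 < lam" "0 \<le> ep" "a \<le> max c0 a"
      "1 < gu" "0 < phi0" "phi0 \<le> max c0 a"
      using bs a lam gu phi0 by auto
    show "\<bar>g bs $. j\<bar> + ep \<le> lam / 4" if "j < d" for j
    proof -
      have "\<bar>g bs $. j\<bar> \<le> linf_norm d (g bs)" by (rule linf_norm_ge[OF that])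
      moreover have "linf_norm d (g bs) + ep \<le> lam / 4" using lam(3) by simp
      ultimately show ?thesis by linarith
    qed
    show "100 * (lam * sqrt (card (supp bs))) / a \<le> r"
    proof -
      have "0 < sqrt (card (supp bs))" using bs by simp
      then have "lam * sqrt (card (supp bs)) \<le> a / 100 * r"
        using mult_right_mono[OF r, of "sqrt (card (supp bs))"] by simp
      then have "100 * (lam * sqrt (card (supp bs))) \<le> 100 * (a / 100 * r)" by linarith
      also have "\<dots> = r * a" by simp
      finally show ?thesis using a(1) by (simp only: pos_divide_le_eq)
    qed
    show "10^6 * (b / a)\<^sup>2 * card (supp bs) \<le> st" by (rule st(1))
    have diff: "\<forall>b \<in> cball bs r \<inter> Euc d. g differentiable (at b within Euc d)"
      using reg by (simp add: regular_loss_def)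
    show "a / 2 * (norm (y - x))\<^sup>2 \<le> D x y \<and> D x y \<le> b / 2 * (norm (y - x))\<^sup>2"
      if "x \<in> cball bs r \<inter> Euc d" "y \<in> cball bs r \<inter> Euc d" "J \<subseteq> {..<d}"
        "card J \<le> 2 * card (supp bs) + 2 * st" "\<And>i. i \<notin> J \<Longrightarrow> y $. i = x $. i" for x y J
      by (rule bregman_sparse_bounds[OF diff st(2,3) that])
    show "(max c0 a)-lipschitz_on (cball bs (3 * (norm bs + 10 * (lam * sqrt (card (supp bs))) / a)) \<inter> Euc d) g"
    proof (rule lipschitz_on_mono[OF lip])
      define e where "e = lam * sqrt (card (supp bs))"
      have e: "0 \<le> e" using lam by (simp add: e_def)
      have "norm bs + 10 * e / a \<le> (norm bs + 10 * e / a) + (e + 10 / a * norm bs)"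
        using e a by simp
      also have "\<dots> = (1 + 10 / a) * (norm bs + e)" using a by (simp add: field_simps)
      finally have "3 * (norm bs + 10 * e / a) \<le> 3 * ((1 + 10 / a) * (norm bs + e))"
        by (rule mult_left_mono) simp
      also have "\<dots> = 6 * (1 + 10 / a) * (norm bs + e) / 2" by simp
      finally have "3 * (norm bs + 10 * e / a) \<le> 6 * (1 + 10 / a) * (norm bs + e) / 2" .
      then show "cball bs (3 * (norm bs + 10 * (lam * sqrt (card (supp bs))) / a)) \<inter> Euc d
          \<subseteq> cball bs (6 * (1 + 10 / a) * (norm bs + lam * sqrt (card (supp bs))) / 2) \<inter> Euc d"
        unfolding e_def by (intro Int_mono subset_cball order_refl)
    qed simp
  qed
  then show ?thesis by (rule that)
qed

text \<open>
  The claim of the theorem for a single problem, with \<open>lam * sqrt s\<close> at most \<open>exp (- 1)\<close> in place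
  of the asymptotic assumption. Then both tolerances are at most \<open>exp (- 1)\<close> as well, which makes
  \<open>ln (1 / eps_t)\<close> at least one.
\<close>

definition iteration_bound :: "real \<Rightarrow> real \<Rightarrow> real \<Rightarrow> real \<Rightarrow> real \<Rightarrow> real \<Rightarrow> real \<Rightarrow> real \<Rightarrow> bool" where
  "iteration_bound delta gu a b c0 B C' C'' \<longleftrightarrow> (\<forall>phi0 d L bs w r lam eps_c eps_t T C.
      0 < phi0 \<longrightarrow> phi0 \<le> a \<longrightarrow> lam * sqrt (card (supp bs)) \<le> exp (- 1) \<longrightarrow>
      bs \<in> Euc d \<and> 1 \<le> card (supp bs) \<and> norm bs \<le> B \<and>
      regular_loss d L bs r \<and> LSE d L bs r a b (10^6 * (b / a)\<^sup>2) C \<and>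
      w \<in> tightening \<and> 1 / 2 \<le> w (18 / a / delta * lam) \<and>
      c0-lipschitz_on (cball bs (6 * (1 + 10 / a) * (norm bs + lam * sqrt (card (supp bs))) / 2) \<inter> Euc d) (grad d L) \<and>
      0 < lam \<and> 0 < eps_c \<and> 0 < eps_t \<and> 1 \<le> T \<and>
      4 * (linf_norm d (grad d L bs) + max eps_t eps_c) \<le> lam \<and>
      lam \<le> a / 100 * (r / sqrt (card (supp bs))) \<longrightarrow>
      (\<exists>bt ph N. ilamm_run d L w lam gu phi0 eps_c eps_t T bt ph N \<and>
        omega d L (weights d w lam (bt 0)) (bt 1) \<le> eps_c \<and>
        (\<forall>k\<in>{2..T}. omega d L (weights d w lam (bt (k - 1))) (bt k) \<le> eps_t) \<and>
        real (\<Sum>l=1..T. N l) \<le> C' * (1 / eps_c\<^sup>2) + C'' * (real T - 1) * ln (1 / eps_t)))"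

lemma iteration_bound_exists:
  assumes par: "0 < delta" "delta < 1" "1 < gu" "0 < a" "a \<le> b" "0 < c0"
  shows "\<exists>C'>0. \<exists>C''>0. iteration_bound delta gu a b c0 B C' C''"
proof -
  define c where "c = max c0 a"
  have c: "0 < c" using par by (simp add: c_def)
  define H where "H = max 1 (40 * c * (1 + gu) / a)"
  have H: "1 \<le> H" by (simp add: H_def)
  define kappa where "kappa = ln (1 + a / (gu * c))"
  have kappa: "0 < kappa" unfolding kappa_def using par c by (intro ln_gt_zero) auto
  define C' where "C' = 4 * c * (1 + gu) * (\<bar>B\<bar> + c * B\<^sup>2) + 1"
  define C'' where "C'' = 2 + 2 * (ln H + 1) / kappa"
  have C': "0 < C'" using c par(3) by (simp add: C'_def add_nonneg_pos)
  have C'': "0 < C''" using kappa H by (simp add: C''_def add_pos_nonneg)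
  have "iteration_bound delta gu a b c0 B C' C''"
    unfolding iteration_bound_def
  proof (intro allI impI, elim conjE)
    fix phi0 d L bs w r lam eps_c eps_t C and T :: nat
    assume small: "lam * sqrt (card (supp bs)) \<le> exp (- 1)"
      and A: "0 < phi0" "phi0 \<le> a" "bs \<in> Euc d" "1 \<le> card (supp bs)" "norm bs \<le> B"
      "regular_loss d L bs r" "LSE d L bs r a b (10^6 * (b / a)\<^sup>2) C"
      "w \<in> tightening" "1 / 2 \<le> w (18 / a / delta * lam)"
      "c0-lipschitz_on (cball bs (6 * (1 + 10 / a) * (norm bs + lam * sqrt (card (supp bs))) / 2) \<inter> Euc d) (grad d L)"
      "0 < lam" "0 < eps_c" "0 < eps_t" "1 \<le> T"
      "4 * (linf_norm d (grad d L bs) + max eps_t eps_c) \<le> lam"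
      "lam \<le> a / 100 * (r / sqrt (card (supp bs)))"
    have ep0: "0 \<le> max eps_t eps_c" using A by simp
    obtain st where st: "lamm_problem d L bs r a b lam (max eps_t eps_c) st (max c0 a) gu phi0"
      using lamm_problemI[OF A(3,4,6,7) par(4,5,6,3) A(1,2,10,11) ep0 A(15,16)] by blast
    interpret lamm_problem d L bs r a b lam "max eps_t eps_c" st c gu phi0
      unfolding c_def by (rule st)
    have e1: "e \<le> exp (- 1)" by (rule small)
    have exp1: "exp (- 1) \<le> (1 :: real)" by simp
    have e_le_1: "e \<le> 1" using e1 exp1 by (rule order_trans)
    have "1 \<le> sqrt s" using A(4) by simp
    then have "lam * 1 \<le> lam * sqrt s" using lam_pos by (intro mult_left_mono) auto
    then have eps: "max eps_t eps_c \<le> exp (- 1)" using ep_le e1 lam_pos by linarith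
    have eps_t: "eps_t \<le> 1" and eps_c: "eps_c \<le> 1" using eps exp1 by linarith+
    have "4 * c * (1 + gu) * err = 40 * c * (1 + gu) / a * e" by (simp add: err_def)
    also have "\<dots> \<le> 40 * c * (1 + gu) / a * 1"
      using e_le_1 c par by (intro mult_left_mono) auto
    also have "\<dots> \<le> H" by (simp add: H_def)
    finally have Herr: "4 * c * (1 + gu) * err \<le> H" .
    obtain bt ph N where run: "\<And>T. ilamm_run d L w lam gu phi0 eps_c eps_t T bt ph N"
      "\<And>l. omega d L (weights d w lam (bt l)) (bt (Suc l)) \<le> (if l = 0 then eps_c else eps_t)"
      and N1: "real (N 1) \<le> 4 * c * (1 + gu) * (e * norm bs + c * (norm bs)\<^sup>2) / eps_c\<^sup>2 + 1"
      and N2: "\<And>l. 2 \<le> l \<Longrightarrow> real (N l) \<le> 2 + 2 * (ln H + ln (1 / eps_t)) / rate"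
      using ilamm_run_bound[OF A(8,9) par(1,2) A(12) max.cobounded2 A(13) max.cobounded1 eps_t H Herr]
      by blast
    have "e * norm bs + c * (norm bs)\<^sup>2 \<le> \<bar>B\<bar> + c * B\<^sup>2"
    proof (rule add_mono)
      have "e * norm bs \<le> 1 * norm bs" using e_le_1 by (intro mult_right_mono) auto
      then show "e * norm bs \<le> \<bar>B\<bar>" using A(5) by linarith
      show "c * (norm bs)\<^sup>2 \<le> c * B\<^sup>2" using A(5) c by (intro mult_left_mono power_mono) auto
    qed
    then have "4 * c * (1 + gu) * (e * norm bs + c * (norm bs)\<^sup>2) / eps_c\<^sup>2
        \<le> 4 * c * (1 + gu) * (\<bar>B\<bar> + c * B\<^sup>2) / eps_c\<^sup>2"
      using c par by (intro divide_right_mono mult_left_mono) auto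
    moreover have "1 \<le> 1 / eps_c\<^sup>2" using eps_c A(12) by (simp add: power_le_one)
    ultimately have "real (N 1) \<le> 4 * c * (1 + gu) * (\<bar>B\<bar> + c * B\<^sup>2) / eps_c\<^sup>2 + 1 / eps_c\<^sup>2"
      using N1 by linarith
    then have N1': "real (N 1) \<le> C' * (1 / eps_c\<^sup>2)" by (simp add: C'_def add_divide_distrib)
    define l where "l = ln (1 / eps_t)"
    have "exp 1 \<le> 1 / eps_t"
    proof -
      have "exp 1 * eps_t \<le> exp 1 * exp (- 1)" using eps by (intro mult_left_mono) auto
      then show ?thesis using A(13) by (simp add: pos_le_divide_eq exp_minus)
    qed
    then have l1: "1 \<le> l" unfolding l_def using A(13) by (subst ln_ge_iff) auto
    have N2': "real (N j) \<le> C'' * l" if j: "j \<in> {2..T}" for j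
    proof -
      have "real (N j) \<le> 2 + 2 * (ln H + l) / kappa"
        using N2[of j] j unfolding l_def kappa_def rate_def by simp
      also have "\<dots> \<le> 2 * l + 2 * ((ln H + 1) * l) / kappa"
      proof (intro add_mono divide_right_mono mult_left_mono)
        have "ln H * 1 \<le> ln H * l" using l1 H by (intro mult_left_mono) auto
        then show "ln H + l \<le> (ln H + 1) * l" by (simp add: algebra_simps)
      qed (use l1 kappa in auto)
      also have "\<dots> = C'' * l" by (simp add: C''_def algebra_simps)
      finally show ?thesis .
    qed
    have "{1..T} = insert 1 {2..T}" using A(14) by auto
    then have "real (\<Sum>l=1..T. N l) = real (N 1) + (\<Sum>j=2..T. real (N j))" by simp
    also have "\<dots> \<le> C' * (1 / eps_c\<^sup>2) + (\<Sum>j=2..T. C'' * l)"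
      using N1' N2' by (intro add_mono sum_mono) auto
    also have "(\<Sum>j=2..T. C'' * l) = C'' * (real T - 1) * l" using A(14) by (simp add: of_nat_diff)
    finally have tot: "real (\<Sum>l=1..T. N l) \<le> C' * (1 / eps_c\<^sup>2) + C'' * (real T - 1) * ln (1 / eps_t)"
      by (simp only: l_def)
    have om1: "omega d L (weights d w lam (bt 0)) (bt 1) \<le> eps_c" using run(2)[of 0] by simp
    have "omega d L (weights d w lam (bt (k - 1))) (bt k) \<le> eps_t" if "k \<in> {2..T}" for k
      using run(2)[of "k - 1"] that by (simp split: if_splits)
    then show "\<exists>bt ph N. ilamm_run d L w lam gu phi0 eps_c eps_t T bt ph N \<and>
        omega d L (weights d w lam (bt 0)) (bt 1) \<le> eps_c \<and>
        (\<forall>k\<in>{2..T}. omega d L (weights d w lam (bt (k - 1))) (bt k) \<le> eps_t) \<and>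
        real (\<Sum>l=1..T. N l) \<le> C' * (1 / eps_c\<^sup>2) + C'' * (real T - 1) * ln (1 / eps_t)"
      using run(1) om1 tot by blast
  qed
  then show ?thesis using C' C'' by blast
qed

theorem theorem4p7:
  shows "\<exists>(c_LSE :: real \<Rightarrow> real \<Rightarrow> real) (C_LSE :: real) (c0 :: real \<Rightarrow> real) (K :: real \<Rightarrow> real).
    (\<forall>rho_lo rho_hi. 0 < rho_lo \<and> rho_lo \<le> rho_hi \<longrightarrow> 0 < c_LSE rho_lo rho_hi) \<and>
    0 < C_LSE \<and>
    (\<forall>rho_lo>0. 0 < c0 rho_lo \<and> 0 < K rho_lo) \<and>
    (\<forall>(delta :: real) (gu :: real) (rho_lo :: real) (rho_hi :: real) (rho_c :: real) (B :: real).
      0 < delta \<and> delta < 1 \<and> 1 < gu \<and> 0 < rho_lo \<and> rho_lo \<le> rho_hi \<and> 0 < rho_c \<longrightarrow>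
      (\<exists>phi_max C' C''. 0 < phi_max \<and> 0 < C' \<and> 0 < C'' \<and>
        (\<forall>(phi0 :: real) (d :: nat \<Rightarrow> nat) (L :: nat \<Rightarrow> fvec \<Rightarrow> real) (bs :: nat \<Rightarrow> fvec)
          (w :: nat \<Rightarrow> real \<Rightarrow> real) (r :: nat \<Rightarrow> real) (lam :: nat \<Rightarrow> real)
          (eps_c :: nat \<Rightarrow> real) (eps_t :: nat \<Rightarrow> real) (T :: nat \<Rightarrow> nat).
          0 < phi0 \<and> phi0 \<le> phi_max \<and>
          (\<lambda>n. lam n * sqrt (card (supp (bs n)))) \<longlonglongrightarrow> 0 \<and>
          lesssim eps_c lam \<and>
          lesssim eps_t (\<lambda>n. sqrt (1 / real n)) \<and>
          asymp_eq (\<lambda>n. real (T n)) (\<lambda>n. ln (lam n * sqrt (real n))) \<and>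
          (\<forall>\<^sub>F n in sequentially.
            bs n \<in> Euc (d n) \<and> 1 \<le> card (supp (bs n)) \<and> norm (bs n) \<le> B \<and>
            regular_loss (d n) (L n) (bs n) (r n) \<and>
            LSE (d n) (L n) (bs n) (r n) rho_lo rho_hi (c_LSE rho_lo rho_hi) C_LSE \<and>
            w n \<in> tightening \<and>
            1 / 2 \<le> w n (18 / rho_lo / delta * lam n) \<and>
            (let R = K rho_lo * (norm (bs n) + lam n * sqrt (card (supp (bs n))))
             in rho_c-lipschitz_on (cball (bs n) (R / 2) \<inter> Euc (d n)) (grad (d n) (L n))) \<and>
            0 < lam n \<and> 0 < eps_c n \<and> 0 < eps_t n \<and> 1 \<le> T n \<and>
            4 * (linf_norm (d n) (grad (d n) (L n) (bs n)) + max (eps_t n) (eps_c n)) \<le> lam n \<and>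
            lam n \<le> c0 rho_lo * (r n / sqrt (card (supp (bs n)))))
          \<longrightarrow>
          (\<forall>\<^sub>F n in sequentially.
            \<exists>bt ph N.
              ilamm_run (d n) (L n) (w n) (lam n) gu phi0 (eps_c n) (eps_t n) (T n) bt ph N \<and>
              omega (d n) (L n) (weights (d n) (w n) (lam n) (bt 0)) (bt 1) \<le> eps_c n \<and>
              (\<forall>k\<in>{2..T n}.
                omega (d n) (L n) (weights (d n) (w n) (lam n) (bt (k - 1))) (bt k) \<le> eps_t n) \<and>
              real (\<Sum>l=1..T n. N l)
                \<le> C' * (1 / (eps_c n)\<^sup>2) + C'' * (real (T n) - 1) * ln (1 / eps_t n)))))"
proof (rule exI[of _ "\<lambda>lo hi. 10^6 * (hi / lo)\<^sup>2"], rule exI[of _ 1], rule exI[of _ "\<lambda>lo. lo / 100"],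
    rule exI[of _ "\<lambda>lo. 6 * (1 + 10 / lo)"], intro conjI allI impI, goal_cases)
  case (5 delta gu rho_lo rho_hi rho_c B)
  then have par: "0 < delta" "delta < 1" "1 < gu" "0 < rho_lo" "rho_lo \<le> rho_hi" "0 < rho_c" by simp_all
  obtain C' C'' where C: "0 < C'" "0 < C''" and bound: "iteration_bound delta gu rho_lo rho_hi rho_c B C' C''"
    using iteration_bound_exists[OF par] by blast
  show ?case
  proof (rule exI[of _ rho_lo], rule exI[of _ C'], rule exI[of _ C''],
      intro conjI allI impI par(4) C, goal_cases)
    case (1 phi0 d L bs w r lam eps_c eps_t T)
    note hyps = 1
    have "(\<lambda>n. lam n * sqrt (card (supp (bs n)))) \<longlonglongrightarrow> 0" using hyps by blast
    then have "\<forall>\<^sub>F n in sequentially. lam n * sqrt (card (supp (bs n))) < exp (- 1)"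
      by (rule order_tendstoD) simp
    with hyps[THEN conjunct2, THEN conjunct2, THEN conjunct2, THEN conjunct2, THEN conjunct2, THEN conjunct2]
    show ?case
    proof eventually_elim
      case (elim n)
      have small: "lam n * sqrt (card (supp (bs n))) \<le> exp (- 1)" using elim(2) by (rule less_imp_le)
      show ?case
        by (rule bound[unfolded iteration_bound_def, rule_format,
              OF hyps[THEN conjunct1] hyps[THEN conjunct2, THEN conjunct1] small elim(1)[unfolded Let_def]])
    qed
  qed
qed (auto intro: add_pos_pos)

end
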